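(* The limiting currents $\mathfrak e_\infty(z),\mathfrak f_\infty(z)$ act on functions $F[X]$ as $$\mathfrak e_\infty(z)F[X]=\frac{q^{1/2}}{(1-q)(1-t^{-1})}\frac{C_\infty(q^{1/2}t^{-1}z)}{C_\infty(q^{1/2}z)}F\Big[X+\frac{q^{1/2}-q^{-1/2}}{z}\Big],$$ $$\mathfrak f_\infty(z)F[X]=\frac{q^{-1/2}}{(1-q^{-1})(1-t)}\frac{C_\infty(q^{-1/2}tz)}{C_\infty(q^{-1/2}z)}F\Big[X-\frac{q^{1/2}-q^{-1/2}}{z}\Big].$$ Moreover, the following commutation relations hold: $$[\mathfrak e_\infty(z),\mathfrak f_\infty(w)]=\frac1{g(1,1)}\big\{\delta(z/w)\psi^+_\infty(z)-\delta(qt^{-1}z/w)\psi^-_\infty(z)\big\},$$ $$\mathfrak e_\infty(z)\mathfrak e_\infty(w)=-\frac{g(w,z)}{g(z,w)}\mathfrak e_\infty(w)\mathfrak e_\infty(z),\qquad \mathfrak f_\infty(z)\mathfrak f_\infty(w)=-\frac{g(z,w)}{g(w,z)}\mathfrak f_\infty(w)\mathfrak f_\infty(z),$$ $$\psi^\pm_\infty(z)\mathfrak e_\infty(w)=-\frac{g(w,z)}{g(z,w)}\mathfrak e_\infty(w)\psi^\pm_\infty(z),\qquad \psi^+_\infty(z)\mathfrak f_\infty(w)=-\frac{g(z,w)}{g(w,z)}\mathfrak f_\infty(w)\psi^+_\infty(z),$$ $$\psi^-_\infty(z)\mathfrak f_\infty(w)=-\frac{g(qt^{-1}z,w)}{g(w,qt^{-1}z)}\mathfrak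 f_\infty(w)\psi^-_\infty(z),\qquad \psi^-_\infty(z)\psi^+_\infty(w)=\frac{g(w,z)\,g(qt^{-1}z,w)}{g(z,w)\,g(w,qt^{-1}z)}\psi^+_\infty(w)\psi^-_\infty(z),$$ where $\psi^+_\infty(z)$ is (multiplication by) the power series of $z$ $$\psi^+_\infty(z)=\frac{C_\infty(q^{-1/2}tz)\,C_\infty(q^{1/2}t^{-1}z)}{C_\infty(q^{-1/2}z)\,C_\infty(q^{1/2}z)},$$ and $\psi^-_\infty(z)$ is a power series of $z^{-1}$ acting on symmetric functions $F[X]$ as $$\psi^-_\infty(z)F[X]=F\Big[X+\frac{(q^{1/2}-q^{-1/2})(1-tq^{-1})}{z}\Big].$$ In addition, the Serre relations hold: $$\mathrm{Sym}_{z_1,z_2,z_3}\Big(\frac{z_2}{z_3}\big[\mathfrak e_\infty(z_1),[\mathfrak e_\infty(z_2),\mathfrak e_\infty(z_3)]\big]\Big)=0,\qquad \mathrm{Sym}_{z_1,z_2,z_3}\Big(\frac{z_2}{z_3}\big[\mathfrak f_\infty(z_1),[\mathfrak f_\infty(z_2),\mathfrak f_\infty(z_3)]\big]\Big)=0.$$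
   Context: $q,t$ are generic parameters. $g(z,w)=(z-qw)(z-t^{-1}w)(z-q^{-1}tw)$, $\delta(u)=\sum_{n\in\mathbb Z}u^n$; $\mathrm{Sym}_{z_1,z_2,z_3}$ is the sum over permutations of $z_1,z_2,z_3$. Functions $F[X]$, with $X=(x_1,x_2,\dots)$ an infinite alphabet, are those that can be expressed as formal power series of the power sums $p_k=p_k[X]=\sum_ix_i^k$, $k\in\mathbb Z\setminus\{0\}$, which are algebraically independent. Plethysms: $F\big[X\pm\frac{q^{1/2}-q^{-1/2}}{z}\big]$ means the substitution $p_k\mapsto p_k\pm(q^{k/2}-q^{-k/2})z^{-k}$ for all $k\ne0$, and $F\big[X+\frac{(q^{1/2}-q^{-1/2})(1-tq^{-1})}{z}\big]$ means $p_k\mapsto p_k+(q^{k/2}-q^{-k/2})(1-(tq^{-1})^k)z^{-k}$ for all $k\neq 0$. Also $C_\infty(z)=\prod_{i\ge1}(1-zx_i)=\exp\big(-\sum_{k\ge1}p_kz^k/k\big)$, and ratios of $C_\infty$'s are power series in $z$. Definition of the limiting currents. For finite $N$, the Macdonald current $\mathfrak e(z)=\frac{q^{1/2}}{1-q}\sum_{n\in\mathbb Z}q^{n/2}z^n\sum_{i=1}^Nx_i^n\prod_{j\ne i}\frac{t^{1/2}x_i-t^{-1/2}x_j}{x_i-x_j}\Gamma_i$ (where $\Gamma_i$ is the shift $x_i\mapsto qx_i$) acts on functions $F[X]$ of $X=(x_1,\dots,x_N)$ by $$\mathfrak e(z)F[X]=\frac{q^{1/2}t^{-1/2}}{(1-q)(1-t^{-1})}\Big\{t^{N/2}\frac{C(q^{1/2}t^{-1}z)}{C(q^{1/2}z)}-t^{-N/2}\frac{\widetilde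 C(q^{-1/2}tz^{-1})}{\widetilde C(q^{-1/2}z^{-1})}\Big\}F\Big[X+\frac{q^{1/2}-q^{-1/2}}{z}\Big],$$ with $C(z)=\prod_{i=1}^N(1-zx_i)=\exp(-\sum_{k\ge1}p_kz^k/k)$ and $\widetilde C(z)=\prod_{i=1}^N(1-zx_i^{-1})=\exp(-\sum_{k\ge1}p_{-k}z^k/k)$. Then $\mathfrak e_\infty(z)=\lim_{N\to\infty}t^{(1-N)/2}\mathfrak e(z)$, assuming $|t|>1$, and $\mathfrak f_\infty(z)$ is obtained from $\mathfrak e_\infty(z)$ by the substitution $q\to q^{-1},\ t\to t^{-1}$.
   Formalization: Functions F[X] are taken to be formal power series in the p_k with finitely many monomials in each degree (deg p_k = k), since the plethystic substitutions are undefined on arbitrary series such as the sum of (p_1 p_{-1})^n. *)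

theory Defs
  imports
    "HOL-Computational_Algebra.Polynomial_FPS"
    "HOL-Library.Poly_Mapping"
    "HOL-Library.Product_Plus"
    "HOL-Combinatorics.Permutations"
begin

section \<open>Functions of an infinite alphabet\<close>

text \<open>
  A monomial \<open>\<mu>\<close> stands for the product of the \<open>p\<^sub>k ^ Poly_Mapping.lookup \<mu> k\<close>; the power sums are
  algebraically independent, so they are treated as variables, indexed by the nonzero integers.
\<close>

type_synonym monomial = "int \<Rightarrow>\<^sub>0 nat"
type_synonym ps_poly = "monomial \<Rightarrow>\<^sub>0 complex"
type_synonym ps_series = "monomial \<Rightarrow> complex"

definition weight :: "monomial \<Rightarrow> int" where
  "weight \<mu> = (\<Sum>k\<in>Poly_Mapping.keys \<mu>. k * int (Poly_Mapping.lookup \<mu> k))"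

text \<open>
  The functions \<open>F[X]\<close>: formal power series in the \<open>p\<^sub>k\<close>, \<open>k \<noteq> 0\<close>, having only finitely many
  monomials in each degree, where \<open>p\<^sub>k\<close> has degree \<open>k\<close>. The finiteness is exactly what the
  substitutions \<open>p\<^sub>k \<mapsto> p\<^sub>k + c\<^sub>k z\<^sup>-\<^sup>k\<close> with nonzero \<open>c\<^sub>k\<close> need: without it a coefficient
  of the result is an infinite sum of numbers, as for the sum over \<open>n\<close> of the \<open>(p\<^sub>1 p\<^sub>-\<^sub>1)^n\<close>.
  All power series in the \<open>p\<^sub>k\<close> with \<open>k > 0\<close>, and all polynomials, are included.
\<close>

definition functions_X :: "ps_series set" where
  "functions_X = {F. (\<forall>\<mu>. F \<mu> \<noteq> 0 \<longrightarrow> 0 \<notin> Poly_Mapping.keys \<mu>) \<and>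
                     (\<forall>d. finite {\<mu>. F \<mu> \<noteq> 0 \<and> weight \<mu> = d})}"

definition cst :: "'b::zero \<Rightarrow> 'a::zero \<Rightarrow>\<^sub>0 'b" where
  "cst c = Poly_Mapping.single 0 c"

definition pvar :: "int \<Rightarrow> ps_poly" where
  "pvar k = Poly_Mapping.single (Poly_Mapping.single k 1) 1"

text \<open>
  The image of a monomial under \<open>p\<^sub>k \<mapsto> p\<^sub>k + c\<^sub>k z\<^sup>-\<^sup>k\<close>, as a Laurent polynomial in \<open>z\<close>
  over the polynomials in the \<open>p\<^sub>k\<close>.
\<close>

definition subst_monomial :: "(int \<Rightarrow> complex) \<Rightarrow> monomial \<Rightarrow> (int \<Rightarrow>\<^sub>0 ps_poly)" where
  "subst_monomial c \<mu> =
     (\<Prod>k\<in>Poly_Mapping.keys \<mu>. (cst (pvar k) + Poly_Mapping.single (- k) (cst (c k))) ^ Poly_Mapping.lookup \<mu> k)"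

text \<open>\<open>plethysm c F n\<close> is the coefficient of \<open>z^n\<close> in \<open>F\<close> with \<open>p\<^sub>k \<mapsto> p\<^sub>k + c\<^sub>k z\<^sup>-\<^sup>k\<close>.\<close>

definition plethysm :: "(int \<Rightarrow> complex) \<Rightarrow> ps_series \<Rightarrow> int \<Rightarrow> ps_series" where
  "plethysm c F n \<nu> = Sum_any (\<lambda>\<mu>. F \<mu> * Poly_Mapping.lookup (Poly_Mapping.lookup (subst_monomial c \<mu>) n) \<nu>)"

section \<open>Power series in \<open>z\<close> and in \<open>1/z\<close> acting by multiplication\<close>

definition exp_series :: "ps_poly fps \<Rightarrow> ps_poly fps" where
  "exp_series L = Abs_fps (\<lambda>n. cst (1 / fact n)) oo L"

text \<open>\<open>C_inf\<close> is \<open>C\<^sub>\<infinity>\<close> and \<open>C_tilde\<close> is the same series in the \<open>p\<^sub>-\<^sub>k\<close>;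
  the constant terms of the exponents vanish because \<open>1 / 0 = 0\<close>.\<close>

definition C_inf :: "ps_poly fps" where
  "C_inf = exp_series (- Abs_fps (\<lambda>k. cst (1 / of_nat k) * pvar (int k)))"

definition C_tilde :: "ps_poly fps" where
  "C_tilde = exp_series (- Abs_fps (\<lambda>k. cst (1 / of_nat k) * pvar (- int k)))"

definition scale_arg :: "complex \<Rightarrow> ps_poly fps \<Rightarrow> ps_poly fps" where
  "scale_arg a f = f oo (fps_const (cst a) * fps_X)"

text \<open>Only for denominators with constant coefficient \<open>1\<close>.\<close>

definition ratio :: "ps_poly fps \<Rightarrow> ps_poly fps \<Rightarrow> ps_poly fps" where
  "ratio f g = f * fps_right_inverse g 1"

definition in_z :: "ps_poly fps \<Rightarrow> int \<Rightarrow> ps_poly" where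
  "in_z f l = (if l \<ge> 0 then fps_nth f (nat l) else 0)"

definition in_z_inverse :: "ps_poly fps \<Rightarrow> int \<Rightarrow> ps_poly" where
  "in_z_inverse f l = (if l \<le> 0 then fps_nth f (nat (- l)) else 0)"

text \<open>
  \<open>mult_z A G n\<close> is the coefficient of \<open>z^n\<close> in \<open>A(z) G(z)\<close>. In all uses below the sum is
  finite at each monomial \<open>\<nu>\<close>, since the polynomial \<open>A l\<close> is homogeneous of degree \<open>l\<close> and
  only the monomials dividing \<open>\<nu>\<close> matter.
\<close>

definition mult_z :: "(int \<Rightarrow> ps_poly) \<Rightarrow> (int \<Rightarrow> ps_series) \<Rightarrow> int \<Rightarrow> ps_series" where
  "mult_z A G n \<nu> = Sum_any (\<lambda>l. Poly_Mapping.prod_fun (Poly_Mapping.lookup (A l)) (G (n - l)) \<nu>)"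

section \<open>Currents\<close>

text \<open>
  A current is the family of its modes: \<open>A n\<close> is the coefficient of \<open>z^n\<close> in \<open>A(z)\<close>.
  The parameters are \<open>h = q^(1/2)\<close> and \<open>u = t^(1/2)\<close>.
\<close>

type_synonym operator = "ps_series \<Rightarrow> ps_series"
type_synonym current = "int \<Rightarrow> operator"

definition generic :: "complex \<Rightarrow> complex \<Rightarrow> bool" where
  "generic h u \<longleftrightarrow> h \<noteq> 0 \<and> u \<noteq> 0 \<and> h\<^sup>2 \<noteq> 1 \<and> u\<^sup>2 \<noteq> 1 \<and> h\<^sup>2 \<noteq> u\<^sup>2"

definition shift_coeff :: "complex \<Rightarrow> int \<Rightarrow> complex" where
  "shift_coeff h k = h powi k - h powi (- k)"

text \<open>The Macdonald current for \<open>N\<close> variables, acting on functions \<open>F[X]\<close>.\<close>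

definition e_finite :: "complex \<Rightarrow> complex \<Rightarrow> nat \<Rightarrow> current" where
  "e_finite h u N n F \<nu> =
     (let q = h\<^sup>2; t = u\<^sup>2; G = plethysm (shift_coeff h) F in
      h / u / ((1 - q) * (1 - 1 / t)) *
        (u powi (int N) *
           mult_z (in_z (ratio (scale_arg (h / t) C_inf) (scale_arg h C_inf))) G n \<nu>
       - u powi (- int N) *
           mult_z (in_z_inverse (ratio (scale_arg (t / h) C_tilde) (scale_arg (1 / h) C_tilde))) G n \<nu>))"

text \<open>
  In finitely many variables \<open>x\<^sub>0, \<dots>, x\<^sub>N\<^sub>-\<^sub>1\<close> the operator \<open>e_finite\<close> is the Macdonald
  difference operator \<open>macdonald_current\<close>; this is the theorem \<open>eval_e_finite\<close> below. The
  limit itself has to be taken in \<open>e_finite\<close>, which treats the \<open>p\<^sub>k\<close> as variables that do not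
  depend on \<open>N\<close>.
\<close>

definition power_sum :: "nat \<Rightarrow> (nat \<Rightarrow> complex) \<Rightarrow> int \<Rightarrow> complex" where
  "power_sum N x k = (\<Sum>i<N. x i powi k)"

definition eval_monomial :: "nat \<Rightarrow> (nat \<Rightarrow> complex) \<Rightarrow> monomial \<Rightarrow> complex" where
  "eval_monomial N x \<mu> =
     (\<Prod>k\<in>Poly_Mapping.keys \<mu>. power_sum N x k ^ Poly_Mapping.lookup \<mu> k)"

definition eval_X :: "nat \<Rightarrow> (nat \<Rightarrow> complex) \<Rightarrow> ps_series \<Rightarrow> complex" where
  "eval_X N x F = (\<Sum>\<mu> | F \<mu> \<noteq> 0. F \<mu> * eval_monomial N x \<mu>)"

definition macdonald_current ::
  "complex \<Rightarrow> complex \<Rightarrow> nat \<Rightarrow> int \<Rightarrow> ((nat \<Rightarrow> complex) \<Rightarrow> complex) \<Rightarrow> (nat \<Rightarrow> complex) \<Rightarrow> complex" where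
  "macdonald_current h u N n f x =
     (let q = h\<^sup>2 in
      h / (1 - q) * h powi n *
        (\<Sum>i<N. x i powi n * (\<Prod>j\<in>{..<N} - {i}. (u * x i - x j / u) / (x i - x j)) *
               f (x(i := q * x i))))"

text \<open>
  The limit exists only for \<open>|t| > 1\<close>, whereas \<open>\<ff>\<^sub>\<infinity>\<close> needs \<open>\<ee>\<^sub>\<infinity>\<close> at \<open>1/t\<close>: the
  parameters are generic and the substitution is made in the matrix coefficients, which are
  rational functions of \<open>q^(1/2)\<close> and \<open>t^(1/2)\<close>. So \<open>\<ee>\<^sub>\<infinity>\<close> is the rational function of the
  parameters that agrees with the limit where \<open>|t| > 1\<close>.
\<close>

definition eval2 :: "complex poly poly \<Rightarrow> complex \<Rightarrow> complex \<Rightarrow> complex" where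
  "eval2 P h u = poly (poly P [:u:]) h"

definition rational_in_parameters :: "(complex \<Rightarrow> complex \<Rightarrow> complex) \<Rightarrow> bool" where
  "rational_in_parameters R \<longleftrightarrow>
     (\<exists>P Q. \<forall>h u. generic h u \<longrightarrow> eval2 Q h u \<noteq> 0 \<and> R h u = eval2 P h u / eval2 Q h u)"

definition e_inf :: "complex \<Rightarrow> complex \<Rightarrow> current" where
  "e_inf h u n F \<nu> =
     (THE v. \<exists>R. rational_in_parameters R \<and>
        (\<forall>h' u'. generic h' u' \<and> cmod (u'\<^sup>2) > 1 \<longrightarrow>
           (\<lambda>N. u' powi (1 - int N) * e_finite h' u' N n F \<nu>) \<longlonglongrightarrow> R h' u') \<and>
        v = R h u)"

definition f_inf :: "complex \<Rightarrow> complex \<Rightarrow> current" where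
  "f_inf h u = e_inf (1 / h) (1 / u)"

definition psi_plus_series :: "complex \<Rightarrow> complex \<Rightarrow> ps_poly fps" where
  "psi_plus_series h u =
     (let t = u\<^sup>2 in
      ratio (scale_arg (t / h) C_inf * scale_arg (h / t) C_inf)
            (scale_arg (1 / h) C_inf * scale_arg h C_inf))"

definition psi_plus :: "complex \<Rightarrow> complex \<Rightarrow> current" where
  "psi_plus h u n F = Poly_Mapping.prod_fun (Poly_Mapping.lookup (in_z (psi_plus_series h u) n)) F"

definition psi_minus :: "complex \<Rightarrow> complex \<Rightarrow> current" where
  "psi_minus h u n F =
     plethysm (\<lambda>k. shift_coeff h k * (1 - (u\<^sup>2 / h\<^sup>2) powi k)) F n"

section \<open>Relations between currents\<close>

definition commutator :: "operator \<Rightarrow> operator \<Rightarrow> operator" where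
  "commutator A B F = (\<lambda>\<nu>. A (B F) \<nu> - B (A F) \<nu>)"

text \<open>
  \<open>D m n\<close> is the coefficient of \<open>z^m w^n\<close> of a formal distribution \<open>D(z,w)\<close>, and \<open>times_zw P D\<close>
  is its product with the Laurent polynomial \<open>P(z,w)\<close>.
\<close>

type_synonym laurent_zw = "int \<times> int \<Rightarrow>\<^sub>0 complex"

definition zvar :: laurent_zw where
  "zvar = Poly_Mapping.single (1, 0) 1"

definition wvar :: laurent_zw where
  "wvar = Poly_Mapping.single (0, 1) 1"

definition times_zw :: "laurent_zw \<Rightarrow> (int \<Rightarrow> int \<Rightarrow> ps_series) \<Rightarrow> (int \<Rightarrow> int \<Rightarrow> ps_series)" where
  "times_zw P D m n \<nu> = (\<Sum>k\<in>Poly_Mapping.keys P. Poly_Mapping.lookup P k * D (m - fst k) (n - snd k) \<nu>)"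

text \<open>\<open>\<iota>\<close> embeds the scalars into the ring containing the arguments of \<open>g\<close>.\<close>

definition gpoly :: "(complex \<Rightarrow> 'a::comm_ring_1) \<Rightarrow> complex \<Rightarrow> complex \<Rightarrow> 'a \<Rightarrow> 'a \<Rightarrow> 'a" where
  "gpoly \<iota> q t z w = (z - \<iota> q * w) * (z - \<iota> (1 / t) * w) * (z - \<iota> (t / q) * w)"

text \<open>The relation \<open>A(z) B(w) = (P / Q) B(w) A(z)\<close>, an identity of formal distributions after
  multiplication by \<open>Q\<close>. (The two sides of a relation between the \<open>\<ee>\<close>'s, or between the \<open>\<ff>\<close>'s,
  are expansions in opposite regions, so the quotient has no direct meaning there. When \<open>A\<close> is
  \<open>\<psi>\<^sup>\<plusminus>\<close> the same relation holds with \<open>P / Q\<close> expanded in \<open>(z/w)\<^sup>\<plusminus>\<^sup>1\<close>, because \<open>Q\<close> is invertible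
  there.)\<close>

definition exchange :: "laurent_zw \<Rightarrow> laurent_zw \<Rightarrow> current \<Rightarrow> current \<Rightarrow> bool" where
  "exchange P Q A B \<longleftrightarrow>
     (\<forall>F\<in>functions_X. times_zw Q (\<lambda>m n. A m (B n F)) = times_zw P (\<lambda>m n. B n (A m F)))"

text \<open>The coefficient of \<open>z^m w^n\<close> in \<open>\<delta>(c z/w) A(z)\<close>, where \<open>\<delta>(c z/w)\<close> is the sum of the
  \<open>c^j z^j w^-j\<close> over all integers \<open>j\<close>.\<close>

definition delta_times :: "complex \<Rightarrow> current \<Rightarrow> int \<Rightarrow> int \<Rightarrow> operator" where
  "delta_times c A m n F = (\<lambda>\<nu>. c powi (- n) * A (m + n) F \<nu>)"

text \<open>The coefficient of \<open>z\<^sub>1^a z\<^sub>2^b z\<^sub>3^c\<close> in \<open>(z\<^sub>2/z\<^sub>3) [A(z\<^sub>1), [A(z\<^sub>2), A(z\<^sub>3)]]\<close>.\<close>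

definition serre_term :: "current \<Rightarrow> int \<Rightarrow> int \<Rightarrow> int \<Rightarrow> operator" where
  "serre_term A a b c = commutator (A a) (commutator (A (b - 1)) (A (c + 1)))"

text \<open>Permuting the variables of a distribution permutes the exponents of its coefficients.\<close>

definition serre_relation :: "current \<Rightarrow> bool" where
  "serre_relation A \<longleftrightarrow>
     (\<forall>F\<in>functions_X. \<forall>n :: nat \<Rightarrow> int. \<forall>\<nu>.
        (\<Sum>\<sigma> | \<sigma> permutes {1, 2, 3}. serre_term A (n (\<sigma> 1)) (n (\<sigma> 2)) (n (\<sigma> 3)) F \<nu>) = 0)"

section \<open>The finite currents are the Macdonald difference operators\<close>

lemma poly_mapping_induct_add:
  assumes "P 0" and "\<And>f a b. P f \<Longrightarrow> P (f + Poly_Mapping.single a b)"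
  shows "P (f :: 'a \<Rightarrow>\<^sub>0 'b::comm_monoid_add)"
proof (induction f rule: update_induct)
  case (update f a b)
  have "Poly_Mapping.update a b f = f + Poly_Mapping.single a b"
    using update(1)
    by (intro poly_mapping_eqI) (auto simp: lookup_update lookup_add lookup_single in_keys_iff when_def)
  then show ?case using assms(2) update by simp
qed (rule assms(1))

definition hom_to_complex :: "('b::comm_ring_1 \<Rightarrow> complex) \<Rightarrow> bool" where
  "hom_to_complex \<phi> \<longleftrightarrow> \<phi> 1 = 1 \<and> (\<forall>a b. \<phi> (a + b) = \<phi> a + \<phi> b) \<and> (\<forall>a b. \<phi> (a * b) = \<phi> a * \<phi> b)"

definition eval_poly_mapping ::
  "('b::comm_ring_1 \<Rightarrow> complex) \<Rightarrow> ('a::comm_monoid_add \<Rightarrow> complex) \<Rightarrow> ('a \<Rightarrow>\<^sub>0 'b) \<Rightarrow> complex" where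
  "eval_poly_mapping \<phi> m P = (\<Sum>k\<in>Poly_Mapping.keys P. \<phi> (Poly_Mapping.lookup P k) * m k)"

lemma hom_to_complexD:
  assumes "hom_to_complex \<phi>"
  shows "\<phi> 1 = 1" "\<phi> 0 = 0" "\<phi> (a + b) = \<phi> a + \<phi> b" "\<phi> (a * b) = \<phi> a * \<phi> b"
    "\<phi> (- a) = - \<phi> a" "\<phi> (a - b) = \<phi> a - \<phi> b" "\<phi> (a ^ n) = \<phi> a ^ n"
    "\<phi> (sum f S) = (\<Sum>s\<in>S. \<phi> (f s))" "\<phi> (prod f S) = (\<Prod>s\<in>S. \<phi> (f s))"
proof -
  have add: "\<phi> (a + b) = \<phi> a + \<phi> b" and mul: "\<phi> (a * b) = \<phi> a * \<phi> b" and one: "\<phi> 1 = 1" for a b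
    using assms by (auto simp: hom_to_complex_def)
  have zero: "\<phi> 0 = 0" using add[of 0 0] by simp
  have neg: "\<phi> (- a) = - \<phi> a" for a
    using add[of a "- a"] zero by (simp add: eq_neg_iff_add_eq_0 add.commute)
  show "\<phi> 1 = 1" "\<phi> 0 = 0" "\<phi> (a + b) = \<phi> a + \<phi> b" "\<phi> (a * b) = \<phi> a * \<phi> b"
    "\<phi> (- a) = - \<phi> a" "\<phi> (a - b) = \<phi> a - \<phi> b"
    using add[of a "- b"] by (auto simp: add mul one zero neg)
  show "\<phi> (a ^ n) = \<phi> a ^ n" by (induction n) (auto simp: one mul)
  show "\<phi> (sum f S) = (\<Sum>s\<in>S. \<phi> (f s))" by (induction S rule: infinite_finite_induct) (auto simp: zero add)
  show "\<phi> (prod f S) = (\<Prod>s\<in>S. \<phi> (f s))" by (induction S rule: infinite_finite_induct) (auto simp: one mul)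
qed

lemma eval_poly_mapping_superset:
  assumes "hom_to_complex \<phi>" "finite S" "Poly_Mapping.keys P \<subseteq> S"
  shows "eval_poly_mapping \<phi> m P = (\<Sum>k\<in>S. \<phi> (Poly_Mapping.lookup P k) * m k)"
  unfolding eval_poly_mapping_def
  by (rule sum.mono_neutral_left) (use assms in \<open>auto simp: in_keys_iff hom_to_complexD(2)\<close>)

lemma eval_poly_mapping_add:
  assumes "hom_to_complex \<phi>"
  shows "eval_poly_mapping \<phi> m (P + Q) = eval_poly_mapping \<phi> m P + eval_poly_mapping \<phi> m Q"
proof -
  let ?S = "Poly_Mapping.keys P \<union> Poly_Mapping.keys Q"
  have "Poly_Mapping.keys (P + Q) \<subseteq> ?S" by (rule Poly_Mapping.keys_add)
  then show ?thesis
    by (simp add: eval_poly_mapping_superset[OF assms, of ?S] lookup_add hom_to_complexD[OF assms]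
        distrib_right sum.distrib)
qed

lemma eval_poly_mapping_single:
  assumes "hom_to_complex \<phi>"
  shows "eval_poly_mapping \<phi> m (Poly_Mapping.single k c) = \<phi> c * m k"
  by (subst eval_poly_mapping_superset[OF assms, of "{k}"]) (auto simp: split: if_splits)

lemma eval_poly_mapping_mult:
  assumes "hom_to_complex \<phi>" "\<And>a b. m (a + b) = m a * m b"
  shows "eval_poly_mapping \<phi> m (P * Q) = eval_poly_mapping \<phi> m P * eval_poly_mapping \<phi> m Q"
proof (induction P rule: poly_mapping_induct_add)
  case 1
  then show ?case by (simp add: eval_poly_mapping_def)
next
  case (2 P a c)
  have "eval_poly_mapping \<phi> m (Poly_Mapping.single a c * Q) = \<phi> c * m a * eval_poly_mapping \<phi> m Q"
  proof (induction Q rule: poly_mapping_induct_add)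
    case 1
    then show ?case by (simp add: eval_poly_mapping_def)
  next
    case (2 Q b d)
    then show ?case
      by (simp add: distrib_left mult_single eval_poly_mapping_add[OF assms(1)] assms
          eval_poly_mapping_single[OF assms(1)] hom_to_complexD[OF assms(1)])
  qed
  with 2 show ?case
    by (simp add: distrib_right eval_poly_mapping_add[OF assms(1)] eval_poly_mapping_single[OF assms(1)])
qed

lemma hom_to_complex_eval_poly_mapping:
  assumes "hom_to_complex \<phi>" "m 0 = 1" "\<And>a b. m (a + b) = m a * m b"
  shows "hom_to_complex (eval_poly_mapping \<phi> m)"
  unfolding hom_to_complex_def
proof (intro conjI allI)
  have "eval_poly_mapping \<phi> m (Poly_Mapping.single 0 1) = 1"
    by (simp only: eval_poly_mapping_single[OF assms(1)]) (simp add: assms hom_to_complexD[OF assms(1)])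
  then show "eval_poly_mapping \<phi> m 1 = 1" by simp
qed (simp_all add: eval_poly_mapping_add eval_poly_mapping_mult assms)

lemma hom_to_complex_id: "hom_to_complex id" "hom_to_complex (\<lambda>a. a)"
  by (auto simp: hom_to_complex_def)

lemma eval_monomial_superset:
  assumes "finite S" "Poly_Mapping.keys \<mu> \<subseteq> S"
  shows "eval_monomial N x \<mu> = (\<Prod>k\<in>S. power_sum N x k ^ Poly_Mapping.lookup \<mu> k)"
  unfolding eval_monomial_def
  by (rule prod.mono_neutral_left) (use assms in \<open>auto simp: in_keys_iff\<close>)

lemma eval_monomial_hom:
  "eval_monomial N x 0 = 1"
  "eval_monomial N x (\<mu> + \<nu>) = eval_monomial N x \<mu> * eval_monomial N x \<nu>"
proof -
  show "eval_monomial N x 0 = 1" by (simp add: eval_monomial_def)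
  let ?S = "Poly_Mapping.keys \<mu> \<union> Poly_Mapping.keys \<nu>"
  have "Poly_Mapping.keys (\<mu> + \<nu>) \<subseteq> ?S" by (rule Poly_Mapping.keys_add)
  then show "eval_monomial N x (\<mu> + \<nu>) = eval_monomial N x \<mu> * eval_monomial N x \<nu>"
    by (simp add: eval_monomial_superset[of ?S] lookup_add power_add prod.distrib)
qed

definition eval_ps :: "nat \<Rightarrow> (nat \<Rightarrow> complex) \<Rightarrow> ps_poly \<Rightarrow> complex" where
  "eval_ps N x = eval_poly_mapping id (eval_monomial N x)"

lemma hom_eval_ps: "hom_to_complex (eval_ps N x)"
  unfolding eval_ps_def
  by (rule hom_to_complex_eval_poly_mapping) (auto simp: eval_monomial_hom hom_to_complex_id)

lemmas eval_ps_simps = hom_to_complexD[OF hom_eval_ps]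

lemma eval_ps_cst [simp]: "eval_ps N x (cst c) = c"
  by (simp add: eval_ps_def cst_def eval_poly_mapping_single[OF hom_to_complex_id(1)] eval_monomial_hom)

lemma eval_ps_pvar [simp]: "eval_ps N x (pvar k) = power_sum N x k"
  by (simp add: eval_ps_def pvar_def eval_poly_mapping_single[OF hom_to_complex_id(1)] eval_monomial_def)

lemma eval_X_lookup: "eval_X N x (Poly_Mapping.lookup P) = eval_ps N x P"
  by (simp add: eval_X_def eval_ps_def eval_poly_mapping_def Poly_Mapping.keys.rep_eq)

definition eval_fps :: "nat \<Rightarrow> (nat \<Rightarrow> complex) \<Rightarrow> ps_poly fps \<Rightarrow> complex fps" where
  "eval_fps N x f = Abs_fps (\<lambda>n. eval_ps N x (fps_nth f n))"

lemma eval_fps_mult: "eval_fps N x (f * g) = eval_fps N x f * eval_fps N x g"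
  by (rule fps_ext) (simp add: eval_fps_def fps_mult_nth eval_ps_simps)

lemma eval_fps_1: "eval_fps N x 1 = 1"
  by (rule fps_ext) (simp add: eval_fps_def eval_ps_simps)

lemma eval_fps_power: "eval_fps N x (f ^ n) = eval_fps N x f ^ n"
  by (induction n) (simp_all add: eval_fps_mult eval_fps_1)

lemma eval_fps_compose: "eval_fps N x (f oo g) = eval_fps N x f oo eval_fps N x g"
proof (rule fps_ext)
  fix n
  have "eval_ps N x (fps_nth (g ^ i) n) = fps_nth (eval_fps N x g ^ i) n" for i
    by (simp only: eval_fps_power[symmetric]) (simp add: eval_fps_def)
  then show "fps_nth (eval_fps N x (f oo g)) n = fps_nth (eval_fps N x f oo eval_fps N x g) n"
    by (simp add: fps_compose_nth eval_fps_def[of N x f] eval_fps_def[of N x "f oo g"] eval_ps_simps)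
qed

lemma exp_power_sums:
  fixes y :: "nat \<Rightarrow> complex"
  shows "fps_exp 1 oo (- Abs_fps (\<lambda>k. 1 / of_nat k * (\<Sum>i<N. y i ^ k))) =
         (\<Prod>i<N. 1 - fps_const (y i) * fps_X)"
proof -
  define L where "L = - Abs_fps (\<lambda>k. 1 / of_nat k * (\<Sum>i<N. y i ^ k))"
  define G where "G = (\<lambda>n. \<Prod>i<n. 1 - fps_const (y i) * fps_X)"
  define D where "D = (\<lambda>n. - Abs_fps (\<lambda>k. (\<Sum>i<n. y i ^ Suc k)))"
  have L0: "fps_nth L 0 = 0" by (simp add: L_def)
  have "fps_deriv L = D N"
    by (rule fps_ext) (simp add: L_def D_def del: power_Suc of_nat_Suc)
  then have dE: "fps_deriv (fps_exp 1 oo L) = (fps_exp 1 oo L) * D N"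
    by (simp add: fps_compose_deriv[OF L0])
  have gp: "Abs_fps (\<lambda>k. c ^ Suc k) * (1 - fps_const c * fps_X) = fps_const c" for c :: complex
  proof (rule fps_ext)
    fix n show "fps_nth (Abs_fps (\<lambda>k. c ^ Suc k) * (1 - fps_const c * fps_X)) n = fps_nth (fps_const c) n"
      by (cases n) (simp_all add: right_diff_distrib mult.assoc[symmetric] fps_X_mult_right_nth)
  qed
  have dG: "fps_deriv (G n) = G n * D n" for n
  proof (induction n)
    case 0
    then show ?case by (simp add: G_def D_def fps_eq_iff)
  next
    case (Suc n)
    have D: "D (Suc n) = D n - Abs_fps (\<lambda>k. y n ^ Suc k)"
      by (rule fps_ext) (simp add: D_def)
    have G: "G (Suc n) = G n * (1 - fps_const (y n) * fps_X)" by (simp add: G_def)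
    have "fps_deriv (G (Suc n)) = G n * D n * (1 - fps_const (y n) * fps_X) - G n * fps_const (y n)"
      unfolding G by (simp add: Suc algebra_simps)
    also have "\<dots> = G n * D n * (1 - fps_const (y n) * fps_X) -
        G n * (Abs_fps (\<lambda>k. y n ^ Suc k) * (1 - fps_const (y n) * fps_X))"
      by (simp only: gp)
    also have "\<dots> = G n * (1 - fps_const (y n) * fps_X) * (D n - Abs_fps (\<lambda>k. y n ^ Suc k))"
      by (simp only: ring_class.ring_distribs mult_ac) (simp only: algebra_simps)
    finally show ?case by (simp add: D G)
  qed
  have G0: "fps_nth (G n) 0 = 1" for n
    by (induction n) (simp_all add: G_def)
  define E where "E = fps_exp 1 oo L"
  have E0: "fps_nth E 0 = 1" by (simp add: E_def)
  have "fps_nth E n = fps_nth (G N) n" for n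
  proof (induction n rule: less_induct)
    case (less n)
    show ?case
    proof (cases n)
      case (Suc m)
      have "of_nat (Suc m) * fps_nth E (Suc m) = fps_nth (fps_deriv E) m" by simp
      also have "\<dots> = (\<Sum>i=0..m. fps_nth E i * fps_nth (D N) (m - i))"
        unfolding E_def dE by (simp add: fps_mult_nth)
      also have "\<dots> = (\<Sum>i=0..m. fps_nth (G N) i * fps_nth (D N) (m - i))"
        using less Suc by (intro sum.cong) auto
      also have "\<dots> = fps_nth (fps_deriv (G N)) m" by (simp only: dG fps_mult_nth)
      also have "\<dots> = of_nat (Suc m) * fps_nth (G N) (Suc m)" by simp
      finally show ?thesis using Suc by (simp del: of_nat_Suc)
    qed (simp add: E0 G0)
  qed
  then show ?thesis by (simp add: fps_eq_iff E_def L_def G_def)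
qed

lemma eval_C:
  "eval_fps N x C_inf = (\<Prod>i<N. 1 - fps_const (x i) * fps_X)"
  "eval_fps N x C_tilde = (\<Prod>i<N. 1 - fps_const (1 / x i) * fps_X)"
proof -
  have e: "eval_fps N x (Abs_fps (\<lambda>n. cst (1 / fact n))) = fps_exp 1"
    by (rule fps_ext) (simp add: eval_fps_def)
  have "eval_fps N x (- Abs_fps (\<lambda>k. cst (1 / of_nat k) * pvar (int k))) =
        - Abs_fps (\<lambda>k. 1 / of_nat k * (\<Sum>i<N. x i ^ k))"
    by (rule fps_ext) (simp add: eval_fps_def eval_ps_simps power_sum_def)
  then show "eval_fps N x C_inf = (\<Prod>i<N. 1 - fps_const (x i) * fps_X)"
    by (simp only: C_inf_def exp_series_def eval_fps_compose e exp_power_sums)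
  have "eval_fps N x (- Abs_fps (\<lambda>k. cst (1 / of_nat k) * pvar (- int k))) =
        - Abs_fps (\<lambda>k. 1 / of_nat k * (\<Sum>i<N. (1 / x i) ^ k))"
    by (rule fps_ext) (simp add: eval_fps_def eval_ps_simps power_sum_def power_int_minus field_simps)
  then show "eval_fps N x C_tilde = (\<Prod>i<N. 1 - fps_const (1 / x i) * fps_X)"
    by (simp only: C_tilde_def exp_series_def eval_fps_compose e exp_power_sums)
qed

lemma eval_scale_arg:
  "eval_fps N x (scale_arg a f) = eval_fps N x f oo (fps_const a * fps_X)"
proof -
  have "eval_fps N x (fps_const (cst a) * fps_X) = fps_const a * fps_X"
    by (rule fps_ext) (simp add: eval_fps_def fps_X_def eval_ps_simps)
  then show ?thesis by (simp add: scale_arg_def eval_fps_compose)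
qed

lemma eval_scale_C:
  "eval_fps N x (scale_arg a C_inf) = (\<Prod>i<N. 1 - fps_const (a * x i) * fps_X)"
  "eval_fps N x (scale_arg a C_tilde) = (\<Prod>i<N. 1 - fps_const (a / x i) * fps_X)"
proof -
  have *: "(\<Prod>i<N. 1 - fps_const (y i) * fps_X) oo (fps_const a * fps_X) =
        (\<Prod>i<N. 1 - fps_const (a * y i) * fps_X)" for y :: "nat \<Rightarrow> complex"
  proof -
    have "(1 - fps_const b * fps_X) oo (fps_const a * fps_X) = 1 - fps_const (a * b) * fps_X" for b
      unfolding fps_compose_linear by (rule fps_ext) (simp add: fps_X_def)
    then show ?thesis by (simp add: fps_compose_prod_distrib)
  qed
  show "eval_fps N x (scale_arg a C_inf) = (\<Prod>i<N. 1 - fps_const (a * x i) * fps_X)"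
    by (simp only: eval_scale_arg eval_C *)
  show "eval_fps N x (scale_arg a C_tilde) = (\<Prod>i<N. 1 - fps_const (a / x i) * fps_X)"
    by (simp only: eval_scale_arg eval_C *) simp
qed

lemma partial_fractions:
  fixes a :: complex
  assumes inj: "inj_on y {..<N}" and nz: "\<And>i. i < N \<Longrightarrow> y i \<noteq> 0"
    and R: "R * (\<Prod>i<N. 1 - fps_const (y i) * fps_X) = (\<Prod>i<N. 1 - fps_const (a * y i) * fps_X)"
  shows "fps_nth R l =
    (if l = 0 then a ^ N else 0) +
    (\<Sum>i<N. (1 - a) * (\<Prod>j\<in>{..<N} - {i}. (y i - a * y j) / (y i - y j)) * y i ^ l)"
proof -
  define c where "c = (\<lambda>i. (1 - a) * (\<Prod>j\<in>{..<N} - {i}. (y i - a * y j) / (y i - y j)))"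
  define p where "p = (\<Prod>i<N. [:1, - (a * y i):]) - smult (a ^ N) (\<Prod>i<N. [:1, - y i:]) -
    (\<Sum>i<N. smult (c i) (\<Prod>j\<in>{..<N} - {i}. [:1, - y j:]))"
  have p0: "p = 0"
  proof (cases "N = 0")
    case True
    then show ?thesis by (simp add: p_def)
  next
    case False
    have lin: "degree (\<Prod>j\<in>S. [:1, - f j:]) \<le> card S \<and> coeff (\<Prod>j\<in>S. [:1, - f j:]) (card S) = (\<Prod>j\<in>S. - f j)"
      if "finite S" for S :: "nat set" and f :: "nat \<Rightarrow> complex"
      using that
    proof (induction S)
      case (insert s S)
      then have "degree (\<Prod>j\<in>insert s S. [:1, - f j:]) \<le> card (insert s S)"
        using degree_mult_le[of "[:1, - f s:]" "\<Prod>j\<in>S. [:1, - f j:]"] by (auto split: if_splits)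
      moreover have "coeff (\<Prod>j\<in>S. [:1, - f j:]) (Suc (card S)) = 0"
        using insert by (intro coeff_eq_0) auto
      then have "coeff (\<Prod>j\<in>insert s S. [:1, - f j:]) (card (insert s S)) = (\<Prod>j\<in>insert s S. - f j)"
        using insert by simp
      ultimately show ?case by blast
    qed simp
    have deg: "degree p < N"
    proof -
      have d1: "degree (\<Prod>i<N. [:1, - (a * y i):]) \<le> N"
        and d2: "degree (\<Prod>i<N. [:1, - y i:]) \<le> N"
        using lin[of "{..<N}" "\<lambda>i. a * y i"] lin[of "{..<N}" y] by simp_all
      have d3: "degree (smult (c i) (\<Prod>j\<in>{..<N} - {i}. [:1, - y j:])) < N" if "i < N" for i
        using lin[of "{..<N} - {i}" y] that False
        by (intro le_less_trans[OF degree_smult_le]) auto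
      then have d3: "degree (\<Sum>i<N. smult (c i) (\<Prod>j\<in>{..<N} - {i}. [:1, - y j:])) < N"
        using False by (intro degree_sum_less) auto
      have "degree p \<le> N"
        unfolding p_def using d1 d2 d3
        by (intro degree_diff_le) (auto intro: order.trans[OF degree_smult_le])
      moreover have "coeff p N = 0"
        using lin[of "{..<N}" "\<lambda>i. a * y i"] lin[of "{..<N}" y] d3
        unfolding p_def by (simp add: coeff_eq_0 prod_uminus prod.distrib)
      ultimately show ?thesis
        using False by (metis leading_coeff_0_iff degree_0 le_neq_implies_less gr0I)
    qed
    have roots: "poly p (1 / y i) = 0" if i: "i < N" for i
    proof -
      have "(\<Sum>k<N. c k * (\<Prod>j\<in>{..<N} - {k}. 1 - y j / y i)) =
            (\<Sum>k\<in>{i}. c k * (\<Prod>j\<in>{..<N} - {k}. 1 - y j / y i))"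
        using i nz by (intro sum.mono_neutral_right) auto
      also have "\<dots> = (1 - a) * (\<Prod>j\<in>{..<N} - {i}. (y i - a * y j) / (y i - y j) * (1 - y j / y i))"
        by (simp only: c_def sum.insert sum.empty finite.emptyI empty_iff not_False_eq_True prod.distrib
            mult.assoc add_0_right)
      also have "(\<Prod>j\<in>{..<N} - {i}. (y i - a * y j) / (y i - y j) * (1 - y j / y i)) =
                 (\<Prod>j\<in>{..<N} - {i}. 1 - a * y j / y i)"
      proof (rule prod.cong)
        fix j assume "j \<in> {..<N} - {i}"
        then have "y i - y j \<noteq> 0" "y i \<noteq> 0" using inj nz i by (auto dest: inj_onD)
        then have "1 - y j / y i = (y i - y j) / y i" "1 - a * y j / y i = (y i - a * y j) / y i"
          by (simp_all add: diff_divide_distrib)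
        then show "(y i - a * y j) / (y i - y j) * (1 - y j / y i) = 1 - a * y j / y i"
          using \<open>y i - y j \<noteq> 0\<close> by simp
      qed simp
      also have "(1 - a) * \<dots> = (\<Prod>j<N. 1 - a * y j / y i)"
        using i nz by (subst prod.remove[of _ i]) auto
      moreover have "(\<Prod>j<N. 1 - y j / y i) = 0"
        using i nz by (auto intro!: prod_zero)
      ultimately show ?thesis
        by (simp add: p_def poly_prod poly_sum)
    qed
    show ?thesis
    proof (rule ccontr)
      assume "p \<noteq> 0"
      have "card ((\<lambda>i. 1 / y i) ` {..<N}) = N"
        using inj by (subst card_image) (auto simp: inj_on_def)
      moreover have "card ((\<lambda>i. 1 / y i) ` {..<N}) \<le> card {z. poly p z = 0}"
        using roots by (intro card_mono poly_roots_finite[OF \<open>p \<noteq> 0\<close>]) auto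
      moreover have "card {z. poly p z = 0} \<le> degree p"
        by (rule card_poly_roots_bound[OF \<open>p \<noteq> 0\<close>])
      ultimately show False using deg by simp
    qed
  qed
  define H where "H = fps_const (a ^ N) + (\<Sum>i<N. fps_const (c i) * Abs_fps (\<lambda>k. y i ^ k))"
  define P where "P = (\<lambda>S. \<Prod>i\<in>S. 1 - fps_const (y i) * fps_X)"
  have gp: "Abs_fps (\<lambda>k. b ^ k) * (1 - fps_const b * fps_X) = 1" for b :: complex
  proof (rule fps_ext)
    fix n show "fps_nth (Abs_fps (\<lambda>k. b ^ k) * (1 - fps_const b * fps_X)) n = fps_nth 1 n"
      by (cases n) (simp_all add: right_diff_distrib mult.assoc[symmetric] fps_X_mult_right_nth)
  qed
  have term_eq: "fps_const (c i) * Abs_fps (\<lambda>k. y i ^ k) * P {..<N} = fps_const (c i) * P ({..<N} - {i})"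
    if "i < N" for i
  proof -
    have "P {..<N} = (1 - fps_const (y i) * fps_X) * P ({..<N} - {i})"
      unfolding P_def using that by (subst prod.remove[of _ i]) auto
    then have "fps_const (c i) * Abs_fps (\<lambda>k. y i ^ k) * P {..<N} =
      fps_const (c i) * (Abs_fps (\<lambda>k. y i ^ k) * (1 - fps_const (y i) * fps_X)) * P ({..<N} - {i})"
      by (simp only: mult.assoc)
    then show ?thesis by (simp only: gp mult_1_right)
  qed
  have "H * P {..<N} = fps_const (a ^ N) * P {..<N} + (\<Sum>i<N. fps_const (c i) * P ({..<N} - {i}))"
    unfolding H_def by (simp add: distrib_right sum_distrib_right term_eq)
  also have "\<dots> = (\<Prod>i<N. 1 - fps_const (a * y i) * fps_X)"
  proof -
    have l: "fps_of_poly [:1, - b:] = 1 - fps_const b * fps_X" for b :: complex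
      by (simp only: fps_of_poly_linear') simp
    have "fps_of_poly p = 0" by (simp add: p0)
    then show ?thesis
      unfolding p_def P_def
      by (simp only: fps_of_poly_diff fps_of_poly_prod fps_of_poly_sum fps_of_poly_smult l)
         (simp add: algebra_simps)
  qed
  finally have "H * P {..<N} = R * P {..<N}" using R by (simp add: P_def)
  moreover have "fps_nth (P S) 0 = 1" if "finite S" for S
    using that unfolding P_def by (induction S) simp_all
  then have "P {..<N} \<noteq> 0" by (metis finite_lessThan fps_zero_nth zero_neq_one)
  ultimately have "R = H" by simp
  then show ?thesis
    by (simp add: H_def c_def fps_sum_nth)
qed

lemma eval_ratio:
  assumes "fps_nth g 0 = 1"
  shows "eval_fps N x (ratio f g) * eval_fps N x g = eval_fps N x f"
proof -
  have "ratio f g * g = f * (g * fps_right_inverse g 1)" by (simp add: ratio_def mult_ac)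
  also have "g * fps_right_inverse g 1 = 1" by (rule fps_right_inverse) (simp add: assms)
  finally show ?thesis by (simp add: eval_fps_mult[symmetric])
qed

lemma scale_C_nth_0: "fps_nth (scale_arg a C_inf) 0 = 1" "fps_nth (scale_arg a C_tilde) 0 = 1"
  by (simp_all add: scale_arg_def C_inf_def C_tilde_def exp_series_def fps_compose_nth cst_def)

lemma bracket_mode:
  assumes "generic h u" "inj_on x {..<N}" "\<And>i. i < N \<Longrightarrow> x i \<noteq> 0" "t = u\<^sup>2"
  shows "u powi (int N) * eval_ps N x (in_z (ratio (scale_arg (h / t) C_inf) (scale_arg h C_inf)) l) -
         u powi (- int N) * eval_ps N x
           (in_z_inverse (ratio (scale_arg (t / h) C_tilde) (scale_arg (1 / h) C_tilde)) l) =
         u * (1 - 1 / t) *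
           (\<Sum>i<N. (\<Prod>j\<in>{..<N} - {i}. (u * x i - x j / u) / (x i - x j)) * (h * x i) powi l)"
proof -
  have gen: "h \<noteq> 0" "u \<noteq> 0" "t \<noteq> 0" using assms(1,4) by (auto simp: generic_def)
  define y where "y = (\<lambda>i. h * x i)"
  define K where "K = (\<lambda>i. \<Prod>j\<in>{..<N} - {i}. (u * x i - x j / u) / (x i - x j))"
  define R where "R = eval_fps N x (ratio (scale_arg (h / t) C_inf) (scale_arg h C_inf))"
  define R' where "R' = eval_fps N x (ratio (scale_arg (t / h) C_tilde) (scale_arg (1 / h) C_tilde))"
  have y: "inj_on y {..<N}" "\<And>i. i < N \<Longrightarrow> y i \<noteq> 0"
    "inj_on (\<lambda>i. 1 / y i) {..<N}" "\<And>i. i < N \<Longrightarrow> 1 / y i \<noteq> 0"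
    using assms(2,3) gen by (auto simp: y_def inj_on_def)
  have dist: "y i \<noteq> y j" "x i \<noteq> x j" if "i < N" "j \<in> {..<N} - {i}" for i j
    using y(1) assms(2) that by (auto dest: inj_onD)
  have R: "fps_nth R l = (if l = 0 then (1 / t) ^ N else 0) +
    (\<Sum>i<N. (1 - 1 / t) * (\<Prod>j\<in>{..<N} - {i}. (y i - 1 / t * y j) / (y i - y j)) * y i ^ l)" for l
  proof (rule partial_fractions[OF y(1,2)])
    show "R * (\<Prod>i<N. 1 - fps_const (y i) * fps_X) = (\<Prod>i<N. 1 - fps_const (1 / t * y i) * fps_X)"
      using eval_ratio[OF scale_C_nth_0(1), of N x "scale_arg (h / t) C_inf" h]
      by (simp add: R_def y_def eval_scale_C)
  qed
  have R': "fps_nth R' l = (if l = 0 then t ^ N else 0) +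
    (\<Sum>i<N. (1 - t) * (\<Prod>j\<in>{..<N} - {i}. (1 / y i - t * (1 / y j)) / (1 / y i - 1 / y j)) * (1 / y i) ^ l)" for l
  proof (rule partial_fractions[OF y(3,4)])
    show "R' * (\<Prod>i<N. 1 - fps_const (1 / y i) * fps_X) = (\<Prod>i<N. 1 - fps_const (t * (1 / y i)) * fps_X)"
      using eval_ratio[OF scale_C_nth_0(2), of N x "scale_arg (t / h) C_tilde" "1 / h"]
      by (simp add: R'_def y_def eval_scale_C)
  qed
  have uN: "u powi int N = u ^ N" "u powi (- int N) = 1 / u ^ N" "t ^ N = u ^ N * u ^ N"
    by (simp_all add: power_int_minus assms(4) power2_eq_square power_mult_distrib inverse_eq_divide)
  have pw: "v ^ N = v * (\<Prod>j\<in>{..<N} - {i}. v)" if "i < N" for i and v :: complex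
    using that by (cases N) auto
  have ac: "a * b * (c * d) = a * c * (b * d)" for a b c d :: complex
    by simp
  have K1: "u ^ N * ((1 - 1 / t) * (\<Prod>j\<in>{..<N} - {i}. (y i - 1 / t * y j) / (y i - y j))) = u * (1 - 1 / t) * K i"
    if "i < N" for i
  proof -
    have "(\<Prod>j\<in>{..<N} - {i}. u) * (\<Prod>j\<in>{..<N} - {i}. (y i - 1 / t * y j) / (y i - y j)) = K i"
      unfolding K_def prod.distrib[symmetric]
    proof (rule prod.cong)
      fix j assume j: "j \<in> {..<N} - {i}"
      have "(y i - 1 / t * y j) / (y i - y j) = (h * (x i - 1 / t * x j)) / (h * (x i - x j))"
        by (simp add: y_def algebra_simps)
      also have "\<dots> = (x i - 1 / t * x j) / (x i - x j)" using gen by simp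
      finally have e: "(y i - 1 / t * y j) / (y i - y j) = (x i - 1 / t * x j) / (x i - x j)" .
      have "u * (x i - 1 / t * x j) = u * x i - x j / u"
        using gen by (simp add: assms(4) power2_eq_square right_diff_distrib)
      then show "u * ((y i - 1 / t * y j) / (y i - y j)) = (u * x i - x j / u) / (x i - x j)"
        unfolding e by (simp only: times_divide_eq_right)
    qed simp
    then show ?thesis by (simp only: pw[OF that, of u] ac)
  qed
  have K2: "1 / u ^ N * ((1 - t) * (\<Prod>j\<in>{..<N} - {i}. (1 / y i - t * (1 / y j)) / (1 / y i - 1 / y j))) =
      - (u * (1 - 1 / t) * K i)" if "i < N" for i
  proof -
    have "(\<Prod>j\<in>{..<N} - {i}. 1 / u) * (\<Prod>j\<in>{..<N} - {i}. (1 / y i - t * (1 / y j)) / (1 / y i - 1 / y j)) = K i"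
      unfolding K_def prod.distrib[symmetric]
    proof (rule prod.cong)
      fix j assume j: "j \<in> {..<N} - {i}"
      have nz: "x i \<noteq> 0" "x j \<noteq> 0" "x i - x j \<noteq> 0" "x j - x i \<noteq> 0"
        using j that assms(3) dist(2)[OF that j] by auto
      have "(1 / y i - t * (1 / y j)) = (x j - t * x i) / (h * x i * x j)"
        "(1 / y i - 1 / y j) = (x j - x i) / (h * x i * x j)"
        using nz gen by (simp_all add: y_def field_simps)
      then have "(1 / y i - t * (1 / y j)) / (1 / y i - 1 / y j) = (x j - t * x i) / (x j - x i)"
        using nz gen by simp
      also have "\<dots> = (t * x i - x j) / (x i - x j)"
        using nz by (simp add: field_simps)
      finally have e: "(1 / y i - t * (1 / y j)) / (1 / y i - 1 / y j) = (t * x i - x j) / (x i - x j)" .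
      have "1 / u * (t * x i - x j) = u * x i - x j / u"
        using gen by (simp add: assms(4) power2_eq_square right_diff_distrib diff_divide_distrib)
      then show "1 / u * ((1 / y i - t * (1 / y j)) / (1 / y i - 1 / y j)) = (u * x i - x j / u) / (x i - x j)"
        unfolding e by (simp only: times_divide_eq_right)
    qed simp
    moreover have "1 / u ^ N = 1 / u * (\<Prod>j\<in>{..<N} - {i}. 1 / u)"
      using pw[OF that, of "1 / u"] by (simp add: power_one_over)
    ultimately have "1 / u ^ N * ((1 - t) * (\<Prod>j\<in>{..<N} - {i}. (1 / y i - t * (1 / y j)) / (1 / y i - 1 / y j))) =
      1 / u * (1 - t) * K i" by (simp only: ac)
    moreover have "1 / u * (1 - t) = - (u * (1 - 1 / t))"
      using gen by (simp add: assms(4) power2_eq_square right_diff_distrib diff_divide_distrib)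
    ultimately show ?thesis by (simp only: mult_minus_left)
  qed
  have S1: "u ^ N * fps_nth R l = (if l = 0 then u ^ N * (1 / t) ^ N else 0) +
      u * (1 - 1 / t) * (\<Sum>i<N. K i * y i ^ l)" for l
  proof -
    have "u ^ N * (\<Sum>i<N. (1 - 1 / t) * (\<Prod>j\<in>{..<N} - {i}. (y i - 1 / t * y j) / (y i - y j)) * y i ^ l)
       = (\<Sum>i<N. (u ^ N * ((1 - 1 / t) * (\<Prod>j\<in>{..<N} - {i}. (y i - 1 / t * y j) / (y i - y j)))) * y i ^ l)"
      by (simp only: sum_distrib_left mult.assoc)
    also have "\<dots> = (\<Sum>i<N. u * (1 - 1 / t) * K i * y i ^ l)"
      by (intro sum.cong arg_cong2[where f = "(*)"] K1) auto
    also have "\<dots> = u * (1 - 1 / t) * (\<Sum>i<N. K i * y i ^ l)"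
      by (simp only: sum_distrib_left mult.assoc)
    finally have e: "u ^ N * (\<Sum>i<N. (1 - 1 / t) * (\<Prod>j\<in>{..<N} - {i}. (y i - 1 / t * y j) / (y i - y j)) * y i ^ l) = u * (1 - 1 / t) * (\<Sum>i<N. K i * y i ^ l)" .
    show ?thesis unfolding R distrib_left e by (simp only: if_distrib[of "\<lambda>v. u ^ N * v"] mult_zero_right)
  qed
  have S2: "1 / u ^ N * fps_nth R' l = (if l = 0 then 1 / u ^ N * t ^ N else 0) -
      u * (1 - 1 / t) * (\<Sum>i<N. K i * (1 / y i) ^ l)" for l
  proof -
    have "1 / u ^ N * (\<Sum>i<N. (1 - t) * (\<Prod>j\<in>{..<N} - {i}. (1 / y i - t * (1 / y j)) / (1 / y i - 1 / y j)) * (1 / y i) ^ l)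
       = (\<Sum>i<N. (1 / u ^ N * ((1 - t) * (\<Prod>j\<in>{..<N} - {i}. (1 / y i - t * (1 / y j)) / (1 / y i - 1 / y j)))) * (1 / y i) ^ l)"
      by (simp only: sum_distrib_left mult.assoc)
    also have "\<dots> = (\<Sum>i<N. - (u * (1 - 1 / t) * K i) * (1 / y i) ^ l)"
      by (intro sum.cong arg_cong2[where f = "(*)"] K2) auto
    also have "\<dots> = - (u * (1 - 1 / t) * (\<Sum>i<N. K i * (1 / y i) ^ l))"
      by (simp only: sum_distrib_left mult.assoc sum_negf mult_minus_left)
    finally have e: "1 / u ^ N * (\<Sum>i<N. (1 - t) * (\<Prod>j\<in>{..<N} - {i}. (1 / y i - t * (1 / y j)) / (1 / y i - 1 / y j)) * (1 / y i) ^ l) = - (u * (1 - 1 / t) * (\<Sum>i<N. K i * (1 / y i) ^ l))" .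
    show ?thesis unfolding R' distrib_left e by (simp only: if_distrib[of "\<lambda>v. 1 / u ^ N * v"] mult_zero_right diff_conv_add_uminus)
  qed
  have R0: "fps_nth R 0 = 1" "fps_nth R' 0 = 1"
    by (simp_all add: R_def R'_def eval_fps_def ratio_def eval_ps_simps scale_C_nth_0)
  have "u ^ N * eval_ps N x (in_z (ratio (scale_arg (h / t) C_inf) (scale_arg h C_inf)) l) -
         1 / u ^ N * eval_ps N x
           (in_z_inverse (ratio (scale_arg (t / h) C_tilde) (scale_arg (1 / h) C_tilde)) l) =
         u * (1 - 1 / t) * (\<Sum>i<N. K i * y i powi l)"
  proof -
    consider "l = 0" | "l > 0" | "l < 0" by linarith
    then show ?thesis
    proof cases
      case 1
      then show ?thesis
        using S1[of 0] gen R0 uN(3)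
        by (simp add: in_z_def in_z_inverse_def R_def R'_def eval_fps_def power_one_over field_simps)
    next
      case 2
      then show ?thesis
        using S1[of "nat l"]
        by (simp add: in_z_def in_z_inverse_def R_def eval_fps_def eval_ps_simps power_int_def)
    next
      case 3
      then show ?thesis
        using S2[of "nat (- l)"]
        by (simp add: in_z_def in_z_inverse_def R'_def eval_fps_def eval_ps_simps power_int_def inverse_eq_divide)
    qed
  qed
  then show ?thesis by (simp add: uN K_def y_def)
qed

lemma lookup_cst_mult: "Poly_Mapping.lookup (cst (c :: 'b::comm_ring_1) * P) n = c * Poly_Mapping.lookup P n"
  unfolding cst_def mult_map_scale_conv_mult[symmetric]
  by (simp add: Poly_Mapping.map.rep_eq when_def)

theorem eval_e_finite:
  assumes "generic h u" "inj_on x {..<N}" "\<And>i. i < N \<Longrightarrow> x i \<noteq> 0" "finite {\<mu>. F \<mu> \<noteq> 0}"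
  shows "finite {\<mu>. e_finite h u N n F \<mu> \<noteq> 0}"
    and "eval_X N x (e_finite h u N n F) = macdonald_current h u N n (\<lambda>y. eval_X N y F) x"
proof -
  define t q where "t = u\<^sup>2" and "q = h\<^sup>2"
  have gen: "h \<noteq> 0" "u \<noteq> 0" "t \<noteq> 0" "q \<noteq> 1" "t \<noteq> 1" using assms(1) by (auto simp: generic_def t_def q_def)
  define c where "c = shift_coeff h"
  define G where "G = (\<Sum>\<mu> | F \<mu> \<noteq> 0. cst (cst (F \<mu>)) * subst_monomial c \<mu>)"
  define A where "A = in_z (ratio (scale_arg (h / t) C_inf) (scale_arg h C_inf))"
  define B where "B = in_z_inverse (ratio (scale_arg (t / h) C_tilde) (scale_arg (1 / h) C_tilde))"
  define pre where "pre = h / u / ((1 - q) * (1 - 1 / t))"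
  define K where "K = (\<lambda>i. \<Prod>j\<in>{..<N} - {i}. (u * x i - x j / u) / (x i - x j))"
  have pl: "plethysm c F = (\<lambda>n. Poly_Mapping.lookup (Poly_Mapping.lookup G n))"
  proof (intro ext)
    fix n \<nu>
    have "plethysm c F n \<nu> = (\<Sum>\<mu> | F \<mu> \<noteq> 0. F \<mu> * Poly_Mapping.lookup (Poly_Mapping.lookup (subst_monomial c \<mu>) n) \<nu>)"
      unfolding plethysm_def by (rule Sum_any.expand_superset) (use assms(4) in auto)
    then show "plethysm c F n \<nu> = Poly_Mapping.lookup (Poly_Mapping.lookup G n) \<nu>"
      by (simp add: G_def lookup_sum lookup_cst_mult)
  qed
  have mz: "mult_z a (\<lambda>n. Poly_Mapping.lookup (Poly_Mapping.lookup G n)) n =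
      Poly_Mapping.lookup (\<Sum>m\<in>Poly_Mapping.keys G. a (n - m) * Poly_Mapping.lookup G m)" for a
  proof
    fix \<nu>
    have "mult_z a (\<lambda>n. Poly_Mapping.lookup (Poly_Mapping.lookup G n)) n \<nu> =
      Sum_any (\<lambda>l. Poly_Mapping.lookup (a l * Poly_Mapping.lookup G (n - l)) \<nu>)"
      by (simp add: mult_z_def times_poly_mapping.rep_eq)
    also have "\<dots> = (\<Sum>l\<in>(\<lambda>m. n - m) ` Poly_Mapping.keys G. Poly_Mapping.lookup (a l * Poly_Mapping.lookup G (n - l)) \<nu>)"
    proof (rule Sum_any.expand_superset)
      show "{l. Poly_Mapping.lookup (a l * Poly_Mapping.lookup G (n - l)) \<nu> \<noteq> 0} \<subseteq> (\<lambda>m. n - m) ` Poly_Mapping.keys G"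
      proof
        fix l assume "l \<in> {l. Poly_Mapping.lookup (a l * Poly_Mapping.lookup G (n - l)) \<nu> \<noteq> 0}"
        then have "n - l \<in> Poly_Mapping.keys G" by (auto simp: in_keys_iff)
        then show "l \<in> (\<lambda>m. n - m) ` Poly_Mapping.keys G" by (rule rev_image_eqI) simp
      qed
    qed simp
    also have "\<dots> = (\<Sum>m\<in>Poly_Mapping.keys G. Poly_Mapping.lookup (a (n - m) * Poly_Mapping.lookup G m) \<nu>)"
      by (subst sum.reindex) (auto simp: inj_on_def)
    finally show "mult_z a (\<lambda>n. Poly_Mapping.lookup (Poly_Mapping.lookup G n)) n \<nu> =
      Poly_Mapping.lookup (\<Sum>m\<in>Poly_Mapping.keys G. a (n - m) * Poly_Mapping.lookup G m) \<nu>"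
      by (simp add: lookup_sum)
  qed
  define E where "E = cst pre * (cst (u powi int N) * (\<Sum>m\<in>Poly_Mapping.keys G. A (n - m) * Poly_Mapping.lookup G m) -
     cst (u powi (- int N)) * (\<Sum>m\<in>Poly_Mapping.keys G. B (n - m) * Poly_Mapping.lookup G m))"
  have eE: "e_finite h u N n F = Poly_Mapping.lookup E"
    by (rule ext) (simp add: e_finite_def Let_def E_def lookup_cst_mult lookup_minus pl[unfolded c_def]
        mz pre_def A_def B_def t_def q_def)
  show "finite {\<mu>. e_finite h u N n F \<mu> \<noteq> 0}" unfolding eE by simp
  have br: "u powi int N * eval_ps N x (A l) - u powi (- int N) * eval_ps N x (B l) =
      u * (1 - 1 / t) * (\<Sum>i<N. K i * (h * x i) powi l)" for l
    unfolding A_def B_def K_def by (rule bracket_mode[OF assms(1-3) t_def])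
  define Z where "Z = (\<lambda>i. eval_poly_mapping (eval_ps N x) (\<lambda>m. (h * x i) powi (- m)) G)"
  have "eval_ps N x E = pre * (\<Sum>m\<in>Poly_Mapping.keys G.
      (u powi int N * eval_ps N x (A (n - m)) - u powi (- int N) * eval_ps N x (B (n - m))) *
      eval_ps N x (Poly_Mapping.lookup G m))"
    by (simp add: E_def eval_ps_simps sum_distrib_left sum_subtractf left_diff_distrib mult.assoc)
  also have "\<dots> = pre * (\<Sum>m\<in>Poly_Mapping.keys G. \<Sum>i<N. u * (1 - 1 / t) * K i * (h * x i) powi n *
      (eval_ps N x (Poly_Mapping.lookup G m) * (h * x i) powi (- m)))"
    unfolding br sum_distrib_left sum_distrib_right
  proof (intro sum.cong refl)
    fix m i assume "i \<in> {..<N}"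
    then have "h * x i \<noteq> 0" using assms(3) gen by simp
    then have "(h * x i) powi (n - m) = (h * x i) powi n * (h * x i) powi (- m)"
      by (metis power_int_add diff_conv_add_uminus)
    then show "pre * (u * (1 - 1 / t) * (K i * (h * x i) powi (n - m)) * eval_ps N x (Poly_Mapping.lookup G m)) =
      pre * (u * (1 - 1 / t) * K i * (h * x i) powi n * (eval_ps N x (Poly_Mapping.lookup G m) * (h * x i) powi (- m)))"
      by simp
  qed
  also have "\<dots> = pre * (\<Sum>i<N. u * (1 - 1 / t) * K i * (h * x i) powi n * Z i)"
    by (subst sum.swap) (simp add: Z_def eval_poly_mapping_def sum_distrib_left)
  also have "\<dots> = h / (1 - q) * h powi n * (\<Sum>i<N. x i powi n * K i * Z i)"
  proof -
    have "pre * (u * (1 - 1 / t)) = h / (1 - q)"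
      using gen by (simp add: pre_def)
    then have "pre * (u * (1 - 1 / t) * K i * (h * x i) powi n * Z i) =
       h / (1 - q) * h powi n * (x i powi n * K i * Z i)" for i
      by (metis (no_types, opaque_lifting) mult.assoc mult.commute mult.left_commute power_int_mult_distrib)
    then show ?thesis by (simp add: sum_distrib_left)
  qed
  also have "(\<Sum>i<N. x i powi n * K i * Z i) = (\<Sum>i<N. x i powi n * K i * eval_X N (x(i := q * x i)) F)"
  proof (intro sum.cong refl arg_cong2[where f = "(*)"])
    fix i assume i: "i \<in> {..<N}"
    then have nz: "h * x i \<noteq> 0" "x i \<noteq> 0" using assms(3) gen by auto
    have hom: "hom_to_complex (eval_poly_mapping (eval_ps N x) (\<lambda>m. (h * x i) powi (- m)))"
    proof (intro hom_to_complex_eval_poly_mapping hom_eval_ps)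
      fix a b :: int
      have "(h * x i) powi (- a + - b) = (h * x i) powi (- a) * (h * x i) powi (- b)"
        using nz by (intro power_int_add) simp
      then show "(h * x i) powi - (a + b) = (h * x i) powi - a * (h * x i) powi - b" by simp
    qed simp
    note simps = hom_to_complexD[OF hom]
    have s: "eval_poly_mapping (eval_ps N x) (\<lambda>m. (h * x i) powi (- m)) (Poly_Mapping.single k P) =
        eval_ps N x P * (h * x i) powi (- k)" for k P
      by (rule eval_poly_mapping_single[OF hom_eval_ps])
    have k: "power_sum N x k + shift_coeff h k * (h * x i) powi k = power_sum N (x(i := q * x i)) k" for k
    proof -
      have "shift_coeff h k * (h * x i) powi k = (q * x i) powi k - x i powi k"
        using gen by (simp add: shift_coeff_def q_def power_int_mult_distrib power2_eq_square
            left_diff_distrib power_int_minus field_simps)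
      moreover have "power_sum N x k = x i powi k + (\<Sum>j\<in>{..<N} - {i}. x j powi k)"
        "power_sum N (x(i := q * x i)) k = (q * x i) powi k + (\<Sum>j\<in>{..<N} - {i}. x j powi k)"
        using i by (simp_all add: power_sum_def sum.remove[of _ i])
      ultimately show ?thesis by simp
    qed
    show "Z i = eval_X N (x(i := q * x i)) F"
      by (simp add: Z_def G_def subst_monomial_def simps s[unfolded cst_def] cst_def[of "pvar _"] cst_def[of "cst _"]
          s c_def k eval_X_def eval_monomial_def eval_ps_cst)
  qed
  finally show "eval_X N x (e_finite h u N n F) = macdonald_current h u N n (\<lambda>y. eval_X N y F) x"
    by (simp add: eE eval_X_lookup macdonald_current_def Let_def K_def q_def)
qed

end

theory Submission
  imports Defs
begin

text \<open>
  All currents are homogeneous, so a function of the infinite alphabet may be treated weight by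
  weight, as a polynomial in the power sums. There each current is a vertex operator
  \<open>M(\<alpha>; z) T(c; z)\<close>: the substitution \<open>T(c; z) : p\<^sub>k \<mapsto> p\<^sub>k + c\<^sub>k z\<^sup>-\<^sup>k\<close> followed by
  multiplication by \<open>M(\<alpha>; z) = exp (\<Sum>\<^sub>k\<^sub>>\<^sub>0 \<alpha>\<^sub>k p\<^sub>k z\<^sup>k / k)\<close>. Since
  \<open>T(c; z) M(\<alpha>; w) = \<phi>(w/z) M(\<alpha>; w) T(c; z)\<close> with \<open>\<phi>(x) = exp (\<Sum>\<^sub>k\<^sub>>\<^sub>0 \<alpha>\<^sub>k c\<^sub>k x\<^sup>k / k)\<close>,
  the two orders of a product are expansions of rational functions times one normally ordered
  product, symmetric in the two factors. This gives the exchange relations, and the commutator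
  of \<open>\<ee>\<close> and \<open>\<ff>\<close> as the difference of two expansions of a function with two simple poles. For
  the Serre relation the rational function multiplying \<open>\<phi>(z\<^sub>2/z\<^sub>1) \<phi>(z\<^sub>3/z\<^sub>1) \<phi>(z\<^sub>3/z\<^sub>2)\<close> is such that the
  product splits into a part that is antisymmetric in \<open>z\<^sub>2, z\<^sub>3\<close> without poles relating them and a part
  that is antisymmetric in \<open>z\<^sub>1, z\<^sub>2\<close> without poles relating them; each vanishes under symmetrization.
\<close>

text \<open>Every rearrangement of modes requires finite sums, although functions of the alphabet
  have infinitely many monomials. At one weight only finitely many modes of a translation survive,
  and multiplications have no modes of negative degree. Hence a normally ordered product has, in
  each total degree, finitely many nonzero modes, and both expansions of a rational function act on
  the same finite family. The limit is a separate matter: it exists for |t| > 1 only, while \<ff>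
  needs 1/t. Its value elsewhere is fixed by rationality in (h, u): a polynomial in h and u that
  vanishes at enough integer points with |t| > 1 is zero. The function in the Serre relation arises
  as follows. Under the symmetrization the variables can be renamed until every term has the order
  \<ee>(z_1) \<ee>(z_2) \<ee>(z_3); the factor becomes z_2/z_3 - z_3/z_2 - z_1/z_2 + z_2/z_1. With x
  = z_2/z_1 and y = z_3/z_2 this is (x - y)(1 + x y)/(x y).\<close>

abbreviation lk :: "('a \<Rightarrow>\<^sub>0 'b::zero) \<Rightarrow> 'a \<Rightarrow> 'b" where
  "lk \<equiv> Poly_Mapping.lookup"

section \<open>Exponential generating series\<close>

lemma cst_simps [simp]:
  "cst 0 = 0" "cst (1 :: 'a::zero_neq_one) = 1"
  by (simp_all add: cst_def)

lemma cst_add: "cst (a + b) = cst a + cst b"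
  by (simp add: cst_def single_add)

lemma cst_mult: "cst (a * b) = (cst a * cst b :: 'a::comm_monoid_add \<Rightarrow>\<^sub>0 'b::comm_semiring_0)"
  by (simp add: cst_def mult_single)

lemma cst_uminus: "cst (- a) = - cst a"
  by (simp add: cst_def single_uminus)

lemma cst_diff: "cst (a - b) = cst a - cst b"
  by (simp add: cst_def single_diff)

lemma cst_of_nat: "cst (of_nat n) = of_nat n"
  by (simp add: cst_def)

lemma cst_sum: "cst (sum f S) = (\<Sum>s\<in>S. cst (f s))"
  by (induction S rule: infinite_finite_induct) (simp_all add: cst_add)

lemma cst_power: "cst (a ^ n) = (cst a :: 'a::comm_monoid_add \<Rightarrow>\<^sub>0 'b::comm_semiring_1) ^ n"
  by (induction n) (simp_all add: cst_mult)

lemma cst_mult_single: "cst a * Poly_Mapping.single k b = Poly_Mapping.single k (a * b)"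
  by (simp add: cst_def mult_single)

text \<open>The equation F' = F D fixes each coefficient by the lower ones, since n + 1 cancels in a
  domain of characteristic 0. Identities between exponentials, here also over rings that are not
  fields, are reduced to this uniqueness.\<close>

lemma fps_eqI_deriv:
  fixes F G D :: "'a::{idom,ring_char_0} fps"
  assumes "fps_nth F 0 = fps_nth G 0" "fps_deriv F = F * D" "fps_deriv G = G * D"
  shows "F = G"
proof (rule fps_ext)
  fix n show "fps_nth F n = fps_nth G n"
  proof (induction n rule: less_induct)
    case (less n)
    show ?case
    proof (cases n)
      case 0
      then show ?thesis using assms(1) by simp
    next
      case (Suc m)
      have "of_nat (Suc m) * fps_nth F (Suc m) = fps_nth (fps_deriv F) m" by simp
      also have "\<dots> = fps_nth (F * D) m" by (simp only: assms(2))
      also have "\<dots> = fps_nth (G * D) m"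
        unfolding fps_mult_nth using less Suc by (intro sum.cong) auto
      also have "\<dots> = fps_nth (fps_deriv G) m" by (simp only: assms(3))
      also have "\<dots> = of_nat (Suc m) * fps_nth G (Suc m)" by simp
      finally show ?thesis using Suc by (simp del: of_nat_Suc)
    qed
  qed
qed

text \<open>The exponential of the sum of s_k x^k / k over k > 0: the term k = 0 drops out because
  division by zero gives 0.\<close>

definition exp_sum :: "(nat \<Rightarrow> complex) \<Rightarrow> complex fps" where
  "exp_sum s = fps_exp 1 oo Abs_fps (\<lambda>k. s k / of_nat k)"

lemma exp_sum_nth_0 [simp]: "fps_nth (exp_sum s) 0 = 1"
  by (simp add: exp_sum_def)

lemma deriv_exp_sum: "fps_deriv (exp_sum s) = exp_sum s * Abs_fps (\<lambda>k. s (Suc k))"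
proof -
  have "fps_deriv (Abs_fps (\<lambda>k. s k / of_nat k)) = Abs_fps (\<lambda>k. s (Suc k))"
    by (rule fps_ext) (simp del: of_nat_Suc)
  then show ?thesis by (simp add: exp_sum_def fps_compose_deriv)
qed

lemma exp_sum_add: "exp_sum s * exp_sum s' = exp_sum (\<lambda>k. s k + s' k)"
proof (rule fps_eqI_deriv)
  have "Abs_fps (\<lambda>k. s (Suc k) + s' (Suc k)) = Abs_fps (\<lambda>k. s (Suc k)) + Abs_fps (\<lambda>k. s' (Suc k))"
    by (rule fps_ext) simp
  then show "fps_deriv (exp_sum s * exp_sum s') =
      exp_sum s * exp_sum s' * Abs_fps (\<lambda>k. s (Suc k) + s' (Suc k))"
    by (simp only: fps_deriv_mult deriv_exp_sum) (simp add: algebra_simps)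
qed (simp_all add: deriv_exp_sum)

lemma exp_sum_cong: "(\<And>k. k > 0 \<Longrightarrow> s k = s' k) \<Longrightarrow> exp_sum s = exp_sum s'"
  by (rule fps_eqI_deriv[where D = "Abs_fps (\<lambda>k. s (Suc k))"]) (simp_all add: deriv_exp_sum)

lemma exp_sum_0 [simp]: "exp_sum (\<lambda>k. 0) = 1"
  by (rule fps_eqI_deriv[where D = 0]) (simp_all add: deriv_exp_sum fps_eq_iff fps_mult_nth)

text \<open>The logarithm of 1 - a x is minus the sum of a^k x^k / k. Products of linear factors
  thus become sums of powers in the exponent.\<close>

lemma exp_sum_neg_power: "exp_sum (\<lambda>k. - (a ^ k)) = 1 - fps_const a * fps_X"
proof (rule fps_eqI_deriv[where D = "Abs_fps (\<lambda>k. - (a ^ Suc k))"])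
  show "fps_deriv (1 - fps_const a * fps_X) = (1 - fps_const a * fps_X) * Abs_fps (\<lambda>k. - (a ^ Suc k))"
  proof (rule fps_ext)
    fix n show "fps_nth (fps_deriv (1 - fps_const a * fps_X)) n =
      fps_nth ((1 - fps_const a * fps_X) * Abs_fps (\<lambda>k. - (a ^ Suc k))) n"
      by (cases n) (simp_all add: left_diff_distrib mult.assoc)
  qed
qed (simp_all add: deriv_exp_sum)

section \<open>\<open>C_inf\<close> and its ratios as exponentials in the power sums\<close>

definition power_sum_exp :: "(nat \<Rightarrow> complex) \<Rightarrow> ps_poly fps" where
  "power_sum_exp \<alpha> = exp_series (Abs_fps (\<lambda>k. cst (\<alpha> k / of_nat k) * pvar (int k)))"

lemma power_sum_exp_nth_0 [simp]: "fps_nth (power_sum_exp \<alpha>) 0 = 1"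
  by (simp add: power_sum_exp_def exp_series_def)

lemma deriv_power_sum_exp:
  "fps_deriv (power_sum_exp \<alpha>) =
     power_sum_exp \<alpha> * Abs_fps (\<lambda>k. cst (\<alpha> (Suc k)) * pvar (int (Suc k)))"
proof -
  have c: "of_nat (Suc n) * cst (a / of_nat (Suc n)) = (cst a :: ps_poly)" for n and a :: complex
    by (simp only: cst_of_nat[symmetric] cst_mult[symmetric]) (simp del: of_nat_Suc)
  have 1: "fps_deriv (Abs_fps (\<lambda>n. cst (1 / fact n))) = (Abs_fps (\<lambda>n. cst (1 / fact n)) :: ps_poly fps)"
  proof (rule fps_ext)
    fix n
    have "1 / fact (Suc n) = 1 / fact n / (of_nat (Suc n) :: complex)"
      by (simp add: field_simps)
    then show "fps_nth (fps_deriv (Abs_fps (\<lambda>n. cst (1 / fact n)))) n =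
       (fps_nth (Abs_fps (\<lambda>n. cst (1 / fact n))) n :: ps_poly)"
      using c[of n "1 / fact n"] by (simp only: fps_deriv_nth fps_nth_Abs_fps Suc_eq_plus1)
  qed
  have 2: "fps_deriv (Abs_fps (\<lambda>k. cst (\<alpha> k / of_nat k) * pvar (int k))) =
      Abs_fps (\<lambda>k. cst (\<alpha> (Suc k)) * pvar (int (Suc k)))"
    by (rule fps_ext) (simp add: mult.assoc[symmetric] c del: of_nat_Suc)
  show ?thesis
    unfolding power_sum_exp_def exp_series_def
    by (subst fps_compose_deriv) (simp_all only: 1 2, simp)
qed

lemma power_sum_exp_add:
  "power_sum_exp \<alpha> * power_sum_exp \<beta> = power_sum_exp (\<lambda>k. \<alpha> k + \<beta> k)"
proof (rule fps_eqI_deriv)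
  have "Abs_fps (\<lambda>k. cst (\<alpha> (Suc k) + \<beta> (Suc k)) * pvar (int (Suc k))) =
      Abs_fps (\<lambda>k. cst (\<alpha> (Suc k)) * pvar (int (Suc k))) + Abs_fps (\<lambda>k. cst (\<beta> (Suc k)) * pvar (int (Suc k)))"
    by (rule fps_ext) (simp add: cst_add distrib_right)
  then show "fps_deriv (power_sum_exp \<alpha> * power_sum_exp \<beta>) = power_sum_exp \<alpha> * power_sum_exp \<beta> *
      Abs_fps (\<lambda>k. cst (\<alpha> (Suc k) + \<beta> (Suc k)) * pvar (int (Suc k)))"
    by (simp only: fps_deriv_mult deriv_power_sum_exp) (simp only: algebra_simps)
qed (simp_all only: deriv_power_sum_exp, simp)

lemma power_sum_exp_cong: "(\<And>k. k > 0 \<Longrightarrow> \<alpha> k = \<beta> k) \<Longrightarrow> power_sum_exp \<alpha> = power_sum_exp \<beta>"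
  by (rule fps_eqI_deriv[where D = "Abs_fps (\<lambda>k. cst (\<alpha> (Suc k)) * pvar (int (Suc k)))"])
     (simp_all add: deriv_power_sum_exp del: of_nat_Suc)

lemma power_sum_exp_0 [simp]: "power_sum_exp (\<lambda>k. 0) = 1"
  by (rule fps_eqI_deriv[where D = 0]) (simp_all add: deriv_power_sum_exp fps_eq_iff fps_mult_nth)

lemma C_inf_eq: "C_inf = power_sum_exp (\<lambda>k. - 1)"
proof -
  have "- Abs_fps (\<lambda>k. cst (1 / of_nat k) * pvar (int k)) =
      Abs_fps (\<lambda>k. cst (- 1 / of_nat k) * pvar (int k))"
    by (rule fps_ext) (simp add: cst_uminus)
  then show ?thesis by (simp add: C_inf_def power_sum_exp_def)
qed

lemma scale_power_sum_exp:
  "scale_arg a (power_sum_exp \<alpha>) = power_sum_exp (\<lambda>k. a ^ k * \<alpha> k)"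
proof (rule fps_eqI_deriv)
  have D: "(Abs_fps (\<lambda>k. cst (\<alpha> (Suc k)) * pvar (int (Suc k))) oo (fps_const (cst a) * fps_X)) * fps_const (cst a) =
      Abs_fps (\<lambda>k. cst (a ^ Suc k * \<alpha> (Suc k)) * pvar (int (Suc k)))"
    unfolding fps_compose_linear
    by (rule fps_ext) (simp add: cst_mult cst_power mult_ac del: of_nat_Suc)
  show "fps_deriv (scale_arg a (power_sum_exp \<alpha>)) = scale_arg a (power_sum_exp \<alpha>) *
      Abs_fps (\<lambda>k. cst (a ^ Suc k * \<alpha> (Suc k)) * pvar (int (Suc k)))"
    unfolding scale_arg_def D[symmetric]
    by (subst fps_compose_deriv) (simp_all add: deriv_power_sum_exp fps_compose_mult_distrib mult.assoc del: of_nat_Suc)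
qed (simp_all only: deriv_power_sum_exp, simp add: scale_arg_def)

lemma right_inverse_unique: "a * b = 1 \<Longrightarrow> a * c = 1 \<Longrightarrow> b = (c :: 'a::comm_ring_1)"
  by (metis mult.assoc mult.commute mult_1_left)

lemma ratio_power_sum_exp:
  "ratio (power_sum_exp \<alpha>) (power_sum_exp \<beta>) = power_sum_exp (\<lambda>k. \<alpha> k - \<beta> k)"
proof -
  let ?i = "fps_right_inverse (power_sum_exp \<beta>) 1"
  have "power_sum_exp \<beta> * ?i = 1" by (rule fps_right_inverse) simp
  moreover have "power_sum_exp \<beta> * power_sum_exp (\<lambda>k. - \<beta> k) = 1"
    by (simp add: power_sum_exp_add)
  ultimately have "?i = power_sum_exp (\<lambda>k. - \<beta> k)"
    by (rule right_inverse_unique)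
  then show ?thesis by (simp add: ratio_def power_sum_exp_add)
qed

lemma ratio_C_inf:
  "ratio (scale_arg a C_inf) (scale_arg b C_inf) = power_sum_exp (\<lambda>k. b ^ k - a ^ k)"
  by (simp add: C_inf_eq scale_power_sum_exp ratio_power_sum_exp)

lemma psi_plus_series_eq:
  "psi_plus_series h u = power_sum_exp (\<lambda>k. (h ^ k - (h / u\<^sup>2) ^ k) + ((1 / h) ^ k - (u\<^sup>2 / h) ^ k))"
  by (simp add: psi_plus_series_def C_inf_eq scale_power_sum_exp power_sum_exp_add ratio_power_sum_exp Let_def)
     (rule power_sum_exp_cong, simp)

section \<open>Translation of the power sums\<close>

lemma subst_monomial_superset:
  assumes "finite S" "Poly_Mapping.keys \<mu> \<subseteq> S"
  shows "subst_monomial c \<mu> = (\<Prod>k\<in>S. (cst (pvar k) + Poly_Mapping.single (- k) (cst (c k))) ^ lk \<mu> k)"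
  unfolding subst_monomial_def
  by (rule prod.mono_neutral_left) (use assms in \<open>auto simp: in_keys_iff\<close>)

lemma subst_monomial_0 [simp]: "subst_monomial c 0 = 1"
  by (simp add: subst_monomial_def)

lemma subst_monomial_add: "subst_monomial c (\<mu> + \<nu>) = subst_monomial c \<mu> * subst_monomial c \<nu>"
proof -
  let ?S = "Poly_Mapping.keys \<mu> \<union> Poly_Mapping.keys \<nu>"
  have "Poly_Mapping.keys (\<mu> + \<nu>) \<subseteq> ?S" by (rule Poly_Mapping.keys_add)
  then show ?thesis
    by (simp add: subst_monomial_superset[of ?S] lookup_add power_add prod.distrib)
qed

definition substitution :: "(int \<Rightarrow> complex) \<Rightarrow> ps_poly \<Rightarrow> (int \<Rightarrow>\<^sub>0 ps_poly)" where
  "substitution c P = (\<Sum>\<mu>\<in>Poly_Mapping.keys P. cst (cst (lk P \<mu>)) * subst_monomial c \<mu>)"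

lemma substitution_superset:
  assumes "finite S" "Poly_Mapping.keys P \<subseteq> S"
  shows "substitution c P = (\<Sum>\<mu>\<in>S. cst (cst (lk P \<mu>)) * subst_monomial c \<mu>)"
  unfolding substitution_def
  by (rule sum.mono_neutral_left) (use assms in \<open>auto simp: in_keys_iff\<close>)

lemma substitution_0 [simp]: "substitution c 0 = 0"
  by (simp add: substitution_def)

lemma substitution_add: "substitution c (P + R) = substitution c P + substitution c R"
proof -
  let ?S = "Poly_Mapping.keys P \<union> Poly_Mapping.keys R"
  have "Poly_Mapping.keys (P + R) \<subseteq> ?S" by (rule Poly_Mapping.keys_add)
  then show ?thesis
    by (simp add: substitution_superset[of ?S] lookup_add cst_add distrib_right sum.distrib)
qed

lemma substitution_single:
  "substitution c (Poly_Mapping.single \<mu> a) = cst (cst a) * subst_monomial c \<mu>"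
  by (subst substitution_superset[of "{\<mu>}"]) (auto split: if_splits)

lemma substitution_mult: "substitution c (P * R) = substitution c P * substitution c R"
proof (induction P rule: poly_mapping_induct_add)
  case (2 P \<mu> a)
  have "substitution c (Poly_Mapping.single \<mu> a * R) = cst (cst a) * subst_monomial c \<mu> * substitution c R"
  proof (induction R rule: poly_mapping_induct_add)
    case (2 R \<nu> b)
    then show ?case
      by (simp add: distrib_left mult_single substitution_add substitution_single cst_mult
          subst_monomial_add mult_ac)
  qed simp
  with 2 show ?case by (simp add: distrib_right substitution_add substitution_single)
qed simp

lemma substitution_cst [simp]: "substitution c (cst a) = cst (cst a)"
  by (simp add: cst_def[of a] substitution_single)

lemma substitution_1 [simp]: "substitution c 1 = 1"
  using substitution_cst[of c 1] by simp

lemma substitution_pvar: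
  "substitution c (pvar k) = cst (pvar k) + Poly_Mapping.single (- k) (cst (c k))"
  by (simp add: pvar_def substitution_single subst_monomial_superset[of "{k}"])

lemma substitution_sum: "substitution c (sum f S) = (\<Sum>s\<in>S. substitution c (f s))"
  by (induction S rule: infinite_finite_induct) (simp_all add: substitution_add)

lemma lookup_mult_single: "lk (Poly_Mapping.single a b * Y) n = b * lk Y (n - a)"
  for a :: "'a::ab_group_add" and Y :: "'a \<Rightarrow>\<^sub>0 'b::comm_ring_1"
proof (induction Y rule: poly_mapping_induct_add)
  case (2 Y k c)
  then show ?case
    by (auto simp: distrib_left lookup_add mult_single lookup_single when_def algebra_simps)
qed simp

lemma lookup_cst_mult_left: "lk (cst b * Y) n = b * lk Y n"
  for Y :: "'a::ab_group_add \<Rightarrow>\<^sub>0 'b::comm_ring_1"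
  using lookup_mult_single[of 0 b Y n] by (simp add: cst_def)

lemma poly_mapping_sum_singles: "P = (\<Sum>k\<in>Poly_Mapping.keys P. Poly_Mapping.single k (lk P k))"
proof (rule poly_mapping_eqI)
  fix n show "lk P n = lk (\<Sum>k\<in>Poly_Mapping.keys P. Poly_Mapping.single k (lk P k)) n"
    by (cases "n \<in> Poly_Mapping.keys P")
       (auto simp: lookup_sum lookup_single when_def sum.delta in_keys_iff intro!: sum.neutral)
qed

lemma lookup_mult_group:
  "lk (X * Y) n = (\<Sum>a\<in>Poly_Mapping.keys X. lk X a * lk Y (n - a))"
  for X Y :: "'a::ab_group_add \<Rightarrow>\<^sub>0 'b::comm_ring_1"
  by (subst poly_mapping_sum_singles[of X]) (simp add: sum_distrib_right lookup_sum lookup_mult_single)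

text \<open>The mode at z^n of the operator T(c; z) of the overview.\<close>

definition translate :: "(int \<Rightarrow> complex) \<Rightarrow> int \<Rightarrow> ps_poly \<Rightarrow> ps_poly" where
  "translate c n P = lk (substitution c P) n"

lemma translate_0 [simp]: "translate c n 0 = 0"
  by (simp add: translate_def)

lemma translate_1: "translate c n 1 = (if n = 0 then 1 else 0)"
  by (simp add: translate_def lookup_one when_def)

lemma translate_add: "translate c n (P + R) = translate c n P + translate c n R"
  by (simp add: translate_def substitution_add lookup_add)

lemma translate_cst_mult: "translate c n (cst a * P) = cst a * translate c n P"
  by (simp add: translate_def substitution_mult lookup_cst_mult_left)

lemma translate_pvar_mult:
  "translate c n (pvar k * P) = pvar k * translate c n P + cst (c k) * translate c (n + k) P"
  by (simp add: translate_def substitution_mult substitution_pvar distrib_right lookup_add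
      lookup_cst_mult_left lookup_mult_single)

lemma finite_translate: "finite {n. translate c n P \<noteq> 0}"
  by (simp add: translate_def)

text \<open>Used with \<open>translate_pvar_mult\<close>, this replaces the expansion of products of
  binomials: a property of \<open>translate\<close> is checked on 1 and under sums, scalars and
  multiplication by p_k. The mode index stays free in such inductions because p_k moves it by
  k.\<close>

lemma ps_poly_induct [case_names one add scale pvar]:
  assumes one: "Q 1" and add: "\<And>P R. Q P \<Longrightarrow> Q R \<Longrightarrow> Q (P + R)"
    and scale: "\<And>a P. Q P \<Longrightarrow> Q (cst a * P)" and pvar: "\<And>k P. Q P \<Longrightarrow> Q (pvar k * P)"
  shows "Q P"
proof -
  have zero: "Q 0" using scale[OF one, of 0] by simp
  have mon: "Q (Poly_Mapping.single \<mu> 1)" for \<mu>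
  proof (induction \<mu> rule: poly_mapping_induct_add)
    case (2 \<mu> k n)
    show ?case
    proof (induction n)
      case (Suc n)
      have "Poly_Mapping.single (\<mu> + Poly_Mapping.single k (Suc n)) 1 =
          pvar k * Poly_Mapping.single (\<mu> + Poly_Mapping.single k n) (1::complex)"
        by (simp add: pvar_def mult_single single_add[symmetric] add.left_commute)
      then show ?case using pvar[OF Suc] by simp
    qed (use 2 in simp)
  qed (use one in simp)
  show ?thesis
  proof (induction P rule: poly_mapping_induct_add)
    case (2 P \<mu> a)
    have "Poly_Mapping.single \<mu> a = cst a * Poly_Mapping.single \<mu> 1"
      by (simp add: cst_mult_single)
    then show ?case using add[OF 2 scale[OF mon[of \<mu>], of a]] by simp
  qed (rule zero)
qed

text \<open>Both translations only add constants to the variables.\<close>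

lemma translate_commute: "translate c n (translate c' m P) = translate c' m (translate c n P)"
proof (induction P arbitrary: n m rule: ps_poly_induct)
  case (pvar k P)
  show ?case
    by (simp add: translate_pvar_mult translate_add translate_cst_mult pvar distrib_left
        mult.left_commute[of "cst _"] add_ac)
qed (simp_all add: translate_1 translate_add translate_cst_mult)

text \<open>As generating series in \<open>l\<close>, both sides solve the same linear differential equation.\<close>

lemma substitution_power_sum_exp:
  fixes \<alpha> :: "nat \<Rightarrow> complex" and c :: "int \<Rightarrow> complex"
  defines "\<phi> \<equiv> exp_sum (\<lambda>k. \<alpha> k * c (int k))"
  shows "substitution c (fps_nth (power_sum_exp \<alpha>) l) =
    (\<Sum>i=0..l. Poly_Mapping.single (- int i) (cst (fps_nth \<phi> i) * fps_nth (power_sum_exp \<alpha>) (l - i)))"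
proof -
  define M where "M = power_sum_exp \<alpha>"
  define D where "D = Abs_fps (\<lambda>k. cst (\<alpha> (Suc k)) * pvar (int (Suc k)))"
  \<comment> \<open>In a formal variable x that marks \<open>l\<close>, \<open>G1\<close> is
    M(\<alpha>; x) and \<open>G2\<close> is \<phi>(x/z). The substitution splits the logarithmic
    derivative \<open>D\<close> into the two parts \<open>D1\<close> and \<open>D2\<close>, which
    belong to \<open>G1\<close> and \<open>G2\<close>.\<close>
  define F where "F = Abs_fps (\<lambda>n. substitution c (fps_nth M n))"
  define G1 where "G1 = Abs_fps (\<lambda>n. cst (fps_nth M n) :: int \<Rightarrow>\<^sub>0 ps_poly)"
  define G2 where "G2 = Abs_fps (\<lambda>n. Poly_Mapping.single (- int n) (cst (fps_nth \<phi> n) :: ps_poly))"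
  define D1 where "D1 = Abs_fps (\<lambda>n. cst (fps_nth D n) :: int \<Rightarrow>\<^sub>0 ps_poly)"
  define D2 where "D2 = Abs_fps (\<lambda>n. Poly_Mapping.single (- int (Suc n)) (cst (\<alpha> (Suc n) * c (int (Suc n))) :: ps_poly))"
  have rec: "of_nat (Suc n) * fps_nth M (Suc n) = (\<Sum>i=0..n. fps_nth M i * fps_nth D (n - i))" for n
    using arg_cong[OF deriv_power_sum_exp[of \<alpha>], of "\<lambda>f. fps_nth f n"]
    by (simp add: fps_mult_nth M_def D_def del: of_nat_Suc)
  have rec': "of_nat (Suc n) * fps_nth \<phi> (Suc n) =
      (\<Sum>i=0..n. fps_nth \<phi> i * (\<alpha> (Suc (n - i)) * c (int (Suc (n - i)))))" for n
    using arg_cong[OF deriv_exp_sum[of "\<lambda>k. \<alpha> k * c (int k)"], of "\<lambda>f. fps_nth f n"]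
    by (simp add: fps_mult_nth \<phi>_def del: of_nat_Suc)
  have "F = G1 * G2"
  proof (rule fps_eqI_deriv)
    show "fps_nth F 0 = fps_nth (G1 * G2) 0"
      by (simp add: F_def G1_def G2_def M_def \<phi>_def)
    show "fps_deriv F = F * (D1 + D2)"
    proof (rule fps_ext)
      fix n
      have "fps_nth (fps_deriv F) n = substitution c (of_nat (Suc n) * fps_nth M (Suc n))"
        by (simp add: F_def substitution_mult cst_of_nat[symmetric] del: of_nat_Suc)
      also have "\<dots> = (\<Sum>i=0..n. substitution c (fps_nth M i) * substitution c (fps_nth D (n - i)))"
        unfolding rec by (simp add: substitution_sum substitution_mult)
      also have "\<dots> = fps_nth (F * (D1 + D2)) n"
        unfolding fps_mult_nth
        by (intro sum.cong)
           (simp_all add: F_def D1_def D2_def D_def substitution_mult substitution_pvar distrib_left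
             cst_mult cst_mult_single del: of_nat_Suc)
      finally show "fps_nth (fps_deriv F) n = fps_nth (F * (D1 + D2)) n" .
    qed
    have d1: "fps_deriv G1 = G1 * D1"
    proof (rule fps_ext)
      fix n
      have "fps_nth (fps_deriv G1) n = cst (of_nat (Suc n) * fps_nth M (Suc n))"
        by (simp only: cst_mult cst_of_nat) (simp add: G1_def)
      then show "fps_nth (fps_deriv G1) n = fps_nth (G1 * D1) n"
        unfolding rec by (simp add: fps_mult_nth cst_sum cst_mult G1_def D1_def)
    qed
    have d2: "fps_deriv G2 = G2 * D2"
    proof (rule fps_ext)
      fix n
      have "fps_nth (fps_deriv G2) n = cst (cst (of_nat (Suc n))) * Poly_Mapping.single (- int (Suc n)) (cst (fps_nth \<phi> (Suc n)))"
        by (simp only: cst_of_nat) (simp add: G2_def del: of_nat_Suc)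
      also have "\<dots> = Poly_Mapping.single (- int (Suc n)) (cst (of_nat (Suc n) * fps_nth \<phi> (Suc n)))"
        by (simp only: cst_mult_single cst_mult)
      also have "\<dots> = (\<Sum>i=0..n. Poly_Mapping.single (- int (Suc n)) (cst (fps_nth \<phi> i * (\<alpha> (Suc (n - i)) * c (int (Suc (n - i)))))))"
      proof -
        have "Poly_Mapping.single k (cst (sum f S)) = (\<Sum>s\<in>S. Poly_Mapping.single k (cst (f s) :: ps_poly))"
          for k :: int and f and S :: "nat set"
          by (induction S rule: infinite_finite_induct) (simp_all add: cst_add single_add)
        then show ?thesis unfolding rec' by simp
      qed
      also have "\<dots> = fps_nth (G2 * D2) n"
        unfolding fps_mult_nth
      proof (rule sum.cong)
        fix i assume "i \<in> {0..n}"
        then have e: "- int (Suc n) = - int i + - int (Suc (n - i))" by simp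
        show "Poly_Mapping.single (- int (Suc n)) (cst (fps_nth \<phi> i * (\<alpha> (Suc (n - i)) * c (int (Suc (n - i)))))) =
            fps_nth G2 i * fps_nth D2 (n - i)"
          unfolding e by (simp only: G2_def D2_def fps_nth_Abs_fps mult_single cst_mult)
      qed simp
      finally show "fps_nth (fps_deriv G2) n = fps_nth (G2 * D2) n" .
    qed
    show "fps_deriv (G1 * G2) = (G1 * G2) * (D1 + D2)"
      by (simp only: fps_deriv_mult d1 d2) (simp only: algebra_simps)
  qed
  then have "substitution c (fps_nth M l) = (\<Sum>i=0..l. fps_nth G2 i * fps_nth G1 (l - i))"
    by (simp only: mult.commute[of G1] F_def fps_eq_iff fps_mult_nth fps_nth_Abs_fps)
  then show ?thesis
    by (simp add: M_def G1_def G2_def cst_mult_single mult.commute[of "Poly_Mapping.single _ _"] mult_ac)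
qed

definition power_sum_mode :: "(nat \<Rightarrow> complex) \<Rightarrow> int \<Rightarrow> ps_poly" where
  "power_sum_mode \<alpha> = in_z (power_sum_exp \<alpha>)"

lemma power_sum_mode_neg [simp]: "l < 0 \<Longrightarrow> power_sum_mode \<alpha> l = 0"
  by (simp add: power_sum_mode_def in_z_def)

text \<open>Coefficients indexed by all integers, so that sums over modes can be shifted without
  side conditions.\<close>

definition zero_ext :: "complex fps \<Rightarrow> int \<Rightarrow> complex" where
  "zero_ext f i = (if i \<ge> 0 then fps_nth f (nat i) else 0)"

lemma zero_ext_neg [simp]: "i < 0 \<Longrightarrow> zero_ext f i = 0"
  by (simp add: zero_ext_def)

text \<open>The relation T(c; z) M(\<alpha>; w) = \<phi>(w/z) M(\<alpha>; w) T(c; z) at one pair of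
  exponents. The range \<open>B\<close> may be any finite set containing 0..l, so that terms with
  different \<open>l\<close> can be summed over a common range.\<close>

lemma translate_power_sum_mode_mult:
  assumes "finite B" "{0..l} \<subseteq> B"
  shows "translate c n (power_sum_mode \<alpha> l * P) =
    (\<Sum>b\<in>B. cst (zero_ext (exp_sum (\<lambda>k. \<alpha> k * c (int k))) (l - b)) * power_sum_mode \<alpha> b *
      translate c (n + l - b) P)"
proof -
  define \<phi> where "\<phi> = exp_sum (\<lambda>k. \<alpha> k * c (int k))"
  let ?f = "\<lambda>b. cst (zero_ext \<phi> (l - b)) * power_sum_mode \<alpha> b * translate c (n + l - b) P"
  have "translate c n (power_sum_mode \<alpha> l * P) = (\<Sum>b\<in>{0..l}. ?f b)"
  proof (cases "l \<ge> 0")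
    case True
    have "translate c n (power_sum_mode \<alpha> l * P) =
        (\<Sum>i=0..nat l. cst (fps_nth \<phi> i) * fps_nth (power_sum_exp \<alpha>) (nat l - i) * translate c (n + int i) P)"
      using True by (simp add: translate_def substitution_mult power_sum_mode_def in_z_def
          substitution_power_sum_exp \<phi>_def sum_distrib_right lookup_sum lookup_mult_single)
    also have "\<dots> = (\<Sum>b\<in>{0..l}. ?f b)"
      by (rule sum.reindex_bij_witness[where i = "\<lambda>b. nat (l - b)" and j = "\<lambda>i. l - int i"])
         (use True in \<open>auto simp: zero_ext_def power_sum_mode_def in_z_def nat_diff_distrib\<close>)
    finally show ?thesis .
  qed simp
  also have "\<dots> = (\<Sum>b\<in>B. ?f b)"
    by (rule sum.mono_neutral_left) (use assms in \<open>auto simp: not_le\<close>)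
  finally show ?thesis by (simp only: \<phi>_def)
qed

section \<open>Gradings\<close>

definition abs_weight :: "monomial \<Rightarrow> int" where
  "abs_weight \<mu> = (\<Sum>k\<in>Poly_Mapping.keys \<mu>. \<bar>k\<bar> * int (lk \<mu> k))"

lemma weight_superset:
  assumes "finite S" "Poly_Mapping.keys \<mu> \<subseteq> S"
  shows "(\<Sum>k\<in>Poly_Mapping.keys \<mu>. f k * int (lk \<mu> k)) = (\<Sum>k\<in>S. f k * int (lk \<mu> k))"
  by (rule sum.mono_neutral_left) (use assms in \<open>auto simp: in_keys_iff\<close>)

lemma weight_sum_add:
  "(\<Sum>k\<in>Poly_Mapping.keys (\<mu> + \<nu>). f k * int (lk (\<mu> + \<nu>) k)) =
   (\<Sum>k\<in>Poly_Mapping.keys \<mu>. f k * int (lk \<mu> k)) + (\<Sum>k\<in>Poly_Mapping.keys \<nu>. f k * int (lk \<nu> k))"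
proof -
  let ?S = "Poly_Mapping.keys \<mu> \<union> Poly_Mapping.keys \<nu>"
  have "Poly_Mapping.keys (\<mu> + \<nu>) \<subseteq> ?S" by (rule Poly_Mapping.keys_add)
  then have e: "(\<Sum>k\<in>Poly_Mapping.keys \<kappa>. f k * int (lk \<kappa> k)) = (\<Sum>k\<in>?S. f k * int (lk \<kappa> k))"
    if "\<kappa> \<in> {\<mu>, \<nu>, \<mu> + \<nu>}" for \<kappa>
    using that by (intro weight_superset) auto
  show ?thesis
    by (subst (1 2 3) e) (simp_all add: lookup_add distrib_left sum.distrib)
qed

lemma weight_add: "weight (\<mu> + \<nu>) = weight \<mu> + weight \<nu>"
  and abs_weight_add: "abs_weight (\<mu> + \<nu>) = abs_weight \<mu> + abs_weight \<nu>"
  unfolding weight_def abs_weight_def by (rule weight_sum_add)+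

definition homogeneous :: "int \<Rightarrow> ps_poly \<Rightarrow> bool" where
  "homogeneous d P \<longleftrightarrow> (\<forall>\<mu>\<in>Poly_Mapping.keys P. weight \<mu> = d \<and> 0 \<notin> Poly_Mapping.keys \<mu>)"

lemma homogeneous_0 [simp]: "homogeneous d 0"
  by (simp add: homogeneous_def)

lemma homogeneous_add: "homogeneous d P \<Longrightarrow> homogeneous d R \<Longrightarrow> homogeneous d (P + R)"
  using Poly_Mapping.keys_add[of P R] by (auto simp: homogeneous_def)

lemma homogeneous_sum: "(\<And>s. s \<in> S \<Longrightarrow> homogeneous d (f s)) \<Longrightarrow> homogeneous d (sum f S)"
  by (induction S rule: infinite_finite_induct) (auto intro: homogeneous_add)

lemma notin_keys_add: "k \<notin> Poly_Mapping.keys \<mu> \<Longrightarrow> k \<notin> Poly_Mapping.keys \<nu> \<Longrightarrow> k \<notin> Poly_Mapping.keys (\<mu> + \<nu> :: monomial)"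
  by (simp add: in_keys_iff lookup_add)

lemma homogeneous_mult: "homogeneous d P \<Longrightarrow> homogeneous e R \<Longrightarrow> homogeneous (d + e) (P * R)"
  using Poly_Mapping.keys_mult[of P R] by (force simp: homogeneous_def weight_add dest: notin_keys_add)

lemma homogeneous_cst [simp]: "homogeneous 0 (cst a)"
  by (auto simp: homogeneous_def cst_def weight_def split: if_splits)

lemma homogeneous_cst_mult: "homogeneous d P \<Longrightarrow> homogeneous d (cst a * P)"
  using homogeneous_mult[of 0 "cst a"] by simp

lemma homogeneous_pvar: "k \<noteq> 0 \<Longrightarrow> homogeneous k (pvar k)"
  by (auto simp: homogeneous_def pvar_def weight_def)

text \<open>The substitution trades p_k for z^-k. Hence the weight minus the power of z stays at
  \<open>d\<close>, and |power of z| plus \<open>abs_weight\<close> stays below a bound that does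
  not depend on the coefficients c.\<close>

definition graded :: "int \<Rightarrow> int \<Rightarrow> (int \<Rightarrow>\<^sub>0 ps_poly) \<Rightarrow> bool" where
  "graded d B X \<longleftrightarrow> (\<forall>i. \<forall>\<nu>\<in>Poly_Mapping.keys (lk X i).
     weight \<nu> = d + i \<and> 0 \<notin> Poly_Mapping.keys \<nu> \<and> \<bar>i\<bar> + abs_weight \<nu> \<le> B)"

lemma graded_mult:
  assumes "graded d B X" "graded e C Y"
  shows "graded (d + e) (B + C) (X * Y)"
  unfolding graded_def
proof (intro allI ballI)
  fix i \<nu> assume "\<nu> \<in> Poly_Mapping.keys (lk (X * Y) i)"
  then have "\<nu> \<in> (\<Union>a\<in>Poly_Mapping.keys X. Poly_Mapping.keys (lk X a * lk Y (i - a)))"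
    unfolding lookup_mult_group by (rule subsetD[OF Poly_Mapping.keys_sum])
  then obtain a where "\<nu> \<in> Poly_Mapping.keys (lk X a * lk Y (i - a))" by blast
  then have "\<nu> \<in> {\<mu> + \<mu>' | \<mu> \<mu>'. \<mu> \<in> Poly_Mapping.keys (lk X a) \<and> \<mu>' \<in> Poly_Mapping.keys (lk Y (i - a))}"
    by (rule subsetD[OF Poly_Mapping.keys_mult])
  then obtain \<mu> \<mu>' where m: "\<nu> = \<mu> + \<mu>'" "\<mu> \<in> Poly_Mapping.keys (lk X a)" "\<mu>' \<in> Poly_Mapping.keys (lk Y (i - a))"
    by blast
  have "weight \<mu> = d + a \<and> 0 \<notin> Poly_Mapping.keys \<mu> \<and> \<bar>a\<bar> + abs_weight \<mu> \<le> B"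
    "weight \<mu>' = e + (i - a) \<and> 0 \<notin> Poly_Mapping.keys \<mu>' \<and> \<bar>i - a\<bar> + abs_weight \<mu>' \<le> C"
    using assms m(2,3) unfolding graded_def by blast+
  then show "weight \<nu> = d + e + i \<and> 0 \<notin> Poly_Mapping.keys \<nu> \<and> \<bar>i\<bar> + abs_weight \<nu> \<le> B + C"
    unfolding m(1) weight_add abs_weight_add by (auto simp: notin_keys_add)
qed

lemma graded_1 [simp]: "graded 0 0 1"
  by (auto simp: graded_def lookup_one when_def weight_def abs_weight_def)

lemma graded_power: "graded d B X \<Longrightarrow> graded (d * int n) (B * int n) (X ^ n)"
proof (induction n)
  case (Suc n)
  then show ?case using graded_mult[of d B X "d * int n" "B * int n" "X ^ n"] by (simp add: distrib_left)
qed simp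

lemma graded_prod:
  "finite S \<Longrightarrow> (\<And>k. k \<in> S \<Longrightarrow> graded (d k) (B k) (X k)) \<Longrightarrow> graded (sum d S) (sum B S) (prod X S)"
  by (induction S rule: finite_induct) (auto intro: graded_mult)

lemma graded_subst_monomial:
  assumes "0 \<notin> Poly_Mapping.keys \<mu>"
  shows "graded (weight \<mu>) (abs_weight \<mu>) (subst_monomial c \<mu>)"
  unfolding subst_monomial_def weight_def abs_weight_def
proof (intro graded_prod graded_power)
  fix k assume "k \<in> Poly_Mapping.keys \<mu>"
  then have "k \<noteq> 0" using assms by auto
  have "lk (cst (pvar k) + Poly_Mapping.single (- k) (cst (c k))) i =
      (if i = 0 then pvar k else if i = - k then cst (c k) else 0)" for i
    using \<open>k \<noteq> 0\<close> by (auto simp: lookup_add cst_def[of "pvar k"] lookup_single)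
  then show "graded k \<bar>k\<bar> (cst (pvar k) + Poly_Mapping.single (- k) (cst (c k)))"
    using \<open>k \<noteq> 0\<close> by (auto simp: graded_def pvar_def cst_def weight_def abs_weight_def split: if_splits)
qed simp

lemma keys_translate:
  assumes "\<nu> \<in> Poly_Mapping.keys (translate c i P)"
  obtains \<mu> where "\<mu> \<in> Poly_Mapping.keys P" "\<nu> \<in> Poly_Mapping.keys (lk (subst_monomial c \<mu>) i)"
proof -
  have "translate c i P = (\<Sum>\<mu>\<in>Poly_Mapping.keys P. cst (lk P \<mu>) * lk (subst_monomial c \<mu>) i)"
    by (simp add: translate_def substitution_def lookup_sum lookup_cst_mult_left)
  then obtain \<mu> where \<mu>: "\<mu> \<in> Poly_Mapping.keys P" "\<nu> \<in> Poly_Mapping.keys (cst (lk P \<mu>) * lk (subst_monomial c \<mu>) i)"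
    using assms Poly_Mapping.keys_sum by fastforce
  then show thesis using that by (auto simp: in_keys_iff lookup_cst_mult)
qed

lemma homogeneous_translate:
  assumes "homogeneous d P"
  shows "homogeneous (d + i) (translate c i P)"
  unfolding homogeneous_def
proof
  fix \<nu> assume "\<nu> \<in> Poly_Mapping.keys (translate c i P)"
  then obtain \<mu> where "\<mu> \<in> Poly_Mapping.keys P" "\<nu> \<in> Poly_Mapping.keys (lk (subst_monomial c \<mu>) i)"
    by (rule keys_translate)
  then show "weight \<nu> = d + i \<and> 0 \<notin> Poly_Mapping.keys \<nu>"
    using assms graded_subst_monomial[of \<mu> c] by (auto simp: homogeneous_def graded_def)
qed

text \<open>One bound serves all \<open>c\<close>. This matters once \<open>c\<close> varies with
  the parameters, because the set of nonzero modes may vary with it.\<close>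

lemma translate_bounded:
  assumes "homogeneous d P"
  obtains B where "\<And>c i. translate c i P \<noteq> 0 \<Longrightarrow> \<bar>i\<bar> \<le> B"
proof
  fix c i assume "translate c i P \<noteq> 0"
  then obtain \<nu> where "\<nu> \<in> Poly_Mapping.keys (translate c i P)" by (metis ex_in_conv keys_eq_empty)
  then obtain \<mu> where m: "\<mu> \<in> Poly_Mapping.keys P" "\<nu> \<in> Poly_Mapping.keys (lk (subst_monomial c \<mu>) i)"
    by (rule keys_translate)
  then have "\<bar>i\<bar> + abs_weight \<nu> \<le> abs_weight \<mu>"
    using assms graded_subst_monomial[of \<mu> c] by (auto simp: homogeneous_def graded_def)
  moreover have nonneg: "abs_weight \<kappa> \<ge> 0" for \<kappa> by (simp add: abs_weight_def sum_nonneg)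
  have "abs_weight \<mu> \<le> (\<Sum>\<mu>\<in>Poly_Mapping.keys P. abs_weight \<mu>)"
    using m(1) nonneg by (intro member_le_sum) auto
  ultimately show "\<bar>i\<bar> \<le> (\<Sum>\<mu>\<in>Poly_Mapping.keys P. abs_weight \<mu>)"
    using nonneg[of \<nu>] by linarith
qed

text \<open>The differential equation expresses each coefficient by products of lower ones with some
  p_k of the complementary degree, so strong induction applies.\<close>

lemma homogeneous_power_sum_exp: "homogeneous (int l) (fps_nth (power_sum_exp \<alpha>) l)"
proof (induction l rule: less_induct)
  case (less l)
  show ?case
  proof (cases l)
    case 0
    then show ?thesis using homogeneous_cst[of 1] by simp
  next
    case (Suc n)
    have "of_nat (Suc n) * fps_nth (power_sum_exp \<alpha>) (Suc n) = (\<Sum>i=0..n. fps_nth (power_sum_exp \<alpha>) i *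
        (cst (\<alpha> (Suc (n - i))) * pvar (int (Suc (n - i)))))"
      using arg_cong[OF deriv_power_sum_exp[of \<alpha>], of "\<lambda>f. fps_nth f n"]
      by (simp add: fps_mult_nth del: of_nat_Suc)
    also have "homogeneous (int l) \<dots>"
    proof (rule homogeneous_sum)
      fix i assume i: "i \<in> {0..n}"
      have "homogeneous (int i + int (Suc (n - i))) (fps_nth (power_sum_exp \<alpha>) i *
          (cst (\<alpha> (Suc (n - i))) * pvar (int (Suc (n - i)))))"
        using i Suc by (intro homogeneous_mult homogeneous_cst_mult homogeneous_pvar less) auto
      moreover have "int i + int (Suc (n - i)) = int l" using i Suc by simp
      ultimately show "homogeneous (int l) (fps_nth (power_sum_exp \<alpha>) i *
          (cst (\<alpha> (Suc (n - i))) * pvar (int (Suc (n - i)))))" by simp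
    qed
    finally have "homogeneous (int l) (cst (of_nat (Suc n)) * fps_nth (power_sum_exp \<alpha>) l)"
      using Suc by (simp only: cst_of_nat)
    then have "homogeneous (int l) (cst (1 / of_nat (Suc n)) * (cst (of_nat (Suc n)) * fps_nth (power_sum_exp \<alpha>) l))"
      by (rule homogeneous_cst_mult)
    then show ?thesis by (simp add: mult.assoc[symmetric] cst_mult[symmetric] del: of_nat_Suc)
  qed
qed

lemma homogeneous_power_sum_mode: "homogeneous l (power_sum_mode \<alpha> l)"
  using homogeneous_power_sum_exp[of "nat l" \<alpha>] by (cases "l \<ge> 0") (simp_all add: power_sum_mode_def in_z_def)

section \<open>Vertex operators\<close>

text \<open>\<open>vertex \<alpha> c\<close> consists of the modes of
  \<open>exp (\<Sum>\<^sub>k\<^sub>>\<^sub>0 \<alpha>\<^sub>k p\<^sub>k z\<^sup>k / k)\<close> times the substitution \<open>p\<^sub>k \<mapsto> p\<^sub>k + c\<^sub>k z\<^sup>-\<^sup>k\<close>.\<close>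

definition vertex :: "(nat \<Rightarrow> complex) \<Rightarrow> (int \<Rightarrow> complex) \<Rightarrow> int \<Rightarrow> ps_poly \<Rightarrow> ps_poly" where
  "vertex \<alpha> c n P = (\<Sum>i | translate c i P \<noteq> 0. power_sum_mode \<alpha> (n - i) * translate c i P)"

lemma vertex_superset:
  assumes "finite I" "{i. translate c i P \<noteq> 0} \<subseteq> I"
  shows "vertex \<alpha> c n P = (\<Sum>i\<in>I. power_sum_mode \<alpha> (n - i) * translate c i P)"
  unfolding vertex_def by (rule sum.mono_neutral_left) (use assms in auto)

lemma vertex_0 [simp]: "vertex \<alpha> c n 0 = 0"
  by (simp add: vertex_def)

lemma vertex_add: "vertex \<alpha> c n (P + R) = vertex \<alpha> c n P + vertex \<alpha> c n R"
proof -
  let ?I = "{i. translate c i P \<noteq> 0} \<union> {i. translate c i R \<noteq> 0}"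
  show ?thesis
    by (subst (1 2 3) vertex_superset[of ?I])
       (auto simp: finite_translate translate_add distrib_left sum.distrib)
qed

lemma vertex_sum: "vertex \<alpha> c n (sum f S) = (\<Sum>s\<in>S. vertex \<alpha> c n (f s))"
  by (induction S rule: infinite_finite_induct) (simp_all add: vertex_add)

lemma vertex_cst_mult: "vertex \<alpha> c n (cst a * P) = cst a * vertex \<alpha> c n P"
proof -
  let ?I = "{i. translate c i P \<noteq> 0}"
  have "vertex \<alpha> c n (cst a * P) = (\<Sum>i\<in>?I. power_sum_mode \<alpha> (n - i) * translate c i (cst a * P))"
    by (rule vertex_superset) (auto simp: finite_translate translate_cst_mult)
  then show ?thesis
    by (simp add: vertex_def translate_cst_mult sum_distrib_left mult.left_commute)
qed

lemma homogeneous_vertex: "homogeneous d P \<Longrightarrow> homogeneous (d + n) (vertex \<alpha> c n P)"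
  unfolding vertex_def
proof (rule homogeneous_sum)
  fix i assume "homogeneous d P"
  then show "homogeneous (d + n) (power_sum_mode \<alpha> (n - i) * translate c i P)"
    using homogeneous_mult[OF homogeneous_power_sum_mode[of "n - i" \<alpha>] homogeneous_translate[of d P i c]]
    by (simp add: algebra_simps)
qed

text \<open>Moves a vertex operator in z past M(\<alpha>'; w). The offset \<open>j\<close> is the
  power of w contributed by an accompanying translation; summing over the total power
  \<open>b\<close> of w lets the ranges for different \<open>j\<close> be merged.\<close>

lemma vertex_mode_mult:
  fixes \<alpha> \<alpha>' :: "nat \<Rightarrow> complex" and c :: "int \<Rightarrow> complex"
  defines "\<phi> \<equiv> zero_ext (exp_sum (\<lambda>k. \<alpha>' k * c (int k)))"
  assumes "finite B" "{j..n} \<subseteq> B"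
  shows "vertex \<alpha> c m (power_sum_mode \<alpha>' (n - j) * P) =
    (\<Sum>b\<in>B. cst (\<phi> (n - b)) * power_sum_mode \<alpha>' (b - j) * vertex \<alpha> c (m + n - b) P)"
proof -
  define K where "K = {i. translate c i P \<noteq> 0}"
  define I where "I = {i. translate c i (power_sum_mode \<alpha>' (n - j) * P) \<noteq> 0} \<union>
      (\<Union>b\<in>B. (\<lambda>i. i - (n - b)) ` K)"
  have fin: "finite K" "finite I"
    using assms(2) by (auto simp: K_def I_def finite_translate)
  have "{0..n - j} \<subseteq> (\<lambda>b. b - j) ` B"
  proof
    fix x assume "x \<in> {0..n - j}"
    then have "x + j \<in> B" using assms(3) by auto
    then show "x \<in> (\<lambda>b. b - j) ` B" by (rule rev_image_eqI) simp
  qed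
  then have t: "translate c i (power_sum_mode \<alpha>' (n - j) * P) =
     (\<Sum>b\<in>B. cst (\<phi> (n - b)) * power_sum_mode \<alpha>' (b - j) * translate c (i + (n - b)) P)" for i
    using assms(2) unfolding \<phi>_def
    by (subst translate_power_sum_mode_mult[of "(\<lambda>b. b - j) ` B"])
       (simp_all add: sum.reindex inj_on_def algebra_simps)
  have "vertex \<alpha> c m (power_sum_mode \<alpha>' (n - j) * P) =
     (\<Sum>i\<in>I. power_sum_mode \<alpha> (m - i) * translate c i (power_sum_mode \<alpha>' (n - j) * P))"
    by (rule vertex_superset[OF fin(2)]) (auto simp: I_def)
  also have "\<dots> = (\<Sum>b\<in>B. \<Sum>i\<in>I. cst (\<phi> (n - b)) * power_sum_mode \<alpha>' (b - j) *
       (power_sum_mode \<alpha> (m - i) * translate c (i + (n - b)) P))"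
    unfolding t sum_distrib_left by (subst sum.swap) (simp only: mult_ac)
  also have "\<dots> = (\<Sum>b\<in>B. cst (\<phi> (n - b)) * power_sum_mode \<alpha>' (b - j) * vertex \<alpha> c (m + n - b) P)"
  proof (intro sum.cong refl)
    fix b assume b: "b \<in> B"
    have "K \<subseteq> (\<lambda>i. i + (n - b)) ` I"
    proof
      fix x assume "x \<in> K"
      then have "x - (n - b) \<in> I" using b by (auto simp: I_def)
      then show "x \<in> (\<lambda>i. i + (n - b)) ` I" by (rule rev_image_eqI) simp
    qed
    then have "vertex \<alpha> c (m + n - b) P =
        (\<Sum>i\<in>(\<lambda>i. i + (n - b)) ` I. power_sum_mode \<alpha> (m + n - b - i) * translate c i P)"
      using fin by (intro vertex_superset) (auto simp: K_def)
    also have "\<dots> = (\<Sum>i\<in>I. power_sum_mode \<alpha> (m - i) * translate c (i + (n - b)) P)"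
      by (subst sum.reindex) (auto simp: inj_on_def algebra_simps)
    finally show "(\<Sum>i\<in>I. cst (\<phi> (n - b)) * power_sum_mode \<alpha>' (b - j) *
       (power_sum_mode \<alpha> (m - i) * translate c (i + (n - b)) P)) =
       cst (\<phi> (n - b)) * power_sum_mode \<alpha>' (b - j) * vertex \<alpha> c (m + n - b) P"
      by (simp only: sum_distrib_left)
  qed
  finally show ?thesis .
qed

text \<open>The mode at z^a w^b of the normally ordered product M(\<alpha>'; w) M(\<alpha>; z) T(c;
  z) T(c'; w).\<close>

definition vertex_pair ::
  "(nat \<Rightarrow> complex) \<Rightarrow> (int \<Rightarrow> complex) \<Rightarrow> (nat \<Rightarrow> complex) \<Rightarrow> (int \<Rightarrow> complex) \<Rightarrow> int \<Rightarrow> int \<Rightarrow> ps_poly \<Rightarrow> ps_poly" where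
  "vertex_pair \<alpha> c \<alpha>' c' a b P =
     (\<Sum>j | translate c' j P \<noteq> 0. power_sum_mode \<alpha>' (b - j) * vertex \<alpha> c a (translate c' j P))"

lemma translate_translate_nonzero:
  "translate c i (translate c' j P) \<noteq> 0 \<Longrightarrow> translate c i P \<noteq> 0"
  by (metis translate_0 translate_commute)

lemma vertex_pair_superset:
  assumes "finite I" "{i. translate c' i P \<noteq> 0} \<subseteq> I"
  shows "vertex_pair \<alpha> c \<alpha>' c' a b P =
    (\<Sum>j\<in>I. power_sum_mode \<alpha>' (b - j) * vertex \<alpha> c a (translate c' j P))"
  unfolding vertex_pair_def by (rule sum.mono_neutral_left) (use assms in auto)

lemma vertex_pair_eq:
  assumes "finite I" "{i. translate c i P \<noteq> 0} \<subseteq> I" "{i. translate c' i P \<noteq> 0} \<subseteq> I"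
  shows "vertex_pair \<alpha> c \<alpha>' c' a b P = (\<Sum>j\<in>I. \<Sum>i\<in>I.
    power_sum_mode \<alpha>' (b - j) * (power_sum_mode \<alpha> (a - i) * translate c i (translate c' j P)))"
proof -
  have "vertex \<alpha> c a (translate c' j P) =
     (\<Sum>i\<in>I. power_sum_mode \<alpha> (a - i) * translate c i (translate c' j P))" for j
    using assms(1,2) translate_translate_nonzero by (intro vertex_superset) blast+
  then show ?thesis
    by (simp add: vertex_pair_superset[OF assms(1,3)] sum_distrib_left)
qed

text \<open>Multiplications commute with each other and so do translations. This symmetry is what
  relates the two orders of a product.\<close>

lemma vertex_pair_commute:
  "vertex_pair \<alpha> c \<alpha>' c' a b P = vertex_pair \<alpha>' c' \<alpha> c b a P"
proof -
  let ?I = "{i. translate c i P \<noteq> 0} \<union> {i. translate c' i P \<noteq> 0}"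
  have I: "finite ?I" by (simp add: finite_translate)
  have "vertex_pair \<alpha> c \<alpha>' c' a b P = (\<Sum>j\<in>?I. \<Sum>i\<in>?I.
    power_sum_mode \<alpha>' (b - j) * (power_sum_mode \<alpha> (a - i) * translate c i (translate c' j P)))"
    using I by (intro vertex_pair_eq) auto
  also have "\<dots> = (\<Sum>i\<in>?I. \<Sum>j\<in>?I.
    power_sum_mode \<alpha> (a - i) * (power_sum_mode \<alpha>' (b - j) * translate c' j (translate c i P)))"
    by (subst sum.swap) (simp only: translate_commute[of c _ c'] mult.left_commute)
  also have "\<dots> = vertex_pair \<alpha>' c' \<alpha> c b a P"
    using I by (intro vertex_pair_eq[symmetric]) auto
  finally show ?thesis .
qed

lemma vertex_pair_nonzero:
  assumes "vertex_pair \<alpha> c \<alpha>' c' a b P \<noteq> 0"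
  shows "\<exists>j. translate c' j P \<noteq> 0 \<and> j \<le> b"
proof (rule ccontr)
  assume "\<nexists>j. translate c' j P \<noteq> 0 \<and> j \<le> b"
  then have "vertex_pair \<alpha> c \<alpha>' c' a b P = 0"
    unfolding vertex_pair_def by (intro sum.neutral) auto
  with assms show False by simp
qed

lemma finite_set_lower_bound:
  assumes "finite (S :: int set)"
  shows "\<exists>l. \<forall>x\<in>S. l \<le> x"
  using assms by (cases "S = {}") (auto intro: Min_le)

text \<open>A multiplication has no modes of negative degree and a translation finitely many, so
  each exponent is bounded below; their sum is fixed.\<close>

lemma finite_vertex_pair: "finite {b. vertex_pair \<alpha> c \<alpha>' c' (N - b) b P \<noteq> 0}"
proof -
  obtain l where l: "\<forall>j\<in>{i. translate c i P \<noteq> 0}. l \<le> j"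
    using finite_set_lower_bound[OF finite_translate[of c P]] ..
  obtain l' where l': "\<forall>j\<in>{i. translate c' i P \<noteq> 0}. l' \<le> j"
    using finite_set_lower_bound[OF finite_translate[of c' P]] ..
  have "b \<in> {l'..N - l}" if nz: "vertex_pair \<alpha> c \<alpha>' c' (N - b) b P \<noteq> 0" for b
  proof -
    obtain j where j: "translate c' j P \<noteq> 0" "j \<le> b"
      using vertex_pair_nonzero[OF nz] by blast
    have "vertex_pair \<alpha>' c' \<alpha> c b (N - b) P \<noteq> 0"
      using nz by (subst vertex_pair_commute)
    from vertex_pair_nonzero[OF this] obtain j' where j': "translate c j' P \<noteq> 0" "j' \<le> N - b"
      by blast
    have "l' \<le> j" using l' j(1) by blast
    moreover have "l \<le> j'" using l j'(1) by blast
    ultimately show ?thesis using j(2) j'(2) by simp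
  qed
  then have "{b. vertex_pair \<alpha> c \<alpha>' c' (N - b) b P \<noteq> 0} \<subseteq> {l'..N - l}" by blast
  then show ?thesis by (rule finite_subset) simp
qed

text \<open>Convolution of the normally ordered product with \<phi>(w/z), expanded in w/z;
  \<open>n - b\<close> is the power of w that \<phi> supplies.\<close>

lemma vertex_vertex:
  fixes \<alpha> \<alpha>' :: "nat \<Rightarrow> complex" and c c' :: "int \<Rightarrow> complex"
  defines "\<phi> \<equiv> zero_ext (exp_sum (\<lambda>k. \<alpha>' k * c (int k)))"
  assumes J: "finite J" "{b. vertex_pair \<alpha> c \<alpha>' c' (m + n - b) b P \<noteq> 0} \<subseteq> J"
  shows "vertex \<alpha> c m (vertex \<alpha>' c' n P) =
    (\<Sum>b\<in>J. cst (\<phi> (n - b)) * vertex_pair \<alpha> c \<alpha>' c' (m + n - b) b P)"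
proof -
  define I where "I = {i. translate c' i P \<noteq> 0}"
  have I: "finite I" by (simp add: I_def finite_translate)
  obtain l where l: "\<And>j. j \<in> I \<Longrightarrow> l \<le> j" using finite_set_lower_bound[OF I] by blast
  \<comment> \<open>The range of \<open>b\<close> must serve all translation modes \<open>j\<close>
    at once, so it starts at a common lower bound of \<open>I\<close>.\<close>
  define B where "B = {l..n} \<union> J"
  have B: "finite B" "J \<subseteq> B" using J by (auto simp: B_def)
  have "vertex \<alpha> c m (vertex \<alpha>' c' n P) =
      (\<Sum>j\<in>I. vertex \<alpha> c m (power_sum_mode \<alpha>' (n - j) * translate c' j P))"
    by (simp add: vertex_def[of \<alpha>' c'] vertex_sum I_def)
  also have "\<dots> = (\<Sum>j\<in>I. \<Sum>b\<in>B. cst (\<phi> (n - b)) * (power_sum_mode \<alpha>' (b - j) *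
      vertex \<alpha> c (m + n - b) (translate c' j P)))"
  proof (rule sum.cong)
    fix j assume "j \<in> I"
    then have "{j..n} \<subseteq> B" using l[of j] by (auto simp: B_def)
    then show "vertex \<alpha> c m (power_sum_mode \<alpha>' (n - j) * translate c' j P) =
      (\<Sum>b\<in>B. cst (\<phi> (n - b)) * (power_sum_mode \<alpha>' (b - j) * vertex \<alpha> c (m + n - b) (translate c' j P)))"
      unfolding \<phi>_def by (subst vertex_mode_mult[OF B(1)]) (simp_all add: mult.assoc add_diff_eq)
  qed simp
  also have "\<dots> = (\<Sum>b\<in>B. cst (\<phi> (n - b)) * vertex_pair \<alpha> c \<alpha>' c' (m + n - b) b P)"
    by (subst sum.swap) (simp add: vertex_pair_def I_def sum_distrib_left)
  also have "\<dots> = (\<Sum>b\<in>J. cst (\<phi> (n - b)) * vertex_pair \<alpha> c \<alpha>' c' (m + n - b) b P)"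
  proof (rule sum.mono_neutral_right)
    have "vertex_pair \<alpha> c \<alpha>' c' (m + n - b) b P = 0" if "b \<notin> J" for b
      using J(2) that by blast
    then show "\<forall>b\<in>B - J. cst (\<phi> (n - b)) * vertex_pair \<alpha> c \<alpha>' c' (m + n - b) b P = 0"
      by simp
  qed (use B in simp_all)
  finally show ?thesis .
qed

text \<open>The normally ordered product of three copies of one vertex operator in z_1, z_2, z_3;
  the arguments x, y, z are the exponents.\<close>

definition vertex_triple ::
  "(nat \<Rightarrow> complex) \<Rightarrow> (int \<Rightarrow> complex) \<Rightarrow> int \<Rightarrow> int \<Rightarrow> int \<Rightarrow> ps_poly \<Rightarrow> ps_poly" where
  "vertex_triple \<alpha> c x y z P =
     (\<Sum>k | translate c k P \<noteq> 0. power_sum_mode \<alpha> (z - k) * vertex_pair \<alpha> c \<alpha> c x y (translate c k P))"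

lemma vertex_triple_eq:
  assumes "finite I" "{i. translate c i P \<noteq> 0} \<subseteq> I"
  shows "vertex_triple \<alpha> c x y z P = (\<Sum>k\<in>I. \<Sum>j\<in>I. \<Sum>i\<in>I.
    power_sum_mode \<alpha> (z - k) * (power_sum_mode \<alpha> (y - j) * (power_sum_mode \<alpha> (x - i) *
      translate c i (translate c j (translate c k P)))))"
proof -
  have "vertex_pair \<alpha> c \<alpha> c x y (translate c k P) = (\<Sum>j\<in>I. \<Sum>i\<in>I.
    power_sum_mode \<alpha> (y - j) * (power_sum_mode \<alpha> (x - i) * translate c i (translate c j (translate c k P))))" for k
  proof (rule vertex_pair_eq[OF assms(1)])
    show "{i. translate c i (translate c k P) \<noteq> 0} \<subseteq> I"
      using assms(2) translate_translate_nonzero[of c _ c k P] by blast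
    then show "{i. translate c i (translate c k P) \<noteq> 0} \<subseteq> I" .
  qed
  moreover have "vertex_triple \<alpha> c x y z P =
      (\<Sum>k\<in>I. power_sum_mode \<alpha> (z - k) * vertex_pair \<alpha> c \<alpha> c x y (translate c k P))"
    unfolding vertex_triple_def
  proof (rule sum.mono_neutral_left[OF assms])
    have "vertex_pair \<alpha> c \<alpha> c x y 0 = 0" by (simp add: vertex_pair_def)
    then show "\<forall>k\<in>I - {i. translate c i P \<noteq> 0}.
        power_sum_mode \<alpha> (z - k) * vertex_pair \<alpha> c \<alpha> c x y (translate c k P) = 0"
      by simp
  qed
  ultimately show ?thesis by (simp only: sum_distrib_left)
qed

lemma vertex_triple_swap12: "vertex_triple \<alpha> c x y z P = vertex_triple \<alpha> c y x z P"
  unfolding vertex_triple_def by (subst vertex_pair_commute) (rule refl)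

lemma vertex_triple_swap23: "vertex_triple \<alpha> c x y z P = vertex_triple \<alpha> c x z y P"
proof -
  define I where "I = {i. translate c i P \<noteq> 0}"
  have I: "finite I" "{i. translate c i P \<noteq> 0} \<subseteq> I" by (simp_all add: I_def finite_translate)
  show ?thesis
    unfolding vertex_triple_eq[OF I] by (subst sum.swap) (simp only: translate_commute mult.left_commute)
qed

lemma vertex_triple_nonzero:
  assumes "vertex_triple \<alpha> c x y z P \<noteq> 0"
  shows "\<exists>k. translate c k P \<noteq> 0 \<and> k \<le> z"
proof (rule ccontr)
  assume "\<nexists>k. translate c k P \<noteq> 0 \<and> k \<le> z"
  then have "vertex_triple \<alpha> c x y z P = 0"
    unfolding vertex_triple_def by (intro sum.neutral) auto
  with assms show False by simp
qed

lemma vertex_triple_bounded: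
  "\<exists>l. \<forall>x y z. vertex_triple \<alpha> c x y z P \<noteq> 0 \<longrightarrow> l \<le> x \<and> l \<le> y \<and> l \<le> z"
proof -
  obtain l where l: "\<forall>j\<in>{i. translate c i P \<noteq> 0}. l \<le> j"
    using finite_set_lower_bound[OF finite_translate[of c P]] ..
  have z: "l \<le> z" if "vertex_triple \<alpha> c x y z P \<noteq> 0" for x y z
  proof -
    from vertex_triple_nonzero[OF that] obtain k where k: "translate c k P \<noteq> 0" "k \<le> z" by blast
    have "l \<le> k" using l k(1) by blast
    then show ?thesis using k(2) by simp
  qed
  have y: "l \<le> y" if "vertex_triple \<alpha> c x y z P \<noteq> 0" for x y z
    using that unfolding vertex_triple_swap23[of \<alpha> c x y z] by (rule z)
  have "l \<le> x" if "vertex_triple \<alpha> c x y z P \<noteq> 0" for x y z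
    using that unfolding vertex_triple_swap12[of \<alpha> c x y z] by (rule y)
  then show ?thesis using y z by blast
qed

text \<open>The coefficient of \<open>x\<^sup>\<beta>\<^sup>+\<^sup>\<gamma> y\<^sup>\<gamma>\<close> in \<open>\<phi>(x) \<phi>(y) \<phi>(x y)\<close>.\<close>

definition triple_kernel :: "complex fps \<Rightarrow> int \<Rightarrow> int \<Rightarrow> complex" where
  "triple_kernel f \<beta> \<gamma> = (\<Sum>s\<in>{0..\<gamma>}. zero_ext f s * zero_ext f (\<gamma> - s) * zero_ext f (\<beta> + s))"

text \<open>Normal ordering produces \<phi>(z_3/z_2), \<phi>(z_3/z_1) and \<phi>(z_2/z_1). In the
  proof they supply the exponents \<open>r - z\<close>, \<open>z - w\<close> and
  \<open>n + r - z - y\<close>, and summing out \<open>z\<close> leaves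
  \<open>triple_kernel\<close>.\<close>

lemma vertex_vertex_vertex:
  fixes \<alpha> :: "nat \<Rightarrow> complex" and c :: "int \<Rightarrow> complex"
  defines "f \<equiv> exp_sum (\<lambda>k. \<alpha> k * c (int k))"
  assumes J: "finite J" "\<And>y z. vertex_triple \<alpha> c (m + n + r - y - z) y z P \<noteq> 0 \<Longrightarrow> (y, z) \<in> J"
  shows "vertex \<alpha> c m (vertex \<alpha> c n (vertex \<alpha> c r P)) =
    (\<Sum>(y, z)\<in>J. cst (triple_kernel f (n - y) (r - z)) * vertex_triple \<alpha> c (m + n + r - y - z) y z P)"
proof -
  define N where "N = m + n + r"
  define \<phi> where "\<phi> = zero_ext f"
  define I where "I = {i. translate c i P \<noteq> 0}"
  have I: "finite I" by (simp add: I_def finite_translate)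
  obtain l where l: "\<forall>x\<in>I \<union> snd ` J. l \<le> x"
    using finite_set_lower_bound[of "I \<union> snd ` J"] I J(1) by blast
  \<comment> \<open>A lower bound of negatives: \<open>- l'\<close> bounds \<open>r\<close> and all
    third exponents from above.\<close>
  obtain l' where l': "\<forall>x\<in>uminus ` insert r (snd ` J). l' \<le> x"
    using finite_set_lower_bound[of "uminus ` insert r (snd ` J)"] J(1) by blast
  define Z where "Z = {l..- l'}"
  have Z: "finite Z" "snd ` J \<subseteq> Z" "r \<le> - l'"
    using l l' by (force simp: Z_def)+
  have Zk: "{k..z} \<subseteq> Z" if "k \<in> I" "z \<le> - l'" for k z
    using l that by (auto simp: Z_def)
  define Y where "Y = fst ` J \<union> (\<Union>w\<in>Z. \<Union>k\<in>I. {y. vertex_pair \<alpha> c \<alpha> c (N - w - y) y (translate c k P) \<noteq> 0})"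
  have Y: "finite Y" "fst ` J \<subseteq> Y"
    using J(1) I Z(1) by (auto simp: Y_def intro!: finite_vertex_pair)
  have YI: "{y. vertex_pair \<alpha> c \<alpha> c (N - w - y) y (translate c k P) \<noteq> 0} \<subseteq> Y" if "w \<in> Z" "k \<in> I" for w k
    using that unfolding Y_def by blast
  let ?T = "\<lambda>z w y k. cst (\<phi> (r - z) * \<phi> (z - w) * \<phi> (n + r - z - y)) *
      (power_sum_mode \<alpha> (w - k) * vertex_pair \<alpha> c \<alpha> c (N - w - y) y (translate c k P))"
  have vvv: "vertex \<alpha> c m (vertex \<alpha> c n (power_sum_mode \<alpha> (r - k) * translate c k P)) =
      (\<Sum>z\<in>Z. \<Sum>w\<in>Z. \<Sum>y\<in>Y. ?T z w y k)" if k: "k \<in> I" for k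
  proof -
    have "vertex \<alpha> c n (power_sum_mode \<alpha> (r - k) * translate c k P) =
        (\<Sum>z\<in>Z. cst (\<phi> (r - z)) * (power_sum_mode \<alpha> (z - k) * vertex \<alpha> c (n + r - z) (translate c k P)))"
      using vertex_mode_mult[OF Z(1) Zk[OF k Z(3)], where ?\<alpha>' = \<alpha>]
      by (simp only: \<phi>_def f_def mult.assoc)
    moreover have "vertex \<alpha> c m (power_sum_mode \<alpha> (z - k) * vertex \<alpha> c (n + r - z) (translate c k P)) =
        (\<Sum>w\<in>Z. cst (\<phi> (z - w)) * (power_sum_mode \<alpha> (w - k) *
           vertex \<alpha> c (m + z - w) (vertex \<alpha> c (n + r - z) (translate c k P))))" if "z \<in> Z" for z
    proof -
      have "z \<le> - l'" using that by (simp add: Z_def)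
      from vertex_mode_mult[OF Z(1) Zk[OF k this], where ?\<alpha>' = \<alpha>] show ?thesis
        by (simp only: \<phi>_def f_def mult.assoc)
    qed
    moreover have "vertex \<alpha> c (m + z - w) (vertex \<alpha> c (n + r - z) (translate c k P)) =
        (\<Sum>y\<in>Y. cst (\<phi> (n + r - z - y)) * vertex_pair \<alpha> c \<alpha> c (N - w - y) y (translate c k P))"
      if "w \<in> Z" for z w
    proof -
      have e: "m + z - w + (n + r - z) = N - w" by (simp add: N_def)
      show ?thesis
        using vertex_vertex[of Y \<alpha> c \<alpha> c "m + z - w" "n + r - z" "translate c k P"] Y(1) YI[OF that k]
        by (simp only: e \<phi>_def f_def)
    qed
    ultimately have "vertex \<alpha> c m (vertex \<alpha> c n (power_sum_mode \<alpha> (r - k) * translate c k P)) =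
      (\<Sum>z\<in>Z. cst (\<phi> (r - z)) * (\<Sum>w\<in>Z. cst (\<phi> (z - w)) * (power_sum_mode \<alpha> (w - k) *
       (\<Sum>y\<in>Y. cst (\<phi> (n + r - z - y)) * vertex_pair \<alpha> c \<alpha> c (N - w - y) y (translate c k P)))))"
      by (simp add: vertex_sum vertex_cst_mult)
    then show ?thesis
      by (simp only: sum_distrib_left cst_mult mult_ac)
  qed
  have kernel: "(\<Sum>z\<in>Z. \<phi> (r - z) * \<phi> (z - w) * \<phi> (n + r - z - y)) = triple_kernel f (n - y) (r - w)"
    if "w \<in> Z" for w y
  proof -
    have "triple_kernel f (n - y) (r - w) = (\<Sum>z\<in>{w..r}. \<phi> (r - z) * \<phi> (z - w) * \<phi> (n + r - z - y))"
      unfolding triple_kernel_def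
      by (rule sum.reindex_bij_witness[where i = "\<lambda>z. r - z" and j = "\<lambda>s. r - s"])
         (auto simp: \<phi>_def algebra_simps)
    also have "\<dots> = (\<Sum>z\<in>Z. \<phi> (r - z) * \<phi> (z - w) * \<phi> (n + r - z - y))"
      using that Z by (intro sum.mono_neutral_left) (auto simp: Z_def \<phi>_def)
    finally show ?thesis by simp
  qed
  have "vertex \<alpha> c m (vertex \<alpha> c n (vertex \<alpha> c r P)) =
      (\<Sum>k\<in>I. vertex \<alpha> c m (vertex \<alpha> c n (power_sum_mode \<alpha> (r - k) * translate c k P)))"
    by (simp add: vertex_def[of \<alpha> c r] vertex_sum I_def)
  also have "\<dots> = (\<Sum>k\<in>I. \<Sum>z\<in>Z. \<Sum>w\<in>Z. \<Sum>y\<in>Y. ?T z w y k)"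
    using vvv by (intro sum.cong refl)
  also have "\<dots> = (\<Sum>y\<in>Y. \<Sum>w\<in>Z. \<Sum>k\<in>I. \<Sum>z\<in>Z. ?T z w y k)"
  proof -
    have "(\<Sum>k\<in>I. \<Sum>z\<in>Z. \<Sum>w\<in>Z. \<Sum>y\<in>Y. ?T z w y k) = (\<Sum>k\<in>I. \<Sum>w\<in>Z. \<Sum>y\<in>Y. \<Sum>z\<in>Z. ?T z w y k)"
      by (subst sum.swap, rule sum.cong[OF refl], rule sum.cong[OF refl], rule sum.swap)
    also have "\<dots> = (\<Sum>w\<in>Z. \<Sum>y\<in>Y. \<Sum>k\<in>I. \<Sum>z\<in>Z. ?T z w y k)"
      by (subst sum.swap, rule sum.cong[OF refl], rule sum.swap)
    also have "\<dots> = (\<Sum>y\<in>Y. \<Sum>w\<in>Z. \<Sum>k\<in>I. \<Sum>z\<in>Z. ?T z w y k)"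
      by (rule sum.swap)
    finally show ?thesis .
  qed
  also have "\<dots> = (\<Sum>y\<in>Y. \<Sum>w\<in>Z. cst (triple_kernel f (n - y) (r - w)) * vertex_triple \<alpha> c (N - y - w) y w P)"
  proof (intro sum.cong refl)
    fix y w assume w: "w \<in> Z"
    have "(\<Sum>k\<in>I. \<Sum>z\<in>Z. ?T z w y k) = (\<Sum>k\<in>I. (\<Sum>z\<in>Z. cst (\<phi> (r - z) * \<phi> (z - w) * \<phi> (n + r - z - y))) *
      (power_sum_mode \<alpha> (w - k) * vertex_pair \<alpha> c \<alpha> c (N - w - y) y (translate c k P)))"
      by (simp only: sum_distrib_right)
    also have "\<dots> = cst (triple_kernel f (n - y) (r - w)) * vertex_triple \<alpha> c (N - y - w) y w P"
      unfolding cst_sum[symmetric] kernel[OF w] sum_distrib_left[symmetric] vertex_triple_def I_def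
      by (simp only: diff_diff_eq add.commute)
    finally show "(\<Sum>k\<in>I. \<Sum>z\<in>Z. ?T z w y k) =
      cst (triple_kernel f (n - y) (r - w)) * vertex_triple \<alpha> c (N - y - w) y w P" .
  qed
  also have "\<dots> = (\<Sum>(y, z)\<in>Y \<times> Z. cst (triple_kernel f (n - y) (r - z)) * vertex_triple \<alpha> c (N - y - z) y z P)"
    by (rule sum.cartesian_product)
  also have "\<dots> = (\<Sum>(y, z)\<in>J. cst (triple_kernel f (n - y) (r - z)) * vertex_triple \<alpha> c (N - y - z) y z P)"
  proof (rule sum.mono_neutral_right)
    show "finite (Y \<times> Z)" using Y Z by simp
    show "J \<subseteq> Y \<times> Z" using Y(2) Z(2) by force
    have "vertex_triple \<alpha> c (N - y - z) y z P = 0" if "(y, z) \<notin> J" for y z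
      using J(2)[of y z] that unfolding N_def by blast
    then show "\<forall>i\<in>Y \<times> Z - J. (case i of (y, z) \<Rightarrow>
        cst (triple_kernel f (n - y) (r - z)) * vertex_triple \<alpha> c (N - y - z) y z P) = 0"
      by auto
  qed
  finally show ?thesis by (simp only: N_def)
qed

section \<open>Specialization of the second variable\<close>

text \<open>T(c; z) T(c'; w) at w = z/r: the power w^j turns into r^-j z^j, and the two translations
  merge into one.\<close>

lemma translate_specialize:
  assumes "r \<noteq> 0" "finite B" "{j. translate c' j P \<noteq> 0} \<subseteq> B"
  shows "(\<Sum>j\<in>B. cst (r powi (- j)) * translate c (n - j) (translate c' j P)) =
    translate (\<lambda>k. c k + r powi k * c' k) n P"
  using assms(2,3)
proof (induction P arbitrary: n B rule: ps_poly_induct)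
  case one
  have "(\<Sum>j\<in>B. cst (r powi (- j)) * translate c (n - j) (translate c' j 1)) =
    (\<Sum>j\<in>{0}. cst (r powi (- j)) * translate c (n - j) (translate c' j 1))"
    using one by (intro sum.mono_neutral_right) (auto simp: translate_1)
  then show ?case by (simp add: translate_1)
next
  case (scale a P)
  have "(\<Sum>j\<in>B. cst (r powi (- j)) * translate c (n - j) (translate c' j (cst a * P))) =
     cst a * (\<Sum>j\<in>B. cst (r powi (- j)) * translate c (n - j) (translate c' j P))"
    by (simp add: translate_cst_mult sum_distrib_left mult.left_commute)
  also have "\<dots> = cst a * translate (\<lambda>k. c k + r powi k * c' k) n P"
  proof (cases "a = 0")
    case False
    have "translate c' j P = 0" if "translate c' j (cst a * P) = 0" for j
    proof -
      have "cst (1 / a) * translate c' j (cst a * P) = translate c' j P"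
        using False by (simp only: translate_cst_mult mult.assoc[symmetric] cst_mult[symmetric]) simp
      then show ?thesis using that by simp
    qed
    then have "{j. translate c' j P \<noteq> 0} \<subseteq> B" using scale(3) by blast
    then show ?thesis using scale(1)[of B n] scale(2) by simp
  qed simp
  finally show ?case by (simp add: translate_cst_mult)
next
  case (add P R)
  define B' where "B' = B \<union> {j. translate c' j P \<noteq> 0} \<union> {j. translate c' j R \<noteq> 0}"
  have B': "finite B'" "{j. translate c' j P \<noteq> 0} \<subseteq> B'" "{j. translate c' j R \<noteq> 0} \<subseteq> B'" "B \<subseteq> B'"
    using add(3) by (auto simp: B'_def finite_translate)
  have "translate c' j (P + R) = 0" if "j \<notin> B" for j using add(4) that by blast
  then have "(\<Sum>j\<in>B. cst (r powi (- j)) * translate c (n - j) (translate c' j (P + R))) =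
    (\<Sum>j\<in>B'. cst (r powi (- j)) * translate c (n - j) (translate c' j (P + R)))"
    using B' by (intro sum.mono_neutral_left) simp_all
  also have "\<dots> = (\<Sum>j\<in>B'. cst (r powi (- j)) * translate c (n - j) (translate c' j P)) +
     (\<Sum>j\<in>B'. cst (r powi (- j)) * translate c (n - j) (translate c' j R))"
    by (simp add: translate_add distrib_left sum.distrib)
  also have "\<dots> = translate (\<lambda>k. c k + r powi k * c' k) n (P + R)"
    by (simp only: add(1)[OF B'(1,2)] add(2)[OF B'(1,3)] translate_add)
  finally show ?case .
next
  case (pvar k P)
  define K where "K = {j. translate c' j P \<noteq> 0}"
  \<comment> \<open>Multiplication by p_k also calls for the mode j + k of \<open>P\<close>, so the
    range has to contain the nonzero modes of \<open>P\<close> and their shifts by - k.\<close>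
  define B' where "B' = B \<union> K \<union> (\<lambda>j. j - k) ` K"
  have B': "finite B'" "{j. translate c' j P \<noteq> 0} \<subseteq> B'" "B \<subseteq> B'"
    using pvar(2) by (auto simp: B'_def K_def finite_translate)
  have B'': "finite ((\<lambda>j. j + k) ` B')" "{j. translate c' j P \<noteq> 0} \<subseteq> (\<lambda>j. j + k) ` B'"
  proof -
    show "{j. translate c' j P \<noteq> 0} \<subseteq> (\<lambda>j. j + k) ` B'"
    proof
      fix j assume "j \<in> {j. translate c' j P \<noteq> 0}"
      then have "j - k \<in> B'" by (simp add: B'_def K_def)
      then show "j \<in> (\<lambda>j. j + k) ` B'" by (rule rev_image_eqI) simp
    qed
  qed (use B' in simp)
  define W where "W = (\<lambda>n. translate (\<lambda>k. c k + r powi k * c' k) n P)"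
  have W: "(\<Sum>j\<in>B'. cst (r powi (- j)) * translate c (n - j) (translate c' j P)) = W n" for n
    unfolding W_def by (rule pvar(1)[OF B'(1,2)])
  have W': "(\<Sum>j\<in>B'. cst (r powi (- j)) * translate c (n - j) (translate c' (j + k) P)) = cst (r powi k) * W (n + k)"
  proof -
    have "(\<Sum>j\<in>B'. cst (r powi (- j)) * translate c (n - j) (translate c' (j + k) P)) =
        (\<Sum>j\<in>(\<lambda>j. j + k) ` B'. cst (r powi k) * (cst (r powi (- j)) * translate c (n + k - j) (translate c' j P)))"
      using assms(1) by (subst sum.reindex)
        (auto simp: inj_on_def mult.assoc[symmetric] cst_mult[symmetric] power_int_add[symmetric])
    also have "\<dots> = cst (r powi k) * W (n + k)"
      unfolding W_def by (simp only: sum_distrib_left[symmetric] pvar(1)[OF B''])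
    finally show ?thesis .
  qed
  have "translate c' j (pvar k * P) = 0" if "j \<notin> B" for j using pvar(3) that by blast
  then have "(\<Sum>j\<in>B. cst (r powi (- j)) * translate c (n - j) (translate c' j (pvar k * P))) =
    (\<Sum>j\<in>B'. cst (r powi (- j)) * translate c (n - j) (translate c' j (pvar k * P)))"
    using B' by (intro sum.mono_neutral_left) simp_all
  also have "\<dots> = (\<Sum>j\<in>B'. pvar k * (cst (r powi (- j)) * translate c (n - j) (translate c' j P)) +
      cst (c k) * (cst (r powi (- j)) * translate c (n + k - j) (translate c' j P)) +
      cst (c' k) * (cst (r powi (- j)) * translate c (n - j) (translate c' (j + k) P)))"
  proof (rule sum.cong)
    fix j
    have e: "n - j + k = n + k - j" by simp
    show "cst (r powi (- j)) * translate c (n - j) (translate c' j (pvar k * P)) =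
      pvar k * (cst (r powi (- j)) * translate c (n - j) (translate c' j P)) +
      cst (c k) * (cst (r powi (- j)) * translate c (n + k - j) (translate c' j P)) +
      cst (c' k) * (cst (r powi (- j)) * translate c (n - j) (translate c' (j + k) P))"
      by (simp only: translate_pvar_mult translate_add translate_cst_mult e distrib_left mult.left_commute)
  qed simp
  also have "\<dots> = pvar k * W n + cst (c k) * W (n + k) + cst (c' k) * (cst (r powi k) * W (n + k))"
    by (simp only: sum.distrib sum_distrib_left[symmetric] W W')
  also have "\<dots> = translate (\<lambda>k. c k + r powi k * c' k) n (pvar k * P)"
    unfolding translate_pvar_mult W_def cst_add cst_mult distrib_right
    by (simp only: mult_ac add_ac)
  finally show ?case .
qed

lemma power_sum_mode_specialize:
  assumes "r \<noteq> 0" "finite B" "{0..n} \<subseteq> B"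
  shows "(\<Sum>b\<in>B. cst (r powi (- b)) * (power_sum_mode \<alpha>' b * power_sum_mode \<alpha> (n - b))) =
    power_sum_mode (\<lambda>k. \<alpha> k + (1 / r) ^ k * \<alpha>' k) n"
proof -
  let ?f = "\<lambda>b. cst (r powi (- b)) * (power_sum_mode \<alpha>' b * power_sum_mode \<alpha> (n - b))"
  have "(\<Sum>b\<in>B. ?f b) = (\<Sum>b\<in>{0..n}. ?f b)"
    using assms by (intro sum.mono_neutral_right) (auto simp: not_le)
  also have "\<dots> = power_sum_mode (\<lambda>k. \<alpha> k + (1 / r) ^ k * \<alpha>' k) n"
  proof (cases "n \<ge> 0")
    case True
    have s: "fps_nth (power_sum_exp (\<lambda>k. (1 / r) ^ k * \<alpha>' k)) i = cst ((1 / r) ^ i) * fps_nth (power_sum_exp \<alpha>') i" for i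
      unfolding scale_power_sum_exp[symmetric] scale_arg_def fps_compose_linear by (simp add: cst_power)
    have "power_sum_mode (\<lambda>k. \<alpha> k + (1 / r) ^ k * \<alpha>' k) n =
        fps_nth (power_sum_exp (\<lambda>k. (1 / r) ^ k * \<alpha>' k) * power_sum_exp \<alpha>) (nat n)"
      using True by (simp add: power_sum_mode_def in_z_def power_sum_exp_add add.commute)
    also have "\<dots> = (\<Sum>i=0..nat n. cst ((1 / r) ^ i) * (fps_nth (power_sum_exp \<alpha>') i * fps_nth (power_sum_exp \<alpha>) (nat n - i)))"
      by (simp add: fps_mult_nth s mult.assoc)
    also have "\<dots> = (\<Sum>b\<in>{0..n}. ?f b)"
      by (rule sum.reindex_bij_witness[where i = nat and j = int])
         (use True in \<open>auto simp: power_sum_mode_def in_z_def nat_diff_distrib power_int_minus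
            power_one_over inverse_eq_divide\<close>)
    finally show ?thesis by simp
  qed simp
  finally show ?thesis .
qed

text \<open>A delta function supported at w = z/r evaluates the normally ordered product there. That
  product has no poles, and the data of its two factors simply add.\<close>

lemma vertex_pair_specialize:
  assumes "r \<noteq> 0" "finite J" "{b. vertex_pair \<alpha> c \<alpha>' c' (N - b) b P \<noteq> 0} \<subseteq> J"
  shows "(\<Sum>b\<in>J. cst (r powi (- b)) * vertex_pair \<alpha> c \<alpha>' c' (N - b) b P) =
    vertex (\<lambda>k. \<alpha> k + (1 / r) ^ k * \<alpha>' k) (\<lambda>k. c k + r powi k * c' k) N P"
proof -
  define I where "I = {i. translate c i P \<noteq> 0} \<union> {i. translate c' i P \<noteq> 0}"
  have I: "finite I" "{i. translate c i P \<noteq> 0} \<subseteq> I" "{i. translate c' i P \<noteq> 0} \<subseteq> I"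
    by (auto simp: I_def finite_translate)
  let ?\<alpha> = "\<lambda>k. \<alpha> k + (1 / r) ^ k * \<alpha>' k" and ?c = "\<lambda>k. c k + r powi k * c' k"
  define B where "B = J \<union> (\<Union>i\<in>I. \<Union>j\<in>I. {j..N - i})"
  have B: "finite B" "J \<subseteq> B" "\<And>i j. i \<in> I \<Longrightarrow> j \<in> I \<Longrightarrow> {j..N - i} \<subseteq> B"
    using assms(2) I(1) by (auto simp: B_def)
  define S where "S = {s. translate ?c s P \<noteq> 0} \<union> (\<lambda>(i, j). i + j) ` (I \<times> I)"
  have S: "finite S" "{s. translate ?c s P \<noteq> 0} \<subseteq> S" "\<And>i j. i \<in> I \<Longrightarrow> j \<in> I \<Longrightarrow> i + j \<in> S"
    using I(1) by (auto simp: S_def finite_translate)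
  have "vertex_pair \<alpha> c \<alpha>' c' (N - b) b P = 0" if "b \<notin> J" for b
    using assms(3) that by blast
  then have "(\<Sum>b\<in>J. cst (r powi (- b)) * vertex_pair \<alpha> c \<alpha>' c' (N - b) b P) =
      (\<Sum>b\<in>B. cst (r powi (- b)) * vertex_pair \<alpha> c \<alpha>' c' (N - b) b P)"
    using B by (intro sum.mono_neutral_left) simp_all
  also have "\<dots> = (\<Sum>b\<in>B. \<Sum>j\<in>I. \<Sum>i\<in>I. cst (r powi (- b)) *
      (power_sum_mode \<alpha>' (b - j) * (power_sum_mode \<alpha> (N - b - i) * translate c i (translate c' j P))))"
    by (simp only: vertex_pair_eq[OF I] sum_distrib_left)
  also have "\<dots> = (\<Sum>j\<in>I. \<Sum>i\<in>I. \<Sum>b\<in>B. cst (r powi (- b)) *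
      (power_sum_mode \<alpha>' (b - j) * (power_sum_mode \<alpha> (N - b - i) * translate c i (translate c' j P))))"
    by (subst sum.swap, rule sum.cong[OF refl], rule sum.swap)
  also have "\<dots> = (\<Sum>j\<in>I. \<Sum>i\<in>I. cst (r powi (- j)) * power_sum_mode ?\<alpha> (N - i - j) * translate c i (translate c' j P))"
  proof (intro sum.cong refl)
    fix j i assume ij: "j \<in> I" "i \<in> I"
    have sub: "{0..N - i - j} \<subseteq> (\<lambda>b. b - j) ` B"
    proof
      fix x assume "x \<in> {0..N - i - j}"
      then have "x + j \<in> B" using B(3)[OF ij(2,1)] by auto
      then show "x \<in> (\<lambda>b. b - j) ` B" by (rule rev_image_eqI) simp
    qed
    have fin: "finite ((\<lambda>b. b - j) ` B)" using B(1) by simp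
    have "(\<Sum>b\<in>B. cst (r powi (- b)) * (power_sum_mode \<alpha>' (b - j) * (power_sum_mode \<alpha> (N - b - i) * translate c i (translate c' j P)))) =
      (\<Sum>b\<in>B. cst (r powi (- j)) * (cst (r powi (- (b - j))) * (power_sum_mode \<alpha>' (b - j) * power_sum_mode \<alpha> (N - i - j - (b - j)))) * translate c i (translate c' j P))"
    proof (intro sum.cong refl)
      fix b
      have "cst (r powi (- b)) = cst (r powi (- j)) * (cst (r powi (- (b - j))) :: ps_poly)"
        using assms(1) by (simp add: cst_mult[symmetric] power_int_add[symmetric])
      moreover have "N - b - i = N - i - j - (b - j)" by simp
      ultimately show "cst (r powi (- b)) * (power_sum_mode \<alpha>' (b - j) * (power_sum_mode \<alpha> (N - b - i) * translate c i (translate c' j P))) =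
        cst (r powi (- j)) * (cst (r powi (- (b - j))) * (power_sum_mode \<alpha>' (b - j) * power_sum_mode \<alpha> (N - i - j - (b - j)))) * translate c i (translate c' j P)"
        by (simp only: mult.assoc)
    qed
    also have "\<dots> = cst (r powi (- j)) * (\<Sum>b\<in>(\<lambda>b. b - j) ` B. cst (r powi (- b)) * (power_sum_mode \<alpha>' b * power_sum_mode \<alpha> (N - i - j - b))) * translate c i (translate c' j P)"
      by (subst sum.reindex) (simp_all add: inj_on_def sum_distrib_left sum_distrib_right)
    also have "\<dots> = cst (r powi (- j)) * power_sum_mode ?\<alpha> (N - i - j) * translate c i (translate c' j P)"
      by (simp only: power_sum_mode_specialize[OF assms(1) fin sub])
    finally show "(\<Sum>b\<in>B. cst (r powi (- b)) * (power_sum_mode \<alpha>' (b - j) * (power_sum_mode \<alpha> (N - b - i) * translate c i (translate c' j P)))) =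
       cst (r powi (- j)) * power_sum_mode ?\<alpha> (N - i - j) * translate c i (translate c' j P)" .
  qed
  also have "\<dots> = (\<Sum>j\<in>I. \<Sum>s\<in>S. cst (r powi (- j)) * power_sum_mode ?\<alpha> (N - s) * translate c (s - j) (translate c' j P))"
  proof (rule sum.cong)
    fix j assume j: "j \<in> I"
    have "translate c (s - j) (translate c' j P) = 0" if "s \<notin> (\<lambda>i. i + j) ` I" for s
    proof (rule ccontr)
      assume "translate c (s - j) (translate c' j P) \<noteq> 0"
      then have "s - j \<in> I" using translate_translate_nonzero I(2) by blast
      then have "s \<in> (\<lambda>i. i + j) ` I" by (rule rev_image_eqI) simp
      with that show False ..
    qed
    then have "(\<Sum>s\<in>S. cst (r powi (- j)) * power_sum_mode ?\<alpha> (N - s) * translate c (s - j) (translate c' j P)) =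
      (\<Sum>s\<in>(\<lambda>i. i + j) ` I. cst (r powi (- j)) * power_sum_mode ?\<alpha> (N - s) * translate c (s - j) (translate c' j P))"
      using S(1) S(3)[OF _ j] by (intro sum.mono_neutral_right) auto
    also have "\<dots> = (\<Sum>i\<in>I. cst (r powi (- j)) * power_sum_mode ?\<alpha> (N - i - j) * translate c i (translate c' j P))"
      by (subst sum.reindex) (simp_all add: inj_on_def diff_diff_eq)
    finally show "(\<Sum>i\<in>I. cst (r powi (- j)) * power_sum_mode ?\<alpha> (N - i - j) * translate c i (translate c' j P)) =
      (\<Sum>s\<in>S. cst (r powi (- j)) * power_sum_mode ?\<alpha> (N - s) * translate c (s - j) (translate c' j P))" by simp
  qed simp
  also have "\<dots> = (\<Sum>s\<in>S. power_sum_mode ?\<alpha> (N - s) * (\<Sum>j\<in>I. cst (r powi (- j)) * translate c (s - j) (translate c' j P)))"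
    by (subst sum.swap) (simp only: sum_distrib_left mult_ac)
  also have "\<dots> = vertex ?\<alpha> ?c N P"
    by (simp only: translate_specialize[OF assms(1) I(1,3)] vertex_superset[OF S(1,2)])
  finally show ?thesis .
qed

section \<open>Homogeneous operators on functions of the infinite alphabet\<close>

text \<open>On \<open>functions_X\<close> this is a genuine polynomial, by the finiteness of the
  monomials of each weight.\<close>

definition weight_part :: "int \<Rightarrow> ps_series \<Rightarrow> ps_poly" where
  "weight_part d F = Abs_poly_mapping (\<lambda>\<mu>. if weight \<mu> = d then F \<mu> else 0)"

lemma lookup_weight_part:
  assumes "F \<in> functions_X"
  shows "lk (weight_part d F) \<mu> = (if weight \<mu> = d then F \<mu> else 0)"
proof -
  have "finite {\<mu>. F \<mu> \<noteq> 0 \<and> weight \<mu> = d}"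
    using assms by (simp add: functions_X_def)
  then have "finite {\<mu>. (if weight \<mu> = d then F \<mu> else 0) \<noteq> 0}"
    by (rule rev_finite_subset) (auto split: if_splits)
  then show ?thesis by (simp add: weight_part_def)
qed

lemma homogeneous_weight_part:
  assumes "F \<in> functions_X"
  shows "homogeneous d (weight_part d F)"
  using assms lookup_weight_part[OF assms]
  by (auto simp: homogeneous_def in_keys_iff functions_X_def split: if_splits)

lemma lookup_homogeneous: "homogeneous d P \<Longrightarrow> weight \<nu> \<noteq> d \<Longrightarrow> lk P \<nu> = 0"
  by (auto simp: homogeneous_def in_keys_iff)

text \<open>A homogeneous operator of degree \<open>n\<close> on polynomials acts on a function weight by weight.\<close>

definition extend :: "int \<Rightarrow> (ps_poly \<Rightarrow> ps_poly) \<Rightarrow> operator" where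
  "extend n a F \<nu> = lk (a (weight_part (weight \<nu> - n) F)) \<nu>"

definition homogeneous_op :: "int \<Rightarrow> (ps_poly \<Rightarrow> ps_poly) \<Rightarrow> bool" where
  "homogeneous_op n a \<longleftrightarrow> (\<forall>d P. homogeneous d P \<longrightarrow> homogeneous (d + n) (a P))"

lemma homogeneous_extend:
  assumes "homogeneous_op n a" "F \<in> functions_X"
  shows "homogeneous (weight \<nu>) (a (weight_part (weight \<nu> - n) F))"
proof -
  have "homogeneous (weight \<nu> - n + n) (a (weight_part (weight \<nu> - n) F))"
    using assms homogeneous_weight_part unfolding homogeneous_op_def by blast
  then show ?thesis by simp
qed

lemma extend_functions_X:
  assumes "homogeneous_op n a" "F \<in> functions_X"
  shows "extend n a F \<in> functions_X"
  unfolding functions_X_def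
proof (intro CollectI conjI allI impI)
  fix \<nu> assume "extend n a F \<nu> \<noteq> 0"
  then have "\<nu> \<in> Poly_Mapping.keys (a (weight_part (weight \<nu> - n) F))"
    by (simp add: extend_def in_keys_iff)
  then show "0 \<notin> Poly_Mapping.keys \<nu>"
    using homogeneous_extend[OF assms, of \<nu>] unfolding homogeneous_def by blast
next
  fix d
  have "{\<nu>. extend n a F \<nu> \<noteq> 0 \<and> weight \<nu> = d} \<subseteq> Poly_Mapping.keys (a (weight_part (d - n) F))"
    by (auto simp: extend_def in_keys_iff)
  then show "finite {\<nu>. extend n a F \<nu> \<noteq> 0 \<and> weight \<nu> = d}"
    by (rule finite_subset) simp
qed

lemma weight_part_extend:
  assumes "homogeneous_op n a" "F \<in> functions_X"
  shows "weight_part d (extend n a F) = a (weight_part (d - n) F)"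
proof (rule poly_mapping_eqI)
  fix \<nu>
  have "homogeneous (d - n + n) (a (weight_part (d - n) F))"
    using assms homogeneous_weight_part unfolding homogeneous_op_def by blast
  then show "lk (weight_part d (extend n a F)) \<nu> = lk (a (weight_part (d - n) F)) \<nu>"
    using lookup_homogeneous[of d "a (weight_part (d - n) F)" \<nu>]
    by (simp add: lookup_weight_part[OF extend_functions_X[OF assms]] extend_def)
qed

lemma extend_extend:
  assumes "homogeneous_op n a" "F \<in> functions_X"
  shows "extend m b (extend n a F) \<nu> = lk (b (a (weight_part (weight \<nu> - (m + n)) F))) \<nu>"
  by (simp add: extend_def[of m b] weight_part_extend[OF assms] diff_diff_eq)

text \<open>Only monomials of weight \<open>weight \<nu> - n\<close> can contribute z^n at the
  monomial \<nu>, so the sum over all monomials collapses to one weight.\<close>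

lemma plethysm_eq_extend:
  assumes F: "F \<in> functions_X"
  shows "plethysm c F n = extend n (translate c n) F"
proof
  fix \<nu>
  define P where "P = weight_part (weight \<nu> - n) F"
  have P: "lk P \<mu> = (if weight \<mu> = weight \<nu> - n then F \<mu> else 0)" for \<mu>
    by (simp add: P_def lookup_weight_part[OF F])
  have w: "weight \<nu> = weight \<mu> + n" if "F \<mu> * lk (lk (subst_monomial c \<mu>) n) \<nu> \<noteq> 0" for \<mu>
  proof -
    have "0 \<notin> Poly_Mapping.keys \<mu>" using F that by (auto simp: functions_X_def)
    moreover have "\<nu> \<in> Poly_Mapping.keys (lk (subst_monomial c \<mu>) n)" using that by (simp add: in_keys_iff)
    ultimately show ?thesis using graded_subst_monomial[of \<mu> c] unfolding graded_def by blast
  qed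
  have "{\<mu>. F \<mu> * lk (lk (subst_monomial c \<mu>) n) \<nu> \<noteq> 0} \<subseteq> Poly_Mapping.keys P"
  proof
    fix \<mu> assume "\<mu> \<in> {\<mu>. F \<mu> * lk (lk (subst_monomial c \<mu>) n) \<nu> \<noteq> 0}"
    then show "\<mu> \<in> Poly_Mapping.keys P" using w[of \<mu>] by (simp add: in_keys_iff P)
  qed
  then have "plethysm c F n \<nu> = (\<Sum>\<mu>\<in>Poly_Mapping.keys P. F \<mu> * lk (lk (subst_monomial c \<mu>) n) \<nu>)"
    unfolding plethysm_def by (intro Sum_any.expand_superset) simp_all
  also have "\<dots> = (\<Sum>\<mu>\<in>Poly_Mapping.keys P. lk P \<mu> * lk (lk (subst_monomial c \<mu>) n) \<nu>)"
    by (rule sum.cong) (auto simp: in_keys_iff P split: if_splits)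
  also have "\<dots> = lk (translate c n P) \<nu>"
    by (simp add: translate_def substitution_def lookup_sum lookup_cst_mult_left lookup_cst_mult)
  finally show "plethysm c F n \<nu> = extend n (translate c n) F \<nu>"
    by (simp add: extend_def P_def)
qed

lemma prod_fun_eq_extend:
  assumes "homogeneous l A" "F \<in> functions_X"
  shows "Poly_Mapping.prod_fun (lk A) F = extend l ((*) A) F"
proof
  fix \<nu>
  have "lk A \<mu> * Sum_any (\<lambda>\<kappa>. F \<kappa> when \<nu> = \<mu> + \<kappa>) =
      lk A \<mu> * Sum_any (\<lambda>\<kappa>. lk (weight_part (weight \<nu> - l) F) \<kappa> when \<nu> = \<mu> + \<kappa>)" for \<mu>
  proof (cases "lk A \<mu> = 0")
    case False
    then have "weight \<mu> = l" using lookup_homogeneous[OF assms(1)] by blast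
    then have "(F \<kappa> when \<nu> = \<mu> + \<kappa>) = (lk (weight_part (weight \<nu> - l) F) \<kappa> when \<nu> = \<mu> + \<kappa>)" for \<kappa>
      by (simp add: lookup_weight_part[OF assms(2)] weight_add when_def)
    then show ?thesis by simp
  qed simp
  then show "Poly_Mapping.prod_fun (lk A) F \<nu> = extend l ((*) A) F \<nu>"
    unfolding extend_def times_poly_mapping.rep_eq prod_fun_def by (intro arg_cong[where f = Sum_any] ext)
qed

lemma homogeneous_op_translate: "homogeneous_op n (translate c n)"
  by (simp add: homogeneous_op_def homogeneous_translate)

lemma homogeneous_op_vertex: "homogeneous_op n (\<lambda>P. cst k * vertex \<alpha> c n P)"
  by (simp add: homogeneous_op_def homogeneous_vertex homogeneous_cst_mult)

text \<open>The sum over all multiplication modes \<open>l\<close> is finite because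
  \<open>n - l\<close> has to be a nonzero mode of the translation.\<close>

lemma mult_z_eq_extend:
  assumes F: "F \<in> functions_X"
  shows "mult_z (in_z (power_sum_exp \<alpha>)) (plethysm c F) n = extend n (vertex \<alpha> c n) F"
proof
  fix \<nu>
  define P where "P = weight_part (weight \<nu> - n) F"
  have 1: "Poly_Mapping.prod_fun (lk (in_z (power_sum_exp \<alpha>) l)) (plethysm c F (n - l)) \<nu> =
      lk (power_sum_mode \<alpha> l * translate c (n - l) P) \<nu>" for l
  proof -
    have "Poly_Mapping.prod_fun (lk (power_sum_mode \<alpha> l)) (plethysm c F (n - l)) \<nu> =
        extend l ((*) (power_sum_mode \<alpha> l)) (extend (n - l) (translate c (n - l)) F) \<nu>"
      unfolding plethysm_eq_extend[OF F]
      by (simp only: prod_fun_eq_extend[OF homogeneous_power_sum_mode extend_functions_X[OF homogeneous_op_translate F]])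
    also have "\<dots> = lk (power_sum_mode \<alpha> l * translate c (n - l) P) \<nu>"
      by (simp add: extend_extend[OF homogeneous_op_translate F] P_def)
    finally show ?thesis by (simp add: power_sum_mode_def)
  qed
  define I where "I = {i. translate c i P \<noteq> 0}"
  have I: "finite I" by (simp add: I_def finite_translate)
  have "mult_z (in_z (power_sum_exp \<alpha>)) (plethysm c F) n \<nu> =
      Sum_any (\<lambda>l. lk (power_sum_mode \<alpha> l * translate c (n - l) P) \<nu>)"
    by (simp add: mult_z_def 1)
  also have "\<dots> = (\<Sum>l\<in>(\<lambda>i. n - i) ` I. lk (power_sum_mode \<alpha> l * translate c (n - l) P) \<nu>)"
  proof (rule Sum_any.expand_superset)
    show "{l. lk (power_sum_mode \<alpha> l * translate c (n - l) P) \<nu> \<noteq> 0} \<subseteq> (\<lambda>i. n - i) ` I"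
    proof
      fix l assume "l \<in> {l. lk (power_sum_mode \<alpha> l * translate c (n - l) P) \<nu> \<noteq> 0}"
      then have "n - l \<in> I" by (auto simp: I_def)
      then show "l \<in> (\<lambda>i. n - i) ` I" by (rule rev_image_eqI) simp
    qed
  qed (use I in simp)
  also have "\<dots> = lk (vertex \<alpha> c n P) \<nu>"
    by (subst sum.reindex) (simp_all add: inj_on_def vertex_def I_def lookup_sum)
  finally show "mult_z (in_z (power_sum_exp \<alpha>)) (plethysm c F) n \<nu> = extend n (vertex \<alpha> c n) F \<nu>"
    by (simp add: extend_def P_def)
qed

definition vertex_current :: "complex \<Rightarrow> (nat \<Rightarrow> complex) \<Rightarrow> (int \<Rightarrow> complex) \<Rightarrow> current" where
  "vertex_current \<kappa> \<alpha> c n = extend n (\<lambda>P. cst \<kappa> * vertex \<alpha> c n P)"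

lemma vertex_current_eq:
  assumes "F \<in> functions_X"
  shows "vertex_current \<kappa> \<alpha> c n F \<nu> =
    \<kappa> * mult_z (in_z (power_sum_exp \<alpha>)) (plethysm c F) n \<nu>"
  by (simp add: vertex_current_def mult_z_eq_extend[OF assms] extend_def lookup_cst_mult)

lemma vertex_current_functions_X:
  "F \<in> functions_X \<Longrightarrow> vertex_current \<kappa> \<alpha> c n F \<in> functions_X"
  unfolding vertex_current_def by (rule extend_functions_X[OF homogeneous_op_vertex])

lemma vertex_current_vertex_current:
  assumes "F \<in> functions_X"
  shows "vertex_current \<kappa> \<alpha> c m (vertex_current \<kappa>' \<alpha>' c' n F) \<nu> =
    \<kappa> * \<kappa>' * lk (vertex \<alpha> c m (vertex \<alpha>' c' n (weight_part (weight \<nu> - (m + n)) F))) \<nu>"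
  by (simp add: vertex_current_def extend_extend[OF homogeneous_op_vertex assms] vertex_cst_mult lookup_cst_mult)

text \<open>Start of the degenerate cases: c = 0 leaves a pure multiplication and \<alpha> = 0 a
  pure translation. They bring \<psi>+ and \<psi>- under the general lemmas on vertex
  operators.\<close>

lemma translate_const_0: "translate (\<lambda>k. 0) n P = (if n = 0 then P else 0)"
  by (induction P arbitrary: n rule: ps_poly_induct)
     (simp_all add: translate_1 translate_add translate_cst_mult translate_pvar_mult)

lemma vertex_no_translation: "vertex \<alpha> (\<lambda>k. 0) n P = power_sum_mode \<alpha> n * P"
proof -
  have "{i. translate (\<lambda>k. 0) i P \<noteq> 0} \<subseteq> {0}" by (auto simp: translate_const_0)
  from vertex_superset[OF _ this] show ?thesis by (simp add: translate_const_0)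
qed

lemma vertex_no_multiplication: "vertex (\<lambda>k. 0) c n P = translate c n P"
proof -
  have "power_sum_mode (\<lambda>k. 0) l = (if l = 0 then 1 else 0)" for l
    by (simp add: power_sum_mode_def in_z_def)
  then have "vertex (\<lambda>k. 0) c n P = (\<Sum>i | translate c i P \<noteq> 0. if n = i then translate c i P else 0)"
    unfolding vertex_def by (intro sum.cong) simp_all
  then show ?thesis by (simp add: sum.delta' finite_translate)
qed

lemma prod_fun_power_sum_mode:
  "F \<in> functions_X \<Longrightarrow> Poly_Mapping.prod_fun (lk (in_z (power_sum_exp \<alpha>) n)) F = vertex_current 1 \<alpha> (\<lambda>k. 0) n F"
  using prod_fun_eq_extend[OF homogeneous_power_sum_mode[of n \<alpha>], of F]
  by (simp add: vertex_current_def vertex_no_translation power_sum_mode_def)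

lemma plethysm_eq_vertex_current:
  "F \<in> functions_X \<Longrightarrow> plethysm c F n = vertex_current 1 (\<lambda>k. 0) c n F"
  by (simp add: plethysm_eq_extend vertex_current_def vertex_no_multiplication)

section \<open>Exchange relations\<close>

lemma times_zw_superset:
  assumes "finite S" "Poly_Mapping.keys P \<subseteq> S"
  shows "times_zw P D m n \<nu> = (\<Sum>k\<in>S. lk P k * D (m - fst k) (n - snd k) \<nu>)"
  unfolding times_zw_def by (rule sum.mono_neutral_left) (use assms in \<open>auto simp: in_keys_iff\<close>)

lemma times_zw_add: "times_zw (P + R) D m n \<nu> = times_zw P D m n \<nu> + times_zw R D m n \<nu>"
proof -
  let ?S = "Poly_Mapping.keys P \<union> Poly_Mapping.keys R"
  have "Poly_Mapping.keys (P + R) \<subseteq> ?S" by (rule Poly_Mapping.keys_add)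
  then show ?thesis
    by (simp add: times_zw_superset[of ?S] lookup_add distrib_right sum.distrib)
qed

lemma times_zw_single:
  "times_zw (Poly_Mapping.single k a) D m n \<nu> = a * D (m - fst k) (n - snd k) \<nu>"
  by (subst times_zw_superset[of "{k}"]) (auto split: if_splits)

lemma times_zw_mult: "times_zw (P * R) D = times_zw P (times_zw R D)"
proof (intro ext)
  show "times_zw (P * R) D m n \<nu> = times_zw P (times_zw R D) m n \<nu>" for m n \<nu>
  proof (induction P rule: poly_mapping_induct_add)
    case (2 P k a)
    have "times_zw (Poly_Mapping.single k a * R) D m n \<nu> = a * times_zw R D (m - fst k) (n - snd k) \<nu>"
    proof (induction R rule: poly_mapping_induct_add)
      case (2 R l b)
      then show ?case
        by (simp add: distrib_left mult_single times_zw_add times_zw_single diff_diff_eq)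
    qed (simp add: times_zw_def)
    with 2 show ?case by (simp add: distrib_right times_zw_add times_zw_single)
  qed (simp add: times_zw_def)
qed

text \<open>A list of pairs \<open>(a, b)\<close> stands for the product of the linear forms \<open>a z + b w\<close>.\<close>

definition linear_forms :: "(complex \<times> complex) list \<Rightarrow> laurent_zw" where
  "linear_forms L = (\<Prod>(a, b)\<leftarrow>L. cst a * zvar + cst b * wvar)"

definition forms_at_1 :: "(complex \<times> complex) list \<Rightarrow> complex fps" where
  "forms_at_1 L = (\<Prod>(a, b)\<leftarrow>L. fps_const a + fps_const b * fps_X)"

fun forms_kernel :: "(complex \<times> complex) list \<Rightarrow> (int \<Rightarrow> complex) \<Rightarrow> int \<Rightarrow> complex" where
  "forms_kernel [] K = K"
| "forms_kernel ((a, b) # L) K = (\<lambda>i. a * forms_kernel L K i + b * forms_kernel L K (i - 1))"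

text \<open>Let D(z, w) have the coefficient \<open>d N b\<close> at z^(N-b) w^b. This is the
  product of D with the sum of K(i) z^(e-i) w^i, a kernel homogeneous of degree
  \<open>e\<close>.\<close>

definition kernel_dist ::
  "(int \<Rightarrow> int \<Rightarrow> monomial \<Rightarrow> complex) \<Rightarrow> int \<Rightarrow> (int \<Rightarrow> complex) \<Rightarrow> int \<Rightarrow> int \<Rightarrow> ps_series" where
  "kernel_dist d e K m n \<nu> =
     (\<Sum>b | d (m + n - e) b \<nu> \<noteq> 0. K (n - b) * d (m + n - e) b \<nu>)"

lemma times_zw_linear:
  "times_zw (cst a * zvar + cst b * wvar) D m n \<nu> = a * D (m - 1) n \<nu> + b * D m (n - 1) \<nu>"
  by (simp add: times_zw_add zvar_def wvar_def cst_mult_single times_zw_single)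

lemma times_zw_linear_forms:
  "times_zw (linear_forms L) (kernel_dist d 0 K) = kernel_dist d (int (length L)) (forms_kernel L K)"
proof (induction L)
  case Nil
  have "times_zw 1 D m n \<nu> = D m n \<nu>" for D m n \<nu>
    using times_zw_single[of 0 1 D m n \<nu>] by simp
  then show ?case by (simp add: linear_forms_def fun_eq_iff)
next
  case (Cons p L)
  obtain a b where p: "p = (a, b)" by fastforce
  have "linear_forms (p # L) = (cst a * zvar + cst b * wvar) * linear_forms L"
    by (simp add: p linear_forms_def)
  then have "times_zw (linear_forms (p # L)) (kernel_dist d 0 K) =
      times_zw (cst a * zvar + cst b * wvar) (kernel_dist d (int (length L)) (forms_kernel L K))"
    by (simp add: times_zw_mult Cons)
  also have "\<dots> = kernel_dist d (int (length (p # L))) (forms_kernel (p # L) K)"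
  proof (intro ext)
    fix m n \<nu>
    have e: "m - 1 + n - int (length L) = m + n - int (length (p # L))"
      "m + (n - 1) - int (length L) = m + n - int (length (p # L))"
      "n - 1 - b = n - b - 1" for b by simp_all
    show "times_zw (cst a * zvar + cst b * wvar) (kernel_dist d (int (length L)) (forms_kernel L K)) m n \<nu> =
        kernel_dist d (int (length (p # L))) (forms_kernel (p # L) K) m n \<nu>"
      by (simp only: times_zw_linear kernel_dist_def e)
         (simp add: p sum_distrib_left sum.distrib distrib_right mult.assoc del: length_Cons)
  qed
  finally show ?case .
qed

lemma zero_ext_linear:
  "zero_ext ((fps_const a + fps_const b * fps_X) * f) i = a * zero_ext f i + b * zero_ext f (i - 1)"
proof -
  have "(fps_const a + fps_const b * fps_X) * f = fps_const a * f + fps_const b * (fps_X * f)"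
    by (simp add: algebra_simps)
  moreover consider "i < 0" | "i = 0" | "i > 0" by linarith
  ultimately show ?thesis
    by cases (simp_all add: zero_ext_def nat_diff_distrib)
qed

lemma forms_kernel_zero_ext: "forms_kernel L (zero_ext f) = zero_ext (forms_at_1 L * f)"
proof (induction L)
  case (Cons p L)
  then show ?case
    by (cases p) (simp add: forms_at_1_def zero_ext_linear mult.assoc)
qed (simp add: forms_at_1_def)

text \<open>In an expansion in z/w the roles of z and w are exchanged, whence the swapped forms; w^i
  occurs together with z^(length L - i), whence the reflected index.\<close>

lemma forms_kernel_zero_ext_rev:
  "forms_kernel L (\<lambda>i. zero_ext f (- i)) = (\<lambda>i. zero_ext (forms_at_1 (map prod.swap L) * f) (int (length L) - i))"
proof (induction L)
  case (Cons p L)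
  have e: "int (length L) - (i - 1) = int (length (p # L)) - i"
    "int (length L) - i = int (length (p # L)) - i - 1" for i by simp_all
  show ?case
    using Cons by (cases p)
      (simp add: forms_at_1_def zero_ext_linear mult.assoc e add.commute del: length_Cons of_nat_Suc)
qed (simp add: forms_at_1_def)

text \<open>The two orders of a product of vertex operators are expansions, in opposite regions, of
  \<open>\<phi>\<close> and \<open>\<phi>'\<close> times the same symmetric distribution. Clearing denominators turns both into
  the Laurent polynomial given by \<open>Ln\<close>.\<close>

lemma exchange_vertex_current:
  fixes \<alpha> \<alpha>' :: "nat \<Rightarrow> complex" and c c' :: "int \<Rightarrow> complex"
  defines "\<phi> \<equiv> exp_sum (\<lambda>k. \<alpha>' k * c (int k))" and "\<phi>' \<equiv> exp_sum (\<lambda>k. \<alpha> k * c' (int k))"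
  assumes len: "length Lp = length Lq" "length Ln = length Lq"
    and q: "forms_at_1 Lq * \<phi> = forms_at_1 Ln"
    and p: "forms_at_1 (map prod.swap Lp) * \<phi>' = forms_at_1 (map prod.swap Ln)"
  shows "exchange (linear_forms Lp) (linear_forms Lq) (vertex_current \<kappa> \<alpha> c) (vertex_current \<kappa>' \<alpha>' c')"
  unfolding exchange_def
proof
  fix F assume F: "F \<in> functions_X"
  define d where "d = (\<lambda>N b \<nu>. \<kappa> * \<kappa>' * lk (vertex_pair \<alpha> c \<alpha>' c' (N - b) b (weight_part (weight \<nu> - N) F)) \<nu>)"
  define J where "J = (\<lambda>N \<nu>. {b. vertex_pair \<alpha> c \<alpha>' c' (N - b) b (weight_part (weight \<nu> - N) F) \<noteq> 0})"
  have J: "finite (J N \<nu>)" "{b. d N b \<nu> \<noteq> 0} \<subseteq> J N \<nu>" for N \<nu>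
    unfolding J_def d_def by (auto simp: finite_vertex_pair)
  have kd: "kernel_dist d 0 K m n \<nu> = (\<Sum>b\<in>J (m + n) \<nu>. K (n - b) * d (m + n) b \<nu>)" for K m n \<nu>
    unfolding kernel_dist_def using J[of "m + n" \<nu>] by (intro sum.mono_neutral_cong_left) auto
  have AB: "(\<lambda>m n. vertex_current \<kappa> \<alpha> c m (vertex_current \<kappa>' \<alpha>' c' n F)) = kernel_dist d 0 (zero_ext \<phi>)"
  proof (intro ext)
    fix m n \<nu>
    let ?P = "weight_part (weight \<nu> - (m + n)) F"
    have "vertex \<alpha> c m (vertex \<alpha>' c' n ?P) =
        (\<Sum>b\<in>J (m + n) \<nu>. cst (zero_ext \<phi> (n - b)) * vertex_pair \<alpha> c \<alpha>' c' (m + n - b) b ?P)"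
      unfolding \<phi>_def by (rule vertex_vertex[OF J(1)]) (simp add: J_def)
    then have "vertex_current \<kappa> \<alpha> c m (vertex_current \<kappa>' \<alpha>' c' n F) \<nu> =
        \<kappa> * \<kappa>' * lk (\<Sum>b\<in>J (m + n) \<nu>. cst (zero_ext \<phi> (n - b)) * vertex_pair \<alpha> c \<alpha>' c' (m + n - b) b ?P) \<nu>"
      by (simp only: vertex_current_vertex_current[OF F])
    also have "\<dots> = (\<Sum>b\<in>J (m + n) \<nu>. zero_ext \<phi> (n - b) * d (m + n) b \<nu>)"
      by (simp add: d_def lookup_sum lookup_cst_mult sum_distrib_left mult_ac)
    also have "\<dots> = kernel_dist d 0 (zero_ext \<phi>) m n \<nu>" by (rule kd[symmetric])
    finally show "vertex_current \<kappa> \<alpha> c m (vertex_current \<kappa>' \<alpha>' c' n F) \<nu> = kernel_dist d 0 (zero_ext \<phi>) m n \<nu>" .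
  qed
  have BA: "(\<lambda>m n. vertex_current \<kappa>' \<alpha>' c' n (vertex_current \<kappa> \<alpha> c m F)) = kernel_dist d 0 (\<lambda>i. zero_ext \<phi>' (- i))"
  proof (intro ext)
    fix m n \<nu>
    let ?P = "weight_part (weight \<nu> - (m + n)) F"
    \<comment> \<open>The modes of the pair in the opposite order are the same ones with the
      exponents exchanged, that is, \<open>b\<close> replaced by \<open>m + n - b\<close>.\<close>
    have sub: "{b. vertex_pair \<alpha>' c' \<alpha> c (n + m - b) b ?P \<noteq> 0} \<subseteq> (\<lambda>b. m + n - b) ` J (m + n) \<nu>"
    proof
      fix b assume "b \<in> {b. vertex_pair \<alpha>' c' \<alpha> c (n + m - b) b ?P \<noteq> 0}"
      then have "m + n - b \<in> J (m + n) \<nu>"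
        by (simp add: J_def vertex_pair_commute[of \<alpha> c \<alpha>' c'] add.commute[of n m])
      then show "b \<in> (\<lambda>b. m + n - b) ` J (m + n) \<nu>" by (rule rev_image_eqI) simp
    qed
    have "vertex \<alpha>' c' n (vertex \<alpha> c m ?P) = (\<Sum>b\<in>(\<lambda>b. m + n - b) ` J (m + n) \<nu>.
        cst (zero_ext \<phi>' (m - b)) * vertex_pair \<alpha>' c' \<alpha> c (n + m - b) b ?P)"
      unfolding \<phi>'_def by (rule vertex_vertex[OF _ sub]) (simp add: J)
    also have "\<dots> = (\<Sum>b\<in>J (m + n) \<nu>. cst (zero_ext \<phi>' (b - n)) * vertex_pair \<alpha> c \<alpha>' c' (m + n - b) b ?P)"
      by (subst sum.reindex) (simp_all add: inj_on_def vertex_pair_commute[of \<alpha>' c' \<alpha> c])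
    finally have "vertex_current \<kappa>' \<alpha>' c' n (vertex_current \<kappa> \<alpha> c m F) \<nu> = \<kappa>' * \<kappa> *
        lk (\<Sum>b\<in>J (m + n) \<nu>. cst (zero_ext \<phi>' (b - n)) * vertex_pair \<alpha> c \<alpha>' c' (m + n - b) b ?P) \<nu>"
      by (simp only: vertex_current_vertex_current[OF F] add.commute[of n m])
    also have "\<dots> = (\<Sum>b\<in>J (m + n) \<nu>. zero_ext \<phi>' (- (n - b)) * d (m + n) b \<nu>)"
      by (simp add: d_def lookup_sum lookup_cst_mult sum_distrib_left mult_ac)
    also have "\<dots> = kernel_dist d 0 (\<lambda>i. zero_ext \<phi>' (- i)) m n \<nu>" by (rule kd[symmetric])
    finally show "vertex_current \<kappa>' \<alpha>' c' n (vertex_current \<kappa> \<alpha> c m F) \<nu> =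
        kernel_dist d 0 (\<lambda>i. zero_ext \<phi>' (- i)) m n \<nu>" .
  qed
  \<comment> \<open>The constant 1 has the same expansion in both regions. After clearing
    denominators both orders become a polynomial times this constant, and here they meet.\<close>
  have one: "zero_ext 1 = (\<lambda>i. zero_ext 1 (- i))"
    by (auto simp: zero_ext_def fun_eq_iff)
  have "forms_kernel Lq (zero_ext \<phi>) = forms_kernel Ln (zero_ext 1)"
    by (simp add: forms_kernel_zero_ext q)
  also have "\<dots> = forms_kernel Ln (\<lambda>i. zero_ext 1 (- i))"
    by (subst one) (rule refl)
  also have "\<dots> = forms_kernel Lp (\<lambda>i. zero_ext \<phi>' (- i))"
    by (simp add: forms_kernel_zero_ext_rev p len)
  finally have K: "forms_kernel Lq (zero_ext \<phi>) = forms_kernel Lp (\<lambda>i. zero_ext \<phi>' (- i))" .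
  show "times_zw (linear_forms Lq) (\<lambda>m n. vertex_current \<kappa> \<alpha> c m (vertex_current \<kappa>' \<alpha>' c' n F)) =
      times_zw (linear_forms Lp) (\<lambda>m n. vertex_current \<kappa>' \<alpha>' c' n (vertex_current \<kappa> \<alpha> c m F))"
    unfolding AB BA times_zw_linear_forms K len ..
qed

section \<open>The commutator relation\<close>

text \<open>If \<open>\<phi>(x)\<close> and \<open>\<phi>'(1/x)\<close> are the two expansions of a rational function with simple poles at
  \<open>x = 1\<close> and \<open>x = 1/r\<close>, their difference is a combination of delta functions.\<close>

lemma commutator_vertex_current:
  fixes \<alpha> \<alpha>' :: "nat \<Rightarrow> complex" and c c' :: "int \<Rightarrow> complex"
  assumes F: "F \<in> functions_X" and r: "r \<noteq> 0"
    and \<phi>: "\<And>i. zero_ext (exp_sum (\<lambda>k. \<alpha>' k * c (int k))) i -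
      zero_ext (exp_sum (\<lambda>k. \<alpha> k * c' (int k))) (- i) = A * (1 - r powi i)"
  shows "commutator (vertex_current \<kappa> \<alpha> c m) (vertex_current \<kappa>' \<alpha>' c' n) F \<nu> =
    \<kappa> * \<kappa>' * A *
      (vertex_current 1 (\<lambda>k. \<alpha> k + \<alpha>' k) (\<lambda>k. c k + c' k) (m + n) F \<nu> -
       r powi n * vertex_current 1 (\<lambda>k. \<alpha> k + (1 / r) ^ k * \<alpha>' k) (\<lambda>k. c k + r powi k * c' k) (m + n) F \<nu>)"
proof -
  define P where "P = weight_part (weight \<nu> - (m + n)) F"
  define \<phi>1 where "\<phi>1 = zero_ext (exp_sum (\<lambda>k. \<alpha>' k * c (int k)))"
  define \<phi>2 where "\<phi>2 = zero_ext (exp_sum (\<lambda>k. \<alpha> k * c' (int k)))"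
  define p where "p = (\<lambda>b. vertex_pair \<alpha> c \<alpha>' c' (m + n - b) b P)"
  define J where "J = {b. p b \<noteq> 0}"
  have J: "finite J" "{b. vertex_pair \<alpha> c \<alpha>' c' (m + n - b) b P \<noteq> 0} \<subseteq> J"
    unfolding J_def p_def by (rule finite_vertex_pair, rule order_refl)
  have AB: "vertex \<alpha> c m (vertex \<alpha>' c' n P) = (\<Sum>b\<in>J. cst (\<phi>1 (n - b)) * p b)"
    unfolding \<phi>1_def p_def by (rule vertex_vertex[OF J])
  have sub: "{b. vertex_pair \<alpha>' c' \<alpha> c (n + m - b) b P \<noteq> 0} \<subseteq> (\<lambda>b. m + n - b) ` J"
  proof
    fix b assume "b \<in> {b. vertex_pair \<alpha>' c' \<alpha> c (n + m - b) b P \<noteq> 0}"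
    then have "m + n - b \<in> J"
      by (simp add: J_def p_def vertex_pair_commute[of \<alpha> c \<alpha>' c'] add.commute[of n m])
    then show "b \<in> (\<lambda>b. m + n - b) ` J" by (rule rev_image_eqI) simp
  qed
  have "vertex \<alpha>' c' n (vertex \<alpha> c m P) =
      (\<Sum>b\<in>(\<lambda>b. m + n - b) ` J. cst (\<phi>2 (m - b)) * vertex_pair \<alpha>' c' \<alpha> c (n + m - b) b P)"
    unfolding \<phi>2_def by (rule vertex_vertex[OF _ sub]) (simp add: J)
  also have "\<dots> = (\<Sum>b\<in>J. cst (\<phi>2 (- (n - b))) * p b)"
    by (subst sum.reindex) (simp_all add: inj_on_def vertex_pair_commute[of \<alpha>' c' \<alpha> c] p_def)
  finally have "vertex \<alpha> c m (vertex \<alpha>' c' n P) - vertex \<alpha>' c' n (vertex \<alpha> c m P) =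
      (\<Sum>b\<in>J. cst (\<phi>1 (n - b) - \<phi>2 (- (n - b))) * p b)"
    by (simp only: AB sum_subtractf[symmetric] left_diff_distrib[symmetric] cst_diff)
  also have "\<dots> = (\<Sum>b\<in>J. cst (A * (1 - r powi (n - b))) * p b)"
    by (simp only: \<phi>1_def \<phi>2_def \<phi>)
  \<comment> \<open>The two parts are the delta functions at w = z and at w = z/r; writing
    \<open>1 powi (- b)\<close> makes both of them instances of the same specialization.\<close>
  also have "\<dots> = cst A * ((\<Sum>b\<in>J. cst (1 powi (- b)) * p b) - cst (r powi n) * (\<Sum>b\<in>J. cst (r powi (- b)) * p b))"
    using r by (simp add: sum_distrib_left sum_subtractf right_diff_distrib left_diff_distrib cst_diff
        cst_mult power_int_diff power_int_minus divide_inverse mult.assoc)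
  also have "\<dots> = cst A * (vertex (\<lambda>k. \<alpha> k + \<alpha>' k) (\<lambda>k. c k + c' k) (m + n) P -
      cst (r powi n) * vertex (\<lambda>k. \<alpha> k + (1 / r) ^ k * \<alpha>' k) (\<lambda>k. c k + r powi k * c' k) (m + n) P)"
    unfolding p_def vertex_pair_specialize[OF r J] vertex_pair_specialize[OF one_neq_zero J] by simp
  finally have *: "vertex \<alpha> c m (vertex \<alpha>' c' n P) - vertex \<alpha>' c' n (vertex \<alpha> c m P) = \<dots>" .
  have "commutator (vertex_current \<kappa> \<alpha> c m) (vertex_current \<kappa>' \<alpha>' c' n) F \<nu> =
      \<kappa> * \<kappa>' * lk (vertex \<alpha> c m (vertex \<alpha>' c' n P) - vertex \<alpha>' c' n (vertex \<alpha> c m P)) \<nu>"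
    by (simp add: commutator_def vertex_current_vertex_current[OF F] P_def add.commute[of n m]
        lookup_minus right_diff_distrib)
  also have "\<dots> = \<kappa> * \<kappa>' * A *
      (vertex_current 1 (\<lambda>k. \<alpha> k + \<alpha>' k) (\<lambda>k. c k + c' k) (m + n) F \<nu> -
       r powi n * vertex_current 1 (\<lambda>k. \<alpha> k + (1 / r) ^ k * \<alpha>' k) (\<lambda>k. c k + r powi k * c' k) (m + n) F \<nu>)"
    unfolding * by (simp add: vertex_current_def extend_def P_def lookup_cst_mult lookup_minus mult.assoc)
  finally show ?thesis .
qed

section \<open>The Serre relation\<close>

definition coeff2 :: "complex fps fps \<Rightarrow> int \<Rightarrow> int \<Rightarrow> complex" where
  "coeff2 M i j = (if i \<ge> 0 \<and> j \<ge> 0 then fps_nth (fps_nth M (nat j)) (nat i) else 0)"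

text \<open>In \<open>complex fps fps\<close> the inner variable is x and the outer one is
  y.\<close>

definition in_x :: "complex fps \<Rightarrow> complex fps fps" where
  "in_x f = fps_const f"

definition in_y :: "complex fps \<Rightarrow> complex fps fps" where
  "in_y f = Abs_fps (\<lambda>n. fps_const (fps_nth f n))"

text \<open>The substitution \<open>(x, y) \<mapsto> (x, x y)\<close>.\<close>

definition shear :: "complex fps fps \<Rightarrow> complex fps fps" where
  "shear M = Abs_fps (\<lambda>n. fps_X ^ n * fps_nth M n)"

definition flip :: "complex fps fps \<Rightarrow> complex fps fps" where
  "flip M = Abs_fps (\<lambda>n. Abs_fps (\<lambda>m. fps_nth (fps_nth M m) n))"

lemma shear_add: "shear (M + N) = shear M + shear N"
  and shear_diff: "shear (M - N) = shear M - shear N"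
  by (simp_all add: shear_def fps_eq_iff algebra_simps)

lemma shear_mult: "shear (M * N) = shear M * shear N"
proof (rule fps_ext)
  fix n
  have e: "fps_X ^ n * (fps_nth M i * fps_nth N (n - i)) =
      fps_X ^ i * fps_nth M i * (fps_X ^ (n - i) * fps_nth N (n - i))" if "i \<in> {0..n}" for i
  proof -
    have "fps_X ^ n = fps_X ^ i * (fps_X ^ (n - i) :: complex fps)"
      using that by (simp add: power_add[symmetric])
    then show ?thesis by (simp only: mult_ac)
  qed
  show "fps_nth (shear (M * N)) n = fps_nth (shear M * shear N) n"
    unfolding shear_def fps_mult_nth fps_nth_Abs_fps sum_distrib_left by (intro sum.cong refl e)
qed

lemma shear_in_x [simp]: "shear (in_x f) = in_x f"
  by (rule fps_ext) (simp add: shear_def in_x_def)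

lemma flip_add: "flip (M + N) = flip M + flip N"
  and flip_diff: "flip (M - N) = flip M - flip N"
  by (simp_all add: flip_def fps_eq_iff)

lemma flip_mult: "flip (M * N) = flip M * flip N"
proof (intro fps_ext)
  fix n m
  show "fps_nth (fps_nth (flip (M * N)) n) m = fps_nth (fps_nth (flip M * flip N) n) m"
    by (simp add: flip_def fps_mult_nth fps_sum_nth) (rule sum.swap)
qed

lemma flip_in_x [simp]: "flip (in_x f) = in_y f"
  and flip_in_y [simp]: "flip (in_y f) = in_x f"
  by (intro fps_ext; simp add: flip_def in_x_def in_y_def)+

lemma flip_shear_in_y [simp]: "flip (shear (in_y f)) = shear (in_y f)"
  by (intro fps_ext) (simp add: flip_def shear_def in_y_def fps_X_power_iff)

lemma in_x_add: "in_x (f + g) = in_x f + in_x g"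
  and in_x_diff: "in_x (f - g) = in_x f - in_x g"
  and in_x_mult: "in_x (f * g) = in_x f * in_x g"
  and in_x_1 [simp]: "in_x 1 = 1"
  by (simp_all add: in_x_def)

lemma in_y_eq_flip: "in_y f = flip (in_x f)"
  by simp

lemma flip_1 [simp]: "flip 1 = 1"
  using flip_mult[of 1 1] by (intro fps_ext) (simp add: flip_def)

lemma shear_1 [simp]: "shear 1 = 1"
  using shear_in_x[of 1] by simp

lemma in_y_add: "in_y (f + g) = in_y f + in_y g"
  and in_y_diff: "in_y (f - g) = in_y f - in_y g"
  and in_y_mult: "in_y (f * g) = in_y f * in_y g"
  and in_y_1 [simp]: "in_y 1 = 1"
  unfolding in_y_eq_flip in_x_add in_x_diff in_x_mult flip_add flip_diff flip_mult by simp_all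

lemma in_y_const [simp]: "in_y (fps_const a) = in_x (fps_const a)"
  by (rule fps_ext) (simp add: in_y_def in_x_def)

lemma in_y_X: "in_y fps_X = fps_X"
  by (rule fps_ext) (simp add: in_y_def fps_X_def)

lemma shear_in_y_X: "shear (in_y fps_X) = in_x fps_X * in_y fps_X"
proof (rule fps_ext)
  show "fps_nth (shear (in_y fps_X)) n = fps_nth (in_x fps_X * in_y fps_X) n" for n
    by (cases "n = 1") (simp_all add: shear_def in_y_X in_x_def)
qed

lemma coeff2_add: "coeff2 (M + N) i j = coeff2 M i j + coeff2 N i j"
  and coeff2_diff: "coeff2 (M - N) i j = coeff2 M i j - coeff2 N i j"
  by (simp_all add: coeff2_def)

lemma coeff2_flip: "coeff2 (flip M) i j = coeff2 M j i"
  by (simp add: coeff2_def flip_def)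

lemma coeff2_x_mult: "coeff2 (in_x fps_X * M) i j = coeff2 M (i - 1) j"
proof -
  consider "i < 0" | "i = 0" | "i > 0" by linarith
  then show ?thesis
    by cases (simp_all add: coeff2_def in_x_def nat_diff_distrib)
qed

lemma coeff2_y_mult: "coeff2 (in_y fps_X * M) i j = coeff2 M i (j - 1)"
proof -
  have "coeff2 (in_y fps_X * M) i j = coeff2 (flip (in_y fps_X * M)) j i"
    by (simp only: coeff2_flip)
  also have "\<dots> = coeff2 M i (j - 1)"
    by (simp add: flip_mult coeff2_x_mult coeff2_flip)
  finally show ?thesis .
qed

lemma coeff2_shear: "coeff2 (shear M) i j = coeff2 M (i - j) j"
  by (auto simp: coeff2_def shear_def fps_X_power_mult_nth nat_diff_distrib)

lemma triple_kernel_eq_coeff2: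
  "triple_kernel f \<beta> \<gamma> = coeff2 (in_x f * in_y f * shear (in_y f)) (\<beta> + \<gamma>) \<gamma>"
proof (cases "\<gamma> \<ge> 0")
  case True
  have c: "fps_const a * (M * fps_const b) = fps_const (a * b) * M" for a b and M :: "complex fps"
    by (simp add: fps_const_mult[symmetric] mult_ac del: fps_const_mult)
  have "fps_nth (in_y f * shear (in_y f)) (nat \<gamma>) =
      (\<Sum>i=0..nat \<gamma>. fps_const (fps_nth f i * fps_nth f (nat \<gamma> - i)) * fps_X ^ (nat \<gamma> - i))"
    by (simp add: fps_mult_nth in_y_def shear_def c)
  then have n: "fps_nth (in_x f * in_y f * shear (in_y f)) (nat \<gamma>) =
      (\<Sum>i=0..nat \<gamma>. fps_const (fps_nth f i * fps_nth f (nat \<gamma> - i)) * (fps_X ^ (nat \<gamma> - i) * f))"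
    by (simp add: in_x_def mult.assoc sum_distrib_left mult_ac)
  have "coeff2 (in_x f * in_y f * shear (in_y f)) (\<beta> + \<gamma>) \<gamma> =
      (\<Sum>i=0..nat \<gamma>. fps_nth f i * fps_nth f (nat \<gamma> - i) * zero_ext f (\<beta> + int i))"
  proof (cases "\<beta> + \<gamma> \<ge> 0")
    case b: True
    show ?thesis
      unfolding coeff2_def n using True b
      by (auto simp: fps_sum_nth fps_X_power_mult_nth zero_ext_def intro!: sum.cong)
         (auto simp: nat_diff_distrib nat_add_distrib intro!: arg_cong[where f = "fps_nth f"])
  next
    case b: False
    then have "zero_ext f (\<beta> + int i) = 0" if "i \<in> {0..nat \<gamma>}" for i
      using that True by (intro zero_ext_neg) auto
    then show ?thesis using b by (simp add: coeff2_def)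
  qed
  also have "\<dots> = triple_kernel f \<beta> \<gamma>"
    unfolding triple_kernel_def
    by (rule sum.reindex_bij_witness[where i = nat and j = int])
       (use True in \<open>auto simp: zero_ext_def nat_diff_distrib\<close>)
  finally show ?thesis by simp
qed (simp add: triple_kernel_def coeff2_def)

section \<open>The splitting of the Serre kernel\<close>

definition serre_poly :: "'a::comm_ring_1 \<Rightarrow> 'a \<Rightarrow> 'a \<Rightarrow> 'a \<Rightarrow> 'a" where
  "serre_poly S P X Y = (X + Y) - (1 + P) * (X^2 + Y^2) + P * (X^3 + Y^3) + (P + 1) * (P - 1 - S) * (X * Y) +
     (P + S * (1 + P)) * (X^2 * Y + X * Y^2) - P * (P + 1) * (X^3 * Y + X * Y^3) -
     (P + 1) * (P + S - 1) * (X^2 * Y^2) + P^2 * (X^3 * Y^2 + X^2 * Y^3)"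

text \<open>The coefficients of \<open>serre_poly\<close> solve this identity, which is the desired
  splitting with denominators cleared. For \<ee> one has 1 - S x + P x^2 = (1 - q x)(1 - x/t). Only
  the sum S and the product P of the inverse poles enter, so one identity serves both \<ee> and
  \<ff>.\<close>

lemma serre_poly_identity:
  fixes x y :: "'a::comm_ring_1"
  shows "(1 - y) * (1 - S * y + P * y^2) * serre_poly S P x (x * y) -
      (1 - x) * (1 - S * x + P * x^2) * serre_poly S P y (x * y) =
    (x - y) * (1 + x * y) * (1 - x * y) * (1 - P * (x * y)) * ((1 - x) * (1 - P * x)) * ((1 - y) * (1 - P * y))"
  by (simp add: serre_poly_def algebra_simps power2_eq_square power3_eq_cube)

text \<open>Up to the factor \<open>1/(x y)\<close>, the left-hand side is
  \<open>(1/y - y - 1/x + x) \<phi>(x) \<phi>(y) \<phi>(x y)\<close>; on the right, neither summand has poles in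
  both \<open>x\<close> and \<open>y\<close>.\<close>

lemma serre_decomposition:
  fixes f k :: "complex fps"
  assumes k: "(1 - fps_const S * fps_X + fps_const P * fps_X^2) * k = 1"
    and f: "f = (1 - fps_X) * (1 - fps_const P * fps_X) * k"
  defines "x \<equiv> in_x fps_X" and "y \<equiv> in_y fps_X"
    and "S' \<equiv> in_x (fps_const S)" and "P' \<equiv> in_x (fps_const P)"
  shows "(x - y) * (1 + x * y) * (in_x f * in_y f * shear (in_y f)) =
    (1 - y) * serre_poly S' P' x (x * y) * (in_x k * shear (in_y k)) -
    (1 - x) * serre_poly S' P' y (x * y) * (in_y k * shear (in_y k))"
proof -
  define kx ky ks where "kx = in_x k" and "ky = in_y k" and "ks = shear (in_y k)"
  have kx: "(1 - S' * x + P' * x^2) * kx = 1"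
    using arg_cong[OF k, of in_x]
    by (simp add: in_x_mult in_x_add in_x_diff kx_def S'_def P'_def x_def power2_eq_square)
  have ky: "(1 - S' * y + P' * y^2) * ky = 1"
    using arg_cong[OF k, of in_y]
    by (simp add: in_y_mult in_y_add in_y_diff ky_def S'_def P'_def y_def power2_eq_square)
  have fx: "in_x f = (1 - x) * (1 - P' * x) * kx"
    by (simp add: f in_x_mult in_x_diff x_def P'_def kx_def)
  have fy: "in_y f = (1 - y) * (1 - P' * y) * ky"
    by (simp add: f in_y_mult in_y_diff y_def P'_def ky_def)
  have fs: "shear (in_y f) = (1 - x * y) * (1 - P' * (x * y)) * ks"
    unfolding fy by (simp add: shear_mult shear_diff shear_in_y_X x_def y_def P'_def ky_def ks_def)
  have gen: "a * m * (kx * ks) * (d' * ky) - b * m' * (ky * ks) * (d * kx) =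
      kx * ky * ks * (a * d' * m - b * d * m')" for a b d d' m m'
    by (simp add: algebra_simps)
  \<comment> \<open>Each summand lacks the denominator in one of x and y; it is restored by a factor
    1 = (1 - S y + P y^2) k(y), respectively the same in x.\<close>
  have "(1 - y) * serre_poly S' P' x (x * y) * (kx * ks) - (1 - x) * serre_poly S' P' y (x * y) * (ky * ks) =
    (1 - y) * serre_poly S' P' x (x * y) * (kx * ks) * ((1 - S' * y + P' * y^2) * ky) -
    (1 - x) * serre_poly S' P' y (x * y) * (ky * ks) * ((1 - S' * x + P' * x^2) * kx)"
    by (simp only: kx ky mult_1_right)
  also have "\<dots> = kx * ky * ks * ((1 - y) * (1 - S' * y + P' * y^2) * serre_poly S' P' x (x * y) -
      (1 - x) * (1 - S' * x + P' * x^2) * serre_poly S' P' y (x * y))"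
    by (rule gen)
  also have "\<dots> = (x - y) * (1 + x * y) * (in_x f * in_y f * shear (in_y f))"
    unfolding serre_poly_identity fs unfolding fx fy by (simp only: mult_ac)
  finally show ?thesis by (simp add: kx_def ky_def ks_def)
qed

text \<open>With k = 1/(1 - S x + P x^2), the numbers \<open>u i j\<close> are the coefficients of
  N/(x y) for the antisymmetric N = (x - y) \<open>serre_poly\<close>(x, y) k(x) k(y). Evaluated at
  (z_2/z_1, z_3/z_1) it is antisymmetric in z_2, z_3, and at (z_3/z_2, z_3/z_1) it is antisymmetric
  in z_1, z_2. The four kernels on the left are the coefficient form of the factor 1/y - y - 1/x +
  x.\<close>

lemma serre_kernel:
  fixes f :: "complex fps"
  assumes f: "(1 - fps_const S * fps_X + fps_const P * fps_X^2) * f = (1 - fps_X) * (1 - fps_const P * fps_X)"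
  obtains u :: "int \<Rightarrow> int \<Rightarrow> complex" where
    "\<And>i j. u j i = - u i j"
    "\<And>\<beta> \<gamma>. triple_kernel f (\<beta> - 1) (\<gamma> + 1) - triple_kernel f (\<beta> + 1) (\<gamma> - 1) -
       triple_kernel f (\<beta> + 1) \<gamma> + triple_kernel f (\<beta> - 1) \<gamma> = u \<beta> \<gamma> - u (- \<beta>) (\<beta> + \<gamma>)"
proof -
  define D where "D = 1 - fps_const S * fps_X + fps_const P * fps_X^2"
  define k where "k = inverse D"
  have "fps_nth D 0 \<noteq> 0" by (simp add: D_def)
  then have k: "D * k = 1" unfolding k_def by (rule inverse_mult_eq_1')
  have f': "f = (1 - fps_X) * (1 - fps_const P * fps_X) * k"
    using f k by (metis D_def mult.assoc mult.commute mult_1_left)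
  define x y where "x = in_x fps_X" and "y = in_y fps_X"
  define S' P' where "S' = in_x (fps_const S)" and "P' = in_x (fps_const P)"
  have S'P': "shear S' = S'" "shear P' = P'" "flip S' = S'" "flip P' = P'"
    by (simp_all add: S'_def P'_def)
  have xy: "shear x = x" "shear y = x * y" "flip x = y" "flip y = x"
    by (simp_all add: x_def y_def shear_in_y_X)
  define N where "N = (x - y) * serre_poly S' P' x y * (in_x k * in_y k)"
  have sym: "serre_poly S' P' X Y = serre_poly S' P' Y X" for X Y
    unfolding serre_poly_def by (simp only: mult_ac add_ac)
  have flipm: "flip (serre_poly S' P' X Y) = serre_poly S' P' (flip X) (flip Y)" for X Y
    by (simp add: serre_poly_def flip_add flip_diff flip_mult S'P' power2_eq_square power3_eq_cube)
  have shearm: "shear (serre_poly S' P' X Y) = serre_poly S' P' (shear X) (shear Y)" for X Y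
    by (simp add: serre_poly_def shear_add shear_diff shear_mult S'P' power2_eq_square power3_eq_cube)
  have flipN: "flip N = - N"
    unfolding N_def flip_mult flipm flip_diff xy flip_in_x flip_in_y
    by (simp only: sym[of y x]) (simp add: algebra_simps)
  have sN: "shear N = x * ((1 - y) * serre_poly S' P' x (x * y) * (in_x k * shear (in_y k)))"
    unfolding N_def shear_mult shearm shear_diff xy shear_in_x
    by (simp add: algebra_simps)
  have fsN: "flip (shear N) = y * ((1 - x) * serre_poly S' P' y (x * y) * (in_y k * shear (in_y k)))"
    unfolding sN flip_mult flipm flip_diff xy flip_in_x flip_shear_in_y by (simp add: mult_ac)
  define \<Phi> where "\<Phi> = in_x f * in_y f * shear (in_y f)"
  \<comment> \<open>The shift by 1 is the division by the product of the two variables.\<close>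
  define u where "u = (\<lambda>i j. coeff2 N (i + 1) (j + 1))"
  have "u j i = - u i j" for i j
  proof -
    have "u j i = coeff2 (flip N) (i + 1) (j + 1)" by (simp add: u_def coeff2_flip)
    also have "\<dots> = - u i j" unfolding flipN by (simp add: u_def coeff2_def)
    finally show ?thesis .
  qed
  moreover have "triple_kernel f (\<beta> - 1) (\<gamma> + 1) - triple_kernel f (\<beta> + 1) (\<gamma> - 1) -
       triple_kernel f (\<beta> + 1) \<gamma> + triple_kernel f (\<beta> - 1) \<gamma> = u \<beta> \<gamma> - u (- \<beta>) (\<beta> + \<gamma>)" for \<beta> \<gamma>
  proof -
    \<comment> \<open>The exponents after multiplication by x y, which turns 1/y - y - 1/x + x into
      (x - y)(1 + x y).\<close>
    let ?A = "\<beta> + \<gamma> + 1" and ?C = "\<gamma> + 1"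
    have "(x - y) * (1 + x * y) * \<Phi> = x * \<Phi> - y * \<Phi> + x * (x * (y * \<Phi>)) - y * (y * (x * \<Phi>))"
      by (simp add: algebra_simps)
    then have "coeff2 ((x - y) * (1 + x * y) * \<Phi>) ?A ?C =
      coeff2 \<Phi> (\<beta> + \<gamma>) (\<gamma> + 1) - coeff2 \<Phi> (\<beta> + \<gamma> + 1) \<gamma> + coeff2 \<Phi> (\<beta> + \<gamma> - 1) \<gamma> -
      coeff2 \<Phi> (\<beta> + \<gamma>) (\<gamma> - 1)"
      by (simp add: coeff2_add coeff2_diff x_def y_def coeff2_x_mult coeff2_y_mult)
    also have "\<dots> = triple_kernel f (\<beta> - 1) (\<gamma> + 1) - triple_kernel f (\<beta> + 1) (\<gamma> - 1) -
       triple_kernel f (\<beta> + 1) \<gamma> + triple_kernel f (\<beta> - 1) \<gamma>"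
      by (simp add: triple_kernel_eq_coeff2 \<Phi>_def algebra_simps)
    finally have 1: "triple_kernel f (\<beta> - 1) (\<gamma> + 1) - triple_kernel f (\<beta> + 1) (\<gamma> - 1) -
       triple_kernel f (\<beta> + 1) \<gamma> + triple_kernel f (\<beta> - 1) \<gamma> = coeff2 ((x - y) * (1 + x * y) * \<Phi>) ?A ?C" ..
    have "(x - y) * (1 + x * y) * \<Phi> =
      (1 - y) * serre_poly S' P' x (x * y) * (in_x k * shear (in_y k)) -
      (1 - x) * serre_poly S' P' y (x * y) * (in_y k * shear (in_y k))"
      unfolding \<Phi>_def x_def y_def S'_def P'_def
      by (rule serre_decomposition[OF k[unfolded D_def] f'])
    then have "coeff2 ((x - y) * (1 + x * y) * \<Phi>) ?A ?C = coeff2 (shear N) (?A + 1) ?C - coeff2 (flip (shear N)) ?A (?C + 1)"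
      unfolding fsN unfolding sN by (simp add: add_ac coeff2_diff x_def y_def coeff2_x_mult coeff2_y_mult)
    also have "\<dots> = u \<beta> \<gamma> - u (- \<beta>) (\<beta> + \<gamma>)"
      by (simp add: coeff2_flip coeff2_shear u_def algebra_simps)
    finally show ?thesis using 1 by simp
  qed
  ultimately show thesis by (rule that)
qed

section \<open>Symmetrization over the three variables\<close>

lemma sum_permutes_3:
  "(\<Sum>\<sigma> | \<sigma> permutes {1, 2, 3 :: nat}. f (\<sigma> 1) (\<sigma> 2) (\<sigma> 3)) =
    f 1 2 3 + f 1 3 2 + f 2 1 3 + f 2 3 1 + f 3 1 2 + (f 3 2 1 :: complex)"
proof -
  have f1: "finite {2::nat, 3}" "1 \<notin> {2::nat, 3}" by auto
  have f2: "finite {3::nat}" "2 \<notin> {3::nat}" by auto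
  show ?thesis
    unfolding sum_over_permutations_insert[OF f1] sum_over_permutations_insert[OF f2]
    by (simp add: permutes_sing transpose_def fun_upd_def)
qed

lemma weight_part_diff:
  assumes "G \<in> functions_X" "H \<in> functions_X"
  shows "(\<lambda>\<nu>. G \<nu> - H \<nu>) \<in> functions_X"
    and "weight_part d (\<lambda>\<nu>. G \<nu> - H \<nu>) = weight_part d G - weight_part d H"
proof -
  have fin: "finite ({\<mu>. G \<mu> \<noteq> 0 \<and> weight \<mu> = d} \<union> {\<mu>. H \<mu> \<noteq> 0 \<and> weight \<mu> = d})" for d
    using assms by (simp add: functions_X_def)
  have "finite {\<mu>. G \<mu> - H \<mu> \<noteq> 0 \<and> weight \<mu> = d}" for d
    using fin[of d] by (rule rev_finite_subset) auto
  moreover have "0 \<notin> Poly_Mapping.keys \<mu>" if "G \<mu> - H \<mu> \<noteq> 0" for \<mu>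
  proof -
    have "G \<mu> \<noteq> 0 \<or> H \<mu> \<noteq> 0" using that by auto
    then show ?thesis using assms unfolding functions_X_def by blast
  qed
  ultimately show F: "(\<lambda>\<nu>. G \<nu> - H \<nu>) \<in> functions_X"
    unfolding functions_X_def by blast
  show "weight_part d (\<lambda>\<nu>. G \<nu> - H \<nu>) = weight_part d G - weight_part d H"
    by (rule poly_mapping_eqI) (simp add: lookup_minus lookup_weight_part[OF F] lookup_weight_part[OF assms(1)] lookup_weight_part[OF assms(2)])
qed

lemma vertex_diff: "vertex \<alpha> c n (P - R) = vertex \<alpha> c n P - vertex \<alpha> c n R"
  using vertex_add[of \<alpha> c n "P - R" R] by simp

lemma vertex_current_diff:
  assumes "G \<in> functions_X" "H \<in> functions_X"
  shows "vertex_current \<kappa> \<alpha> c n (\<lambda>\<nu>. G \<nu> - H \<nu>) \<nu> = vertex_current \<kappa> \<alpha> c n G \<nu> - vertex_current \<kappa> \<alpha> c n H \<nu>"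
  by (simp add: vertex_current_def extend_def weight_part_diff[OF assms] vertex_diff right_diff_distrib lookup_minus)

lemma serre_relation_vertex_current:
  fixes \<alpha> :: "nat \<Rightarrow> complex" and c :: "int \<Rightarrow> complex"
  defines "f \<equiv> exp_sum (\<lambda>k. \<alpha> k * c (int k))"
  assumes f: "(1 - fps_const S * fps_X + fps_const Q * fps_X^2) * f = (1 - fps_X) * (1 - fps_const Q * fps_X)"
  shows "serre_relation (vertex_current \<kappa> \<alpha> c)"
  unfolding serre_relation_def
proof (intro ballI allI)
  fix F :: ps_series and n :: "nat \<Rightarrow> int" and \<nu>
  assume F: "F \<in> functions_X"
  define N where "N = n 1 + n 2 + n 3"
  define P where "P = weight_part (weight \<nu> - N) F"
  \<comment> \<open>For i + j + k = N all triple products see the same weight part \<open>P\<close>;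
    this is why the condition accompanies every formula below.\<close>
  define E where "E = (\<lambda>i j k. \<kappa>^3 * lk (vertex \<alpha> c i (vertex \<alpha> c j (vertex \<alpha> c k P))) \<nu>)"
  let ?A = "vertex_current \<kappa> \<alpha> c"
  note FX = vertex_current_functions_X F
  have E: "?A i (?A j (?A k F)) \<nu> = E i j k" if "i + j + k = N" for i j k
  proof -
    have hom: "homogeneous_op l (\<lambda>P. cst \<kappa> * vertex \<alpha> c l P)" for l by (rule homogeneous_op_vertex)
    have "?A i (?A j (?A k F)) \<nu> =
        \<kappa> * \<kappa> * lk (vertex \<alpha> c i (vertex \<alpha> c j (weight_part (weight \<nu> - (i + j)) (?A k F)))) \<nu>"
      by (rule vertex_current_vertex_current) (intro FX)
    also have "weight_part (weight \<nu> - (i + j)) (?A k F) = cst \<kappa> * vertex \<alpha> c k P"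
      unfolding vertex_current_def weight_part_extend[OF hom F] P_def
      using that by (simp add: algebra_simps)
    finally show ?thesis
      by (simp add: vertex_cst_mult lookup_cst_mult E_def power3_eq_cube)
  qed
  have serre: "serre_term ?A i j k F \<nu> =
      E i (j - 1) (k + 1) - E i (k + 1) (j - 1) - E (j - 1) (k + 1) i + E (k + 1) (j - 1) i"
    if "i + j + k = N" for i j k
  proof -
    have "commutator (?A (j - 1)) (?A (k + 1)) G =
        (\<lambda>\<nu>. ?A (j - 1) (?A (k + 1) G) \<nu> - ?A (k + 1) (?A (j - 1) G) \<nu>)" for G
      by (simp add: commutator_def)
    then have "serre_term ?A i j k F \<nu> =
        (?A i (?A (j - 1) (?A (k + 1) F)) \<nu> - ?A i (?A (k + 1) (?A (j - 1) F)) \<nu>) -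
        (?A (j - 1) (?A (k + 1) (?A i F)) \<nu> - ?A (k + 1) (?A (j - 1) (?A i F)) \<nu>)"
      unfolding serre_term_def commutator_def[of "?A i"]
      by (simp add: vertex_current_diff FX)
    then show ?thesis using that by (simp add: E algebra_simps)
  qed
  obtain l where l: "\<And>x y z. vertex_triple \<alpha> c x y z P \<noteq> 0 \<Longrightarrow> l \<le> x \<and> l \<le> y \<and> l \<le> z"
    using vertex_triple_bounded[of \<alpha> c P] by blast
  define J where "J = {(x, y, z). x + y + z = N \<and> l \<le> x \<and> l \<le> y \<and> l \<le> z}"
  define T where "T = (\<lambda>(x, y, z). \<kappa>^3 * lk (vertex_triple \<alpha> c x y z P) \<nu>)"
  define J' where "J' = (\<lambda>(x, y, z). (y, z)) ` J"
  have J': "finite J'"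
  proof (rule finite_subset)
    show "J' \<subseteq> {l..N - 2 * l} \<times> {l..N - 2 * l}" by (auto simp: J'_def J_def)
  qed simp
  have E_eq: "E i j k = (\<Sum>p\<in>J. triple_kernel f (j - fst (snd p)) (k - snd (snd p)) * T p)"
    if "i + j + k = N" for i j k
  proof -
    have inJ: "(y, z) \<in> J'" if "vertex_triple \<alpha> c (i + j + k - y - z) y z P \<noteq> 0" for y z
    proof -
      have "(N - y - z, y, z) \<in> J" using l[OF that] \<open>i + j + k = N\<close> by (simp add: J_def)
      then show ?thesis unfolding J'_def by (rule rev_image_eqI) simp
    qed
    have "vertex \<alpha> c i (vertex \<alpha> c j (vertex \<alpha> c k P)) =
        (\<Sum>(y, z)\<in>J'. cst (triple_kernel f (j - y) (k - z)) * vertex_triple \<alpha> c (N - y - z) y z P)"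
      using vertex_vertex_vertex[of J' \<alpha> c i j k P, OF J' inJ] by (simp add: f_def that)
    then have "E i j k = (\<Sum>(y, z)\<in>J'. triple_kernel f (j - y) (k - z) * T (N - y - z, y, z))"
      by (simp add: E_def T_def lookup_sum sum_distrib_left lookup_cst_mult case_prod_unfold mult_ac)
    also have "\<dots> = (\<Sum>p\<in>J. triple_kernel f (j - fst (snd p)) (k - snd (snd p)) * T p)"
      by (rule sum.reindex_bij_witness[where j = "\<lambda>(y, z). (N - y - z, y, z)" and i = "\<lambda>(x, y, z). (y, z)"])
         (auto simp: J'_def J_def)
    finally show ?thesis .
  qed
  obtain u where u: "\<And>i j. u j i = - u i j"
    "\<And>\<beta> \<gamma>. triple_kernel f (\<beta> - 1) (\<gamma> + 1) - triple_kernel f (\<beta> + 1) (\<gamma> - 1) -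
       triple_kernel f (\<beta> + 1) \<gamma> + triple_kernel f (\<beta> - 1) \<gamma> = u \<beta> \<gamma> - u (- \<beta>) (\<beta> + \<gamma>)"
    using serre_kernel[OF f] by blast
  \<comment> \<open>The four terms of the nested commutator after renaming the variables so that
    each product has its modes in the order i, j, k. The symmetrization is unchanged by
    this.\<close>
  define W where "W = (\<lambda>i j k. E i (j - 1) (k + 1) - E i (j + 1) (k - 1) - E (i - 1) (j + 1) k + E (i + 1) (j - 1) k)"
  have W: "W i j k = (\<Sum>(x, y, z)\<in>J. (u (j - y) (k - z) - u (y - j) (x - i)) * T (x, y, z))"
    if "i + j + k = N" for i j k
  proof -
    have "W i j k = (\<Sum>p\<in>J. (triple_kernel f (j - 1 - fst (snd p)) (k + 1 - snd (snd p)) -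
        triple_kernel f (j + 1 - fst (snd p)) (k - 1 - snd (snd p)) -
        triple_kernel f (j + 1 - fst (snd p)) (k - snd (snd p)) +
        triple_kernel f (j - 1 - fst (snd p)) (k - snd (snd p))) * T p)"
      using that by (simp add: W_def E_eq sum_subtractf sum.distrib left_diff_distrib distrib_right)
    also have "\<dots> = (\<Sum>(x, y, z)\<in>J. (u (j - y) (k - z) - u (y - j) (x - i)) * T (x, y, z))"
    proof (rule sum.cong)
      fix p assume "p \<in> J"
      then obtain x y z where p: "p = (x, y, z)" "x + y + z = N" by (auto simp: J_def)
      have e: "j - y + (k - z) = x - i" using p(2) that by simp
      have "triple_kernel f (j - 1 - y) (k + 1 - z) - triple_kernel f (j + 1 - y) (k - 1 - z) -
        triple_kernel f (j + 1 - y) (k - z) + triple_kernel f (j - 1 - y) (k - z) =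
        u (j - y) (k - z) - u (y - j) (x - i)"
        using u(2)[of "j - y" "k - z", unfolded e] by (simp add: algebra_simps)
      then show "(triple_kernel f (j - 1 - fst (snd p)) (k + 1 - snd (snd p)) -
        triple_kernel f (j + 1 - fst (snd p)) (k - 1 - snd (snd p)) -
        triple_kernel f (j + 1 - fst (snd p)) (k - snd (snd p)) +
        triple_kernel f (j - 1 - fst (snd p)) (k - snd (snd p))) * T p =
        (case p of (x, y, z) \<Rightarrow> (u (j - y) (k - z) - u (y - j) (x - i)) * T (x, y, z))"
        by (simp add: p(1))
    qed simp
    finally show ?thesis .
  qed
  have T12: "T (x, y, z) = T (y, x, z)" for x y z
    unfolding T_def case_prod_conv by (subst vertex_triple_swap12) (rule refl)
  have T23: "T (x, y, z) = T (x, z, y)" for x y z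
    unfolding T_def case_prod_conv by (subst vertex_triple_swap23) (rule refl)
  \<comment> \<open>\<open>J\<close> and \<open>T\<close> are symmetric, so the exponents in a
    coefficient may be permuted; this gives all six permuted sums the common factor
    \<open>T (x, y, z)\<close>.\<close>
  have s12: "(\<Sum>(x, y, z)\<in>J. H x y z * T (x, y, z)) = (\<Sum>(x, y, z)\<in>J. H y x z * T (x, y, z))" for H
    by (rule sum.reindex_bij_witness[where i = "\<lambda>(x, y, z). (y, x, z)" and j = "\<lambda>(x, y, z). (y, x, z)"])
       (auto simp: J_def intro: T12)
  have s23: "(\<Sum>(x, y, z)\<in>J. H x y z * T (x, y, z)) = (\<Sum>(x, y, z)\<in>J. H x z y * T (x, y, z))" for H
    by (rule sum.reindex_bij_witness[where i = "\<lambda>(x, y, z). (x, z, y)" and j = "\<lambda>(x, y, z). (x, z, y)"])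
       (auto simp: J_def intro: T23)
  let ?w = "\<lambda>i j k x y z. u (j - y) (k - z) - u (y - j) (x - i)"
  have p: "n 1 + n 2 + n 3 = N" "n 1 + n 3 + n 2 = N" "n 2 + n 1 + n 3 = N"
    "n 2 + n 3 + n 1 = N" "n 3 + n 1 + n 2 = N" "n 3 + n 2 + n 1 = N" by (simp_all add: N_def)
  have W6: "W (n 1) (n 2) (n 3) = (\<Sum>(x, y, z)\<in>J. ?w (n 1) (n 2) (n 3) x y z * T (x, y, z))"
    "W (n 1) (n 3) (n 2) = (\<Sum>(x, y, z)\<in>J. ?w (n 1) (n 3) (n 2) x z y * T (x, y, z))"
    "W (n 2) (n 1) (n 3) = (\<Sum>(x, y, z)\<in>J. ?w (n 2) (n 1) (n 3) y x z * T (x, y, z))"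
    "W (n 2) (n 3) (n 1) = (\<Sum>(x, y, z)\<in>J. ?w (n 2) (n 3) (n 1) y z x * T (x, y, z))"
    "W (n 3) (n 1) (n 2) = (\<Sum>(x, y, z)\<in>J. ?w (n 3) (n 1) (n 2) z x y * T (x, y, z))"
    "W (n 3) (n 2) (n 1) = (\<Sum>(x, y, z)\<in>J. ?w (n 3) (n 2) (n 1) z y x * T (x, y, z))"
  proof -
    show "W (n 1) (n 2) (n 3) = (\<Sum>(x, y, z)\<in>J. ?w (n 1) (n 2) (n 3) x y z * T (x, y, z))"
      by (rule W[OF p(1)])
    show "W (n 1) (n 3) (n 2) = (\<Sum>(x, y, z)\<in>J. ?w (n 1) (n 3) (n 2) x z y * T (x, y, z))"
      unfolding W[OF p(2)] by (rule s23)
    show "W (n 2) (n 1) (n 3) = (\<Sum>(x, y, z)\<in>J. ?w (n 2) (n 1) (n 3) y x z * T (x, y, z))"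
      unfolding W[OF p(3)] by (rule s12)
    show "W (n 2) (n 3) (n 1) = (\<Sum>(x, y, z)\<in>J. ?w (n 2) (n 3) (n 1) y z x * T (x, y, z))"
      unfolding W[OF p(4)] by (rule trans[OF s23 s12])
    show "W (n 3) (n 1) (n 2) = (\<Sum>(x, y, z)\<in>J. ?w (n 3) (n 1) (n 2) z x y * T (x, y, z))"
      unfolding W[OF p(5)] by (rule trans[OF s12 s23])
    show "W (n 3) (n 2) (n 1) = (\<Sum>(x, y, z)\<in>J. ?w (n 3) (n 2) (n 1) z y x * T (x, y, z))"
      unfolding W[OF p(6)] by (rule trans[OF s12 trans[OF s23 s12]])
  qed
  have "(\<Sum>\<sigma> | \<sigma> permutes {1, 2, 3}. serre_term ?A (n (\<sigma> 1)) (n (\<sigma> 2)) (n (\<sigma> 3)) F \<nu>) =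
      W (n 1) (n 2) (n 3) + W (n 1) (n 3) (n 2) + W (n 2) (n 1) (n 3) + W (n 2) (n 3) (n 1) +
      W (n 3) (n 1) (n 2) + W (n 3) (n 2) (n 1)"
    unfolding sum_permutes_3[of "\<lambda>i j k. serre_term ?A (n i) (n j) (n k) F \<nu>"]
      serre[OF p(1)] serre[OF p(2)] serre[OF p(3)] serre[OF p(4)] serre[OF p(5)] serre[OF p(6)] W_def
    by simp
  also have "\<dots> = (\<Sum>(x, y, z)\<in>J. (?w (n 1) (n 2) (n 3) x y z + ?w (n 1) (n 3) (n 2) x z y +
      ?w (n 2) (n 1) (n 3) y x z + ?w (n 2) (n 3) (n 1) y z x + ?w (n 3) (n 1) (n 2) z x y +
      ?w (n 3) (n 2) (n 1) z y x) * T (x, y, z))"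
    unfolding W6 by (simp only: sum.distrib[symmetric] case_prod_unfold distrib_right)
  also have "\<dots> = 0"
  proof (rule sum.neutral, safe)
    \<comment> \<open>By antisymmetry of \<open>u\<close>, the first terms cancel in pairs under the
      exchange of positions 2 and 3, and the second terms under the exchange of positions 1 and
      2.\<close>
    fix x y z
    show "(?w (n 1) (n 2) (n 3) x y z + ?w (n 1) (n 3) (n 2) x z y +
      ?w (n 2) (n 1) (n 3) y x z + ?w (n 2) (n 3) (n 1) y z x + ?w (n 3) (n 1) (n 2) z x y +
      ?w (n 3) (n 2) (n 1) z y x) * T (x, y, z) = 0"
      using u(1)[of "n 3 - z" "n 2 - y"] u(1)[of "n 3 - z" "n 1 - x"] u(1)[of "n 2 - y" "n 1 - x"]
        u(1)[of "z - n 3" "y - n 2"] u(1)[of "z - n 3" "x - n 1"] u(1)[of "y - n 2" "x - n 1"]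
      by simp
  qed
  finally show "(\<Sum>\<sigma> | \<sigma> permutes {1, 2, 3}. serre_term ?A (n (\<sigma> 1)) (n (\<sigma> 2)) (n (\<sigma> 3)) F \<nu>) = 0" .
qed

section \<open>Rational dependence on the parameters\<close>

lemma eval2_simps [simp]:
  "eval2 (P + Q) h u = eval2 P h u + eval2 Q h u"
  "eval2 (P - Q) h u = eval2 P h u - eval2 Q h u"
  "eval2 (P * Q) h u = eval2 P h u * eval2 Q h u"
  "eval2 [:[:a:]:] h u = a" "eval2 [:[:0, 1:]:] h u = h" "eval2 [:0, 1:] h u = u"
  by (simp_all add: eval2_def)

lemma rational_const: "rational_in_parameters (\<lambda>h u. a)"
  unfolding rational_in_parameters_def
  by (rule exI[of _ "[:[:a:]:]"], rule exI[of _ "[:[:1:]:]"]) simp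

lemma rational_h: "rational_in_parameters (\<lambda>h u. h)"
  unfolding rational_in_parameters_def
  by (rule exI[of _ "[:[:0, 1:]:]"], rule exI[of _ "[:[:1:]:]"]) simp

lemma rational_u: "rational_in_parameters (\<lambda>h u. u)"
  unfolding rational_in_parameters_def
  by (rule exI[of _ "[:0, 1:]"], rule exI[of _ "[:[:1:]:]"]) simp

lemma rational_add:
  assumes "rational_in_parameters R" "rational_in_parameters R'"
  shows "rational_in_parameters (\<lambda>h u. R h u + R' h u)"
proof -
  obtain P Q P' Q' where
    "\<forall>h u. generic h u \<longrightarrow> eval2 Q h u \<noteq> 0 \<and> R h u = eval2 P h u / eval2 Q h u"
    "\<forall>h u. generic h u \<longrightarrow> eval2 Q' h u \<noteq> 0 \<and> R' h u = eval2 P' h u / eval2 Q' h u"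
    using assms unfolding rational_in_parameters_def by blast
  then show ?thesis
    unfolding rational_in_parameters_def
    by (intro exI[of _ "P * Q' + P' * Q"] exI[of _ "Q * Q'"]) (simp add: add_frac_eq)
qed

lemma rational_mult:
  assumes "rational_in_parameters R" "rational_in_parameters R'"
  shows "rational_in_parameters (\<lambda>h u. R h u * R' h u)"
proof -
  obtain P Q P' Q' where
    "\<forall>h u. generic h u \<longrightarrow> eval2 Q h u \<noteq> 0 \<and> R h u = eval2 P h u / eval2 Q h u"
    "\<forall>h u. generic h u \<longrightarrow> eval2 Q' h u \<noteq> 0 \<and> R' h u = eval2 P' h u / eval2 Q' h u"
    using assms unfolding rational_in_parameters_def by blast
  then show ?thesis
    unfolding rational_in_parameters_def
    by (intro exI[of _ "P * P'"] exI[of _ "Q * Q'"]) simp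
qed

lemma rational_inverse:
  assumes "rational_in_parameters R" "\<And>h u. generic h u \<Longrightarrow> R h u \<noteq> 0"
  shows "rational_in_parameters (\<lambda>h u. 1 / R h u)"
proof -
  obtain P Q where PQ: "\<forall>h u. generic h u \<longrightarrow> eval2 Q h u \<noteq> 0 \<and> R h u = eval2 P h u / eval2 Q h u"
    using assms(1) unfolding rational_in_parameters_def by blast
  have "eval2 P h u \<noteq> 0" if "generic h u" for h u
    using PQ assms(2)[OF that] that by auto
  then show ?thesis
    unfolding rational_in_parameters_def using PQ
    by (intro exI[of _ Q] exI[of _ P]) simp
qed

lemma rational_diff:
  "rational_in_parameters R \<Longrightarrow> rational_in_parameters R' \<Longrightarrow> rational_in_parameters (\<lambda>h u. R h u - R' h u)"
  using rational_add[OF _ rational_mult[OF rational_const[of "- 1"]], of R R'] by simp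

lemma rational_power: "rational_in_parameters R \<Longrightarrow> rational_in_parameters (\<lambda>h u. R h u ^ n)"
  by (induction n) (simp_all add: rational_const rational_mult)

lemma rational_power_int:
  assumes "rational_in_parameters R" "\<And>h u. generic h u \<Longrightarrow> R h u \<noteq> 0"
  shows "rational_in_parameters (\<lambda>h u. R h u powi k)"
proof (cases "k \<ge> 0")
  case True
  then show ?thesis using rational_power[OF assms(1)] by (simp add: power_int_def)
next
  case False
  then have "(\<lambda>h u. R h u powi k) = (\<lambda>h u. (1 / R h u) ^ nat (- k))"
    by (simp add: power_int_def inverse_eq_divide)
  then show ?thesis using rational_power[OF rational_inverse[OF assms]] by simp
qed

text \<open>The numerator \<open>W\<close> of the difference vanishes at the integer points h > u >=
  2, which are generic with |t| > 1. Each such u admits infinitely many h, so \<open>W\<close>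
  vanishes identically in h there; infinitely many such u then force \<open>W = 0\<close>.\<close>

lemma rational_identity:
  assumes "rational_in_parameters R" "rational_in_parameters R'"
    and eq: "\<And>h u. generic h u \<Longrightarrow> cmod (u\<^sup>2) > 1 \<Longrightarrow> R h u = R' h u"
    and "generic h u"
  shows "R h u = R' h u"
proof -
  obtain P Q P' Q' where
    PQ: "\<forall>h u. generic h u \<longrightarrow> eval2 Q h u \<noteq> 0 \<and> R h u = eval2 P h u / eval2 Q h u"
    and PQ': "\<forall>h u. generic h u \<longrightarrow> eval2 Q' h u \<noteq> 0 \<and> R' h u = eval2 P' h u / eval2 Q' h u"
    using assms(1,2) unfolding rational_in_parameters_def by blast
  define W where "W = P * Q' - P' * Q"
  have W0: "eval2 W h u = 0 \<longleftrightarrow> R h u = R' h u" if "generic h u" for h u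
    using PQ PQ' that by (simp add: W_def frac_eq_eq)
  have "poly W [:of_nat (n + 2):] = 0" for n
  proof (rule ccontr)
    assume ne: "poly W [:of_nat (n + 2):] \<noteq> 0"
    have "range (\<lambda>m. of_nat (m + n + 3)) \<subseteq> {z. poly (poly W [:of_nat (n + 2):]) z = 0}"
    proof safe
      fix m
      let ?h = "of_nat (m + n + 3) :: complex" and ?u = "of_nat (n + 2) :: complex"
      have sq: "?h\<^sup>2 = of_nat ((m + n + 3)\<^sup>2)" "?u\<^sup>2 = of_nat ((n + 2)\<^sup>2)"
        by (simp_all only: of_nat_power)
      have lt: "1 < (n + 2)\<^sup>2" "(n + 2)\<^sup>2 < (m + n + 3)\<^sup>2"
        by (simp_all add: power2_eq_square algebra_simps)
      have "?h \<noteq> 0" "?u \<noteq> 0" by (simp_all only: of_nat_eq_0_iff)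
      moreover have "?h\<^sup>2 \<noteq> 1" "?u\<^sup>2 \<noteq> 1" "?h\<^sup>2 \<noteq> ?u\<^sup>2"
        unfolding sq of_nat_eq_1_iff of_nat_eq_iff using lt by linarith+
      ultimately have g: "generic ?h ?u" by (simp only: generic_def not_False_eq_True simp_thms)
      have "cmod (?u\<^sup>2) > 1" unfolding sq using lt(1) by (simp only: norm_of_nat)
      from eq[OF g this] show "poly (poly W [:?u:]) ?h = 0"
        using W0[OF g] by (simp only: eval2_def)
    qed
    moreover have "infinite (range (\<lambda>m. of_nat (m + n + 3) :: complex))"
      by (rule range_inj_infinite) (simp add: inj_on_def)
    ultimately show False using poly_roots_finite[OF ne] finite_subset by blast
  qed
  then have "range (\<lambda>n. [:of_nat (n + 2):]) \<subseteq> {z. poly W z = 0}" by blast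
  moreover have "infinite (range (\<lambda>n. [:of_nat (n + 2) :: complex:]))"
    by (rule range_inj_infinite) (simp add: inj_on_def)
  ultimately have "W = 0" using poly_roots_finite[of W] finite_subset by blast
  then show ?thesis using W0[OF assms(4)] by (simp add: eval2_def)
qed

text \<open>Finite sums of fixed polynomials with coefficients rational in the parameters. As the
  polynomials do not vary, rationality passes to each single coefficient.\<close>

inductive rational_family :: "(complex \<Rightarrow> complex \<Rightarrow> ps_poly) \<Rightarrow> bool" where
  base: "rational_in_parameters r \<Longrightarrow> rational_family (\<lambda>h u. cst (r h u) * P)"
| add: "rational_family \<Phi> \<Longrightarrow> rational_family \<Psi> \<Longrightarrow> rational_family (\<lambda>h u. \<Phi> h u + \<Psi> h u)"

lemma rational_family_const: "rational_family (\<lambda>h u. P)"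
  using rational_family.base[OF rational_const[of 1], of P] by simp

lemma rational_family_sum:
  "(\<And>s. s \<in> S \<Longrightarrow> rational_family (\<Phi> s)) \<Longrightarrow> rational_family (\<lambda>h u. \<Sum>s\<in>S. \<Phi> s h u)"
  by (induction S rule: infinite_finite_induct) (auto intro: rational_family_const rational_family.add)

lemma rational_family_mult:
  assumes "rational_family \<Phi>" "rational_family \<Psi>"
  shows "rational_family (\<lambda>h u. \<Phi> h u * \<Psi> h u)"
  using assms(1)
proof induction
  case (base r P)
  show ?case using assms(2)
  proof induction
    case (base r' R)
    have "rational_family (\<lambda>h u. cst (r h u * r' h u) * (P * R))"
      by (intro rational_family.base rational_mult) fact+
    then show ?case by (simp add: cst_mult mult_ac)
  qed (simp add: distrib_left rational_family.add)
qed (simp add: distrib_right rational_family.add)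

lemma rational_family_cst_mult:
  "rational_in_parameters r \<Longrightarrow> rational_family \<Phi> \<Longrightarrow> rational_family (\<lambda>h u. cst (r h u) * \<Phi> h u)"
  using rational_family_mult[OF rational_family.base[of r 1]] by simp

lemma rational_lookup: "rational_family \<Phi> \<Longrightarrow> rational_in_parameters (\<lambda>h u. lk (\<Phi> h u) \<nu>)"
  by (induction rule: rational_family.induct)
     (simp_all add: lookup_cst_mult lookup_add rational_add rational_mult rational_const)

lemma rational_family_translate:
  assumes "\<And>k. rational_in_parameters (\<lambda>h u. c h u k)"
  shows "rational_family (\<lambda>h u. translate (c h u) i P)"
proof (induction P arbitrary: i rule: ps_poly_induct)
  case one
  show ?case unfolding translate_1 by (rule rational_family_const)
next
  case (add P R)
  then show ?case by (simp add: translate_add rational_family.add)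
next
  case (scale a P)
  then show ?case by (simp add: translate_cst_mult rational_family_cst_mult rational_const)
next
  case (pvar k P)
  show ?case
    unfolding translate_pvar_mult
    by (intro rational_family.add rational_family_mult[OF rational_family_const] rational_family_cst_mult assms pvar)
qed

lemma rational_family_power_sum_mode:
  assumes "\<And>k. rational_in_parameters (\<lambda>h u. \<alpha> h u k)"
  shows "rational_family (\<lambda>h u. power_sum_mode (\<alpha> h u) l)"
proof -
  have "rational_family (\<lambda>h u. fps_nth (power_sum_exp (\<alpha> h u)) n)" for n
  proof (induction n rule: less_induct)
    case (less n)
    show ?case
    proof (cases n)
      case 0
      then show ?thesis by (simp add: rational_family_const)
    next
      case (Suc m)
      have "cst (of_nat (Suc m)) * fps_nth (power_sum_exp (\<alpha> h u)) (Suc m) =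
          (\<Sum>i=0..m. fps_nth (power_sum_exp (\<alpha> h u)) i * (cst (\<alpha> h u (Suc (m - i))) * pvar (int (Suc (m - i)))))" for h u
        using arg_cong[OF deriv_power_sum_exp[of "\<alpha> h u"], of "\<lambda>f. fps_nth f m"]
        by (simp add: fps_mult_nth cst_of_nat del: of_nat_Suc)
      then have "cst (1 / of_nat (Suc m)) * (cst (of_nat (Suc m)) * fps_nth (power_sum_exp (\<alpha> h u)) (Suc m)) =
         cst (1 / of_nat (Suc m)) * (\<Sum>i=0..m. fps_nth (power_sum_exp (\<alpha> h u)) i * (cst (\<alpha> h u (Suc (m - i))) * pvar (int (Suc (m - i)))))" for h u
        by (simp only:)
      then have e: "fps_nth (power_sum_exp (\<alpha> h u)) n =
         cst (1 / of_nat (Suc m)) * (\<Sum>i=0..m. fps_nth (power_sum_exp (\<alpha> h u)) i * (cst (\<alpha> h u (Suc (m - i))) * pvar (int (Suc (m - i)))))" for h u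
        unfolding Suc by (simp add: mult.assoc[symmetric] cst_mult[symmetric] del: of_nat_Suc)
      show ?thesis
        unfolding e
        by (intro rational_family_cst_mult[OF rational_const] rational_family_sum rational_family_mult less
            rational_family.base assms) (auto simp: Suc)
    qed
  qed
  then show ?thesis
    by (cases "l \<ge> 0") (simp_all add: power_sum_mode_def in_z_def rational_family_const)
qed

text \<open>The nonzero translation modes may vary with the parameters; the uniform bound replaces
  them by a fixed range of summation.\<close>

lemma rational_family_vertex:
  assumes "\<And>k. rational_in_parameters (\<lambda>h u. \<alpha> h u k)" "\<And>k. rational_in_parameters (\<lambda>h u. c h u k)"
    and "homogeneous d P"
  shows "rational_family (\<lambda>h u. vertex (\<alpha> h u) (c h u) n P)"
proof -
  obtain B where B: "\<And>c i. translate c i P \<noteq> 0 \<Longrightarrow> \<bar>i\<bar> \<le> B"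
    using translate_bounded[OF assms(3)] by blast
  have "vertex \<alpha> c n P = (\<Sum>i\<in>{- B..B}. power_sum_mode \<alpha> (n - i) * translate c i P)" for \<alpha> c
    by (rule vertex_superset) (use B in \<open>force simp: abs_le_iff\<close>)+
  then show ?thesis
    by (simp only:)
       (intro rational_family_sum rational_family_mult rational_family_power_sum_mode rational_family_translate assms)
qed

section \<open>The limiting currents\<close>

definition e_current :: "complex \<Rightarrow> complex \<Rightarrow> current" where
  "e_current h u = vertex_current (h / ((1 - h\<^sup>2) * (1 - 1 / u\<^sup>2)))
     (\<lambda>k. h ^ k - (h / u\<^sup>2) ^ k) (shift_coeff h)"

lemma e_current_eq:
  assumes "F \<in> functions_X"
  shows "e_current h u n F \<nu> = h / ((1 - h\<^sup>2) * (1 - 1 / u\<^sup>2)) *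
    mult_z (in_z (ratio (scale_arg (h / u\<^sup>2) C_inf) (scale_arg h C_inf))) (plethysm (shift_coeff h) F) n \<nu>"
  by (simp only: e_current_def vertex_current_eq[OF assms] ratio_C_inf)

lemma rational_e_current:
  assumes F: "F \<in> functions_X"
  shows "rational_in_parameters (\<lambda>h u. e_current h u n F \<nu>)"
proof -
  have h: "rational_in_parameters (\<lambda>h u. h powi k)" for k
    by (rule rational_power_int[OF rational_h]) (simp add: generic_def)
  have u: "rational_in_parameters (\<lambda>h u. 1 / u\<^sup>2)"
    by (intro rational_inverse rational_power rational_u) (simp add: generic_def)
  have "rational_family (\<lambda>h u. vertex (\<lambda>k. h ^ k - (h / u\<^sup>2) ^ k) (shift_coeff h) n (weight_part (weight \<nu> - n) F))"
  proof (rule rational_family_vertex[OF _ _ homogeneous_weight_part[OF F]])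
    show "rational_in_parameters (\<lambda>h u. h ^ k - (h / u\<^sup>2) ^ k)" for k
      using rational_diff[OF rational_power[OF rational_h] rational_power[OF rational_mult[OF rational_h u]], of k k]
      by simp
    show "rational_in_parameters (\<lambda>h u. shift_coeff h k)" for k
      unfolding shift_coeff_def by (intro rational_diff h)
  qed
  then have "rational_in_parameters (\<lambda>h u. lk (vertex (\<lambda>k. h ^ k - (h / u\<^sup>2) ^ k) (shift_coeff h) n (weight_part (weight \<nu> - n) F)) \<nu>)"
    by (rule rational_lookup)
  moreover have "rational_in_parameters (\<lambda>h u. (1 - h\<^sup>2) * (1 - 1 / u\<^sup>2))"
    by (rule rational_mult[OF rational_diff[OF rational_const rational_power[OF rational_h]] rational_diff[OF rational_const u]])
  then have "rational_in_parameters (\<lambda>h u. h * (1 / ((1 - h\<^sup>2) * (1 - 1 / u\<^sup>2))))"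
    by (intro rational_mult[OF rational_h] rational_inverse) (auto simp: generic_def)
  ultimately have "rational_in_parameters (\<lambda>h u. h * (1 / ((1 - h\<^sup>2) * (1 - 1 / u\<^sup>2))) *
      lk (vertex (\<lambda>k. h ^ k - (h / u\<^sup>2) ^ k) (shift_coeff h) n (weight_part (weight \<nu> - n) F)) \<nu>)"
    by (rule rational_mult[rotated])
  then show ?thesis
    by (simp add: e_current_def vertex_current_def extend_def lookup_cst_mult)
qed

text \<open>The normalization makes the first term constant in N and leaves the factor t^-N on the
  second one.\<close>

lemma e_finite_tendsto:
  assumes F: "F \<in> functions_X" and g: "generic h u" and u: "cmod (u\<^sup>2) > 1"
  shows "(\<lambda>N. u powi (1 - int N) * e_finite h u N n F \<nu>) \<longlonglongrightarrow> e_current h u n F \<nu>"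
proof -
  define X where "X = mult_z (in_z (ratio (scale_arg (h / u\<^sup>2) C_inf) (scale_arg h C_inf))) (plethysm (shift_coeff h) F) n \<nu>"
  define Y where "Y = mult_z (in_z_inverse (ratio (scale_arg (u\<^sup>2 / h) C_tilde) (scale_arg (1 / h) C_tilde)))
    (plethysm (shift_coeff h) F) n \<nu>"
  define c where "c = h / ((1 - h\<^sup>2) * (1 - 1 / u\<^sup>2))"
  have u0: "u \<noteq> 0" using g by (simp add: generic_def)
  have "u powi (1 - int N) * e_finite h u N n F \<nu> = c * (X - (1 / u\<^sup>2) ^ N * Y)" for N
  proof -
    have 1: "u powi (1 - int N) * (1 / u * u powi int N) = 1"
      using u0 by (simp add: power_int_diff)
    have 2: "u powi (1 - int N) * (1 / u * u powi (- int N)) = (1 / u\<^sup>2) ^ N"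
      using u0 by (simp add: power_int_diff power_int_minus power_one_over power2_eq_square
          power_mult_distrib inverse_eq_divide)
    have "e_finite h u N n F \<nu> = c * (1 / u * u powi int N * X - 1 / u * u powi (- int N) * Y)"
      unfolding e_finite_def Let_def X_def Y_def c_def by (simp add: algebra_simps)
    then have "u powi (1 - int N) * e_finite h u N n F \<nu> =
      c * (u powi (1 - int N) * (1 / u * u powi int N) * X - u powi (1 - int N) * (1 / u * u powi (- int N)) * Y)"
      by (simp only: right_diff_distrib mult_ac)
    then show ?thesis by (simp only: 1 2 mult_1_left)
  qed
  moreover have "1 / cmod (u\<^sup>2) < 1" using u by (subst divide_less_eq_1_pos) auto
  then have "(\<lambda>N. c * (X - (1 / u\<^sup>2) ^ N * Y)) \<longlonglongrightarrow> c * (X - 0 * Y)"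
    by (intro tendsto_intros LIMSEQ_power_zero) (simp only: norm_divide norm_one)
  ultimately show ?thesis
    by (simp add: e_current_eq[OF F] X_def c_def)
qed

text \<open>The explicit formula is a rational function with the required limits. Any other
  candidate has the same limits where |t| > 1 and hence agrees with it at every generic
  point.\<close>

lemma e_inf_eq:
  assumes F: "F \<in> functions_X" and g: "generic h u"
  shows "e_inf h u n F \<nu> = e_current h u n F \<nu>"
  unfolding e_inf_def
proof (rule the_equality)
  show "\<exists>R. rational_in_parameters R \<and>
    (\<forall>h' u'. generic h' u' \<and> 1 < cmod (u'\<^sup>2) \<longrightarrow>
      (\<lambda>N. u' powi (1 - int N) * e_finite h' u' N n F \<nu>) \<longlonglongrightarrow> R h' u') \<and> e_current h u n F \<nu> = R h u"
    using rational_e_current[OF F] e_finite_tendsto[OF F]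
    by (intro exI[of _ "\<lambda>h u. e_current h u n F \<nu>"]) simp
next
  fix v assume "\<exists>R. rational_in_parameters R \<and>
    (\<forall>h' u'. generic h' u' \<and> 1 < cmod (u'\<^sup>2) \<longrightarrow>
      (\<lambda>N. u' powi (1 - int N) * e_finite h' u' N n F \<nu>) \<longlonglongrightarrow> R h' u') \<and> v = R h u"
  then obtain R where R: "rational_in_parameters R" "v = R h u"
    "\<And>h' u'. generic h' u' \<Longrightarrow> 1 < cmod (u'\<^sup>2) \<Longrightarrow>
      (\<lambda>N. u' powi (1 - int N) * e_finite h' u' N n F \<nu>) \<longlonglongrightarrow> R h' u'"
    by blast
  have "R h u = e_current h u n F \<nu>"
    by (rule rational_identity[OF R(1) rational_e_current[OF F] _ g])
       (rule LIMSEQ_unique[OF R(3) e_finite_tendsto[OF F]])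
  then show "v = e_current h u n F \<nu>" by (simp add: R(2))
qed

lemma generic_inverse: "generic h u \<Longrightarrow> generic (1 / h) (1 / u)"
  by (auto simp: generic_def power_one_over)

lemma f_inf_eq:
  assumes "F \<in> functions_X" "generic h u"
  shows "f_inf h u n F \<nu> = e_current (1 / h) (1 / u) n F \<nu>"
  unfolding f_inf_def by (rule e_inf_eq[OF assms(1) generic_inverse[OF assms(2)]])

section \<open>The relations between the limiting currents\<close>

lemma forms_at_1_eq:
  assumes "\<forall>(a, b)\<in>set L. a \<noteq> 0"
  shows "forms_at_1 L = fps_const (\<Prod>p\<leftarrow>L. fst p) * exp_sum (\<lambda>k. - (\<Sum>(a, b)\<leftarrow>L. (- b / a) ^ k))"
  using assms
proof (induction L)
  case (Cons p L)
  obtain a b where p: "p = (a, b)" by fastforce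
  have a: "a \<noteq> 0" using Cons.prems by (simp add: p)
  have "fps_const a + fps_const b * fps_X = fps_const a * (1 - fps_const (- b / a) * fps_X)"
    using a by (simp add: fps_eq_iff)
  also have "\<dots> = fps_const a * exp_sum (\<lambda>k. - ((- b / a) ^ k))"
    by (simp only: exp_sum_neg_power)
  finally have "forms_at_1 (p # L) = fps_const a * exp_sum (\<lambda>k. - ((- b / a) ^ k)) * forms_at_1 L"
    by (simp add: forms_at_1_def p)
  also have "\<dots> = fps_const a * fps_const (\<Prod>p\<leftarrow>L. fst p) *
      (exp_sum (\<lambda>k. - ((- b / a) ^ k)) * exp_sum (\<lambda>k. - (\<Sum>(a, b)\<leftarrow>L. (- b / a) ^ k)))"
    using Cons by (simp only: list.set_intros(2) Ball_def mult_ac) simp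
  finally show ?case by (simp add: exp_sum_add p)
qed (simp add: forms_at_1_def)

text \<open>Comparison of logarithms: an identity between products of linear factors becomes, for
  each k > 0, an identity between sums of k-th powers of the inverse roots - b / a.\<close>

lemma forms_at_1_mult_exp_sum:
  assumes "\<forall>(a, b)\<in>set L. a \<noteq> 0" "\<forall>(a, b)\<in>set L'. a \<noteq> 0"
    and "(\<Prod>p\<leftarrow>L. fst p) = (\<Prod>p\<leftarrow>L'. fst p)"
    and "\<And>k. k > 0 \<Longrightarrow> s k = (\<Sum>(a, b)\<leftarrow>L. (- b / a) ^ k) - (\<Sum>(a, b)\<leftarrow>L'. (- b / a) ^ k)"
  shows "forms_at_1 L * exp_sum s = forms_at_1 L'"
  unfolding forms_at_1_eq[OF assms(1)] forms_at_1_eq[OF assms(2)] mult.assoc exp_sum_add assms(3)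
  by (intro arg_cong2[where f = "(*)"] refl exp_sum_cong) (simp add: assms(4))

text \<open>The case of \<open>\<phi> = (1 - a x) (1 - b x) / ((1 - x) (1 - a b x))\<close>.\<close>

lemma exp_sum_two_poles:
  assumes r: "r = a * b" "r \<noteq> 1" and s: "\<And>k. k > 0 \<Longrightarrow> s k = 1 + r ^ k - a ^ k - b ^ k"
  shows "fps_nth (exp_sum s) i = (if i = 0 then 1 else 0) + (1 - a) * (1 - b) / (1 - r) * (1 - r ^ i)"
proof -
  define A where "A = (1 - a) * (1 - b) / (1 - r)"
  define g where "g = (\<lambda>c. Abs_fps (\<lambda>n. c ^ n) :: complex fps)"
  define l where "l = (\<lambda>c. 1 - fps_const c * fps_X :: complex fps)"
  have gl: "g c * l c = 1" for c
  proof (rule fps_ext)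
    fix n show "fps_nth (g c * l c) n = fps_nth 1 n"
      by (cases n) (simp_all add: g_def l_def right_diff_distrib mult.assoc[symmetric] fps_X_mult_right_nth)
  qed
  have l: "l c = exp_sum (\<lambda>k. - (c ^ k))" for c by (simp add: l_def exp_sum_neg_power)
  \<comment> \<open>Partial fractions: the values at 0 and, for nonzero r = a b, at infinity are
    both 1. So the constant is 1 and the two polar parts have opposite coefficients.\<close>
  define G where "G = 1 + fps_const A * (g 1 - g r)"
  have "exp_sum s * (l 1 * l r) = l a * l b"
    unfolding l exp_sum_add by (rule exp_sum_cong) (simp add: s)
  also have "\<dots> = l 1 * l r + fps_const A * (l r - l 1)"
  proof -
    have "A * (1 - r) = (1 - a) * (1 - b)" using r(2) by (simp add: A_def)
    then have "A - A * r = 1 - a - b + a * b" by (simp add: algebra_simps)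
    then have "fps_const A - fps_const A * fps_const r = 1 - fps_const a - fps_const b + fps_const a * fps_const b"
      by (simp only: fps_const_mult fps_const_sub fps_const_add fps_const_1_eq_1[symmetric])
    then have e: "fps_const A * fps_const r = fps_const A - (1 - fps_const a - fps_const b + fps_const r)"
      by (simp add: r(1) algebra_simps)
    have "fps_const A * (l r - l 1) = (fps_const A - fps_const A * fps_const r) * fps_X"
      by (simp add: l_def algebra_simps)
    also have "\<dots> = (1 - fps_const a - fps_const b + fps_const r) * fps_X"
      unfolding e by simp
    finally have "fps_const A * (l r - l 1) = (1 - fps_const a - fps_const b + fps_const r) * fps_X" .
    then show ?thesis
      by (simp add: l_def r(1) fps_const_mult[symmetric] algebra_simps del: fps_const_mult)
  qed
  also have "\<dots> = G * (l 1 * l r)"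
  proof -
    have "G * (l 1 * l r) = l 1 * l r + fps_const A * ((g 1 * l 1) * l r - (g r * l r) * l 1)"
      by (simp add: G_def algebra_simps)
    then show ?thesis by (simp only: gl mult_1_left)
  qed
  finally have "exp_sum s * (l 1 * l r) = G * (l 1 * l r)" .
  moreover have "fps_nth (l 1 * l r) 0 = 1" by (simp add: l_def)
  then have "l 1 * l r \<noteq> 0" by (metis fps_zero_nth zero_neq_one)
  ultimately have "exp_sum s = G" by (simp only: mult_cancel_right) simp
  then show ?thesis by (simp add: G_def g_def A_def)
qed

lemma shift_coeff_of_nat: "shift_coeff h (int k) = h ^ k - 1 / h ^ k"
  by (simp add: shift_coeff_def power_int_minus inverse_eq_divide)

lemma shift_coeff_inverse: "shift_coeff (1 / h) k = - shift_coeff h k"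
proof -
  have "(1 / h) powi k = h powi (- k)" "(1 / h) powi (- k) = h powi k"
    by (simp_all add: power_int_minus power_int_divide_distrib inverse_eq_divide)
  then show ?thesis by (simp add: shift_coeff_def)
qed

section \<open>The limiting currents as vertex currents on functions\<close>

lemma psi_plus_eq:
  "F \<in> functions_X \<Longrightarrow> psi_plus h u n F = vertex_current 1
     (\<lambda>k. (h ^ k - (h / u\<^sup>2) ^ k) + ((1 / h) ^ k - (u\<^sup>2 / h) ^ k)) (\<lambda>k. 0) n F"
  by (simp only: psi_plus_def psi_plus_series_eq prod_fun_power_sum_mode)

lemma psi_minus_eq:
  "F \<in> functions_X \<Longrightarrow> psi_minus h u n F = vertex_current 1 (\<lambda>k. 0)
     (\<lambda>k. shift_coeff h k * (1 - (u\<^sup>2 / h\<^sup>2) powi k)) n F"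
  by (simp only: psi_minus_def plethysm_eq_vertex_current)

text \<open>The currents agree with vertex currents on \<open>functions_X\<close>. Replacing the
  outer factor of a product therefore requires that the inner factor stays in that set.\<close>

lemma exchange_cong:
  assumes "exchange P Q A' B'"
    and "\<And>F n. F \<in> functions_X \<Longrightarrow> A n F = A' n F" "\<And>F n. F \<in> functions_X \<Longrightarrow> B n F = B' n F"
    and "\<And>F n. F \<in> functions_X \<Longrightarrow> A' n F \<in> functions_X" "\<And>F n. F \<in> functions_X \<Longrightarrow> B' n F \<in> functions_X"
  shows "exchange P Q A B"
  using assms(1) unfolding exchange_def by (simp add: assms(2-5))

lemma serre_relation_cong:
  assumes "serre_relation A'"
    and A: "\<And>F n. F \<in> functions_X \<Longrightarrow> A n F = A' n F" "\<And>F n. F \<in> functions_X \<Longrightarrow> A' n F \<in> functions_X"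
  shows "serre_relation A"
proof -
  have c: "commutator (A i) (A j) F = commutator (A' i) (A' j) F"
    and cF: "commutator (A' i) (A' j) F \<in> functions_X" if "F \<in> functions_X" for i j F
    using that weight_part_diff(1)[of "A' i (A' j F)" "A' j (A' i F)"] by (simp_all add: commutator_def A)
  have "serre_term A i j k F = serre_term A' i j k F" if "F \<in> functions_X" for i j k F
    using that unfolding serre_term_def commutator_def[of "A i"] commutator_def[of "A' i"]
    by (simp add: A c cF)
  then show ?thesis using assms(1) unfolding serre_relation_def by simp
qed

text \<open>Here \<phi>(x) = (1 - x)(1 - q x/t) / ((1 - q x)(1 - x/t)). The parameters are merely
  nonzero, so inverting h and u gives the case of \<ff>.\<close>

lemma serre_relation_e_current:
  assumes "h \<noteq> 0" "u \<noteq> 0"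
  shows "serre_relation (e_current h u)"
  unfolding e_current_def
proof (rule serre_relation_vertex_current)
  let ?q = "h\<^sup>2" and ?t = "u\<^sup>2"
  let ?f = "exp_sum (\<lambda>k. (h ^ k - (h / ?t) ^ k) * shift_coeff h (int k))"
  have "forms_at_1 [(1, - ?q), (1, - 1 / ?t)] * ?f = forms_at_1 [(1, - 1), (1, - ?q / ?t)]"
    by (rule forms_at_1_mult_exp_sum)
       (use assms in \<open>simp_all add: shift_coeff_of_nat power_divide power_mult[symmetric] mult.commute[of 2]
         power_mult power2_eq_square field_simps\<close>)
  moreover have "forms_at_1 [(1, - ?q), (1, - 1 / ?t)] =
      1 - fps_const (?q + 1 / ?t) * fps_X + fps_const (?q / ?t) * fps_X^2"
    by (simp add: forms_at_1_def fps_eq_iff fps_X_power_iff algebra_simps) presburger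
  moreover have "forms_at_1 [(1, - 1), (1, - ?q / ?t)] = (1 - fps_X) * (1 - fps_const (?q / ?t) * fps_X)"
    by (simp add: forms_at_1_def)
  ultimately show "(1 - fps_const (?q + 1 / ?t) * fps_X + fps_const (?q / ?t) * fps_X^2) * ?f =
      (1 - fps_X) * (1 - fps_const (?q / ?t) * fps_X)" by simp
qed

text \<open>The sign of -g goes into one of the three forms, and the scale q/t of the rescaled
  variable into the coefficients.\<close>

lemma gpoly_linear_forms:
  fixes q t :: complex
  assumes "q \<noteq> 0" "t \<noteq> 0"
  shows "gpoly cst q t zvar wvar = linear_forms [(1, - q), (1, - 1 / t), (1, - t / q)]"
    and "gpoly cst q t wvar zvar = linear_forms [(- q, 1), (- 1 / t, 1), (- t / q, 1)]"
    and "- gpoly cst q t wvar zvar = linear_forms [(q, - 1), (- 1 / t, 1), (- t / q, 1)]"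
    and "- gpoly cst q t zvar wvar = linear_forms [(- 1, q), (1, - 1 / t), (1, - t / q)]"
    and "gpoly cst q t wvar (cst (q / t) * zvar) =
      linear_forms [(- (q\<^sup>2 / t), 1), (- (q / t\<^sup>2), 1), (- 1, 1)]"
    and "- gpoly cst q t (cst (q / t) * zvar) wvar =
      linear_forms [(- (q / t), q), (q / t, - 1 / t), (q / t, - t / q)]"
proof -
  have m: "cst a * (cst b * v) = cst (a * b) * v" for a b and v :: laurent_zw
    by (simp add: cst_mult mult.assoc)
  have e: "q * (q / t) = q\<^sup>2 / t" "1 / t * (q / t) = q / t\<^sup>2" "t / q * (q / t) = 1"
    using assms by (simp_all add: power2_eq_square)
  have neg: "- (a * b * c) = - a * b * c" for a b c :: laurent_zw by simp
  show "gpoly cst q t zvar wvar = linear_forms [(1, - q), (1, - 1 / t), (1, - t / q)]"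
    "gpoly cst q t wvar zvar = linear_forms [(- q, 1), (- 1 / t, 1), (- t / q, 1)]"
    "- gpoly cst q t wvar zvar = linear_forms [(q, - 1), (- 1 / t, 1), (- t / q, 1)]"
    "- gpoly cst q t zvar wvar = linear_forms [(- 1, q), (1, - 1 / t), (1, - t / q)]"
    "gpoly cst q t wvar (cst (q / t) * zvar) =
      linear_forms [(- (q\<^sup>2 / t), 1), (- (q / t\<^sup>2), 1), (- 1, 1)]"
    "- gpoly cst q t (cst (q / t) * zvar) wvar =
      linear_forms [(- (q / t), q), (q / t, - 1 / t), (q / t, - t / q)]"
    unfolding gpoly_def linear_forms_def m e neg
    by (simp_all add: cst_uminus mult.assoc)
qed

lemma linear_forms_append: "linear_forms (L @ L') = linear_forms L * linear_forms L'"
  by (simp add: linear_forms_def)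

lemma exchange_e_current:
  assumes h: "h \<noteq> 0" "u \<noteq> 0" and q: "q = h\<^sup>2" "t = u\<^sup>2"
  shows "exchange (- gpoly cst q t wvar zvar) (gpoly cst q t zvar wvar) (e_current h u) (e_current h u)"
proof -
  have n: "q \<noteq> 0" "t \<noteq> 0" using h q by auto
  have pw: "q ^ k = (h ^ k)\<^sup>2" for k by (simp add: q power_mult[symmetric] mult.commute)
  \<comment> \<open>\<open>Ln\<close> stands for (z - w)(z - (q/t) w)(z - (t/q) w): multiplication
    by \<phi> replaces two factors of g(z, w) and keeps the third.\<close>
  show ?thesis
    unfolding gpoly_linear_forms(1)[OF n] gpoly_linear_forms(3)[OF n] e_current_def q(2)[symmetric]
    by (rule exchange_vertex_current[where Ln = "[(1, - 1), (1, - (q / t)), (1, - (t / q))]"]; (rule forms_at_1_mult_exp_sum)?)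
       (use n h in \<open>simp_all add: shift_coeff_of_nat power_divide pw, (simp_all add: power2_eq_square field_simps)?\<close>)
qed

lemma exchange_f_current:
  assumes h: "h \<noteq> 0" "u \<noteq> 0" and q: "q = h\<^sup>2" "t = u\<^sup>2"
  shows "exchange (- gpoly cst q t zvar wvar) (gpoly cst q t wvar zvar)
    (e_current (1 / h) (1 / u)) (e_current (1 / h) (1 / u))"
proof -
  have n: "q \<noteq> 0" "t \<noteq> 0" using h q by auto
  have pw: "q ^ k = (h ^ k)\<^sup>2" for k by (simp add: q power_mult[symmetric] mult.commute)
  have t: "1 / h / (1 / u)\<^sup>2 = t / h" by (simp add: q power_one_over)
  show ?thesis
    unfolding gpoly_linear_forms(2)[OF n] gpoly_linear_forms(4)[OF n] e_current_def t
    by (rule exchange_vertex_current[where Ln = "[(- 1, 1), (1, - (t / q)), (1, - (q / t))]"]; (rule forms_at_1_mult_exp_sum)?)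
       (use n h in \<open>simp_all add: shift_coeff_inverse shift_coeff_of_nat power_divide pw, (simp_all add: power2_eq_square field_simps)?\<close>)
qed

text \<open>\<psi>+ has no translation and \<psi>- no multiplication, so one of the two orders is
  already normally ordered. With \<psi>+ on the left \<open>Ln\<close> is therefore the denominator
  of the relation, with \<psi>- on the left its numerator.\<close>

lemma exchange_psi:
  assumes h: "h \<noteq> 0" "u \<noteq> 0" and q: "q = h\<^sup>2" "t = u\<^sup>2"
  defines "\<beta> \<equiv> \<lambda>k. (h ^ k - (h / t) ^ k) + ((1 / h) ^ k - (t / h) ^ k)"
    and "d \<equiv> \<lambda>k. shift_coeff h k * (1 - (t / q) powi k)"
  shows "exchange (- gpoly cst q t wvar zvar) (gpoly cst q t zvar wvar)
      (vertex_current 1 \<beta> (\<lambda>k. 0)) (e_current h u)"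
    and "exchange (- gpoly cst q t wvar zvar) (gpoly cst q t zvar wvar)
      (vertex_current 1 (\<lambda>k. 0) d) (e_current h u)"
    and "exchange (- gpoly cst q t zvar wvar) (gpoly cst q t wvar zvar)
      (vertex_current 1 \<beta> (\<lambda>k. 0)) (e_current (1 / h) (1 / u))"
    and "exchange (- gpoly cst q t (cst (q / t) * zvar) wvar) (gpoly cst q t wvar (cst (q / t) * zvar))
      (vertex_current 1 (\<lambda>k. 0) d) (e_current (1 / h) (1 / u))"
    and "exchange (gpoly cst q t wvar zvar * gpoly cst q t (cst (q / t) * zvar) wvar)
      (gpoly cst q t zvar wvar * gpoly cst q t wvar (cst (q / t) * zvar))
      (vertex_current 1 (\<lambda>k. 0) d) (vertex_current 1 \<beta> (\<lambda>k. 0))"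
proof -
  have n: "q \<noteq> 0" "t \<noteq> 0" using h q by auto
  have pw: "q ^ k = (h ^ k)\<^sup>2" for k by (simp add: q power_mult[symmetric] mult.commute)
  have t: "1 / h / (1 / u)\<^sup>2 = t / h" by (simp add: q power_one_over)
  \<comment> \<open>At H = h^k and T = t^k, \<open>E1\<close> and \<open>E2\<close> are k times the
    coefficients of x^k in the logarithms of -g(w, z)/g(z, w) and of -g((q/t) z, w)/g(w, (q/t) z),
    where x = w/z.\<close>
  define E1 where "E1 = (\<lambda>H T :: complex. H\<^sup>2 + 1 / T + T / H\<^sup>2 - 1 / H\<^sup>2 - T - H\<^sup>2 / T)"
  define E2 where "E2 = (\<lambda>H T :: complex. 1 + T / H\<^sup>2 / H\<^sup>2 + T * (T / H\<^sup>2) - 1 / H\<^sup>2 - T - T / H\<^sup>2 * (T / H\<^sup>2))"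
  have id1: "(H - H / T + (1 / H - T / H)) * (H - 1 / H) = E1 H T"
    "(H - H / T) * ((H - 1 / H) * (1 - T / H\<^sup>2)) = E1 H T"
    "(1 / H - T / H) * ((H - 1 / H) * (1 - T / H\<^sup>2)) = E2 H T" if "H \<noteq> 0" "T \<noteq> 0" for H T
    using that by (simp_all add: E1_def E2_def field_simps power2_eq_square)
  have d: "d (int k) = (h ^ k - 1 / h ^ k) * (1 - t ^ k / (h ^ k)\<^sup>2)" for k
    by (simp add: d_def shift_coeff_of_nat power_divide pw)
  have \<beta>: "\<beta> k = h ^ k - h ^ k / t ^ k + (1 / h ^ k - t ^ k / h ^ k)" for k
    by (simp add: \<beta>_def power_divide)
  have s: "\<beta> k * shift_coeff h (int k) = E1 (h ^ k) (t ^ k)"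
    "(h ^ k - (h / t) ^ k) * d (int k) = E1 (h ^ k) (t ^ k)"
    "((1 / h) ^ k - (t / h) ^ k) * d (int k) = E2 (h ^ k) (t ^ k)"
    "\<beta> k * d (int k) = E1 (h ^ k) (t ^ k) + E2 (h ^ k) (t ^ k)"
    "\<beta> k * shift_coeff (1 / h) (int k) = - E1 (h ^ k) (t ^ k)" for k
  proof -
    have nz: "h ^ k \<noteq> 0" "t ^ k \<noteq> 0" using h n by simp_all
    note id = id1[OF nz]
    show 1: "\<beta> k * shift_coeff h (int k) = E1 (h ^ k) (t ^ k)"
      by (simp only: \<beta> shift_coeff_of_nat id)
    show 2: "(h ^ k - (h / t) ^ k) * d (int k) = E1 (h ^ k) (t ^ k)"
      "((1 / h) ^ k - (t / h) ^ k) * d (int k) = E2 (h ^ k) (t ^ k)"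
      by (simp_all only: d power_divide power_one id)
    show "\<beta> k * d (int k) = E1 (h ^ k) (t ^ k) + E2 (h ^ k) (t ^ k)"
      unfolding 2[symmetric] by (simp only: \<beta>_def distrib_right)
    show "\<beta> k * shift_coeff (1 / h) (int k) = - E1 (h ^ k) (t ^ k)"
      by (simp only: shift_coeff_inverse mult_minus_right 1)
  qed
  have roots: "- (- t / q) / (q / t) = t / q * (t / q)" "- q / (- (q / t)) = t" "- (- 1 / t) / (q / t) = 1 / q"
    "- 1 / (- (q\<^sup>2 / t)) = t / q / q" "- 1 / (- (q / t\<^sup>2)) = t * (t / q)"
    using n by (simp_all add: power2_eq_square)
  note simps = E1_def E2_def roots power_divide power_mult_distrib pw
  \<comment> \<open>The forms of numerator and denominator have the same product of leading
    coefficients, as the quotient must be 1 at x = 0.\<close>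
  have L6: "(- (q\<^sup>2 / t)) * ((- (q / t\<^sup>2)) * - 1) = (- (q / t)) * (q / t * (q / t))"
    using n by (simp add: power2_eq_square)
  show "exchange (- gpoly cst q t wvar zvar) (gpoly cst q t zvar wvar)
      (vertex_current 1 \<beta> (\<lambda>k. 0)) (e_current h u)"
    unfolding gpoly_linear_forms(1)[OF n] gpoly_linear_forms(3)[OF n] e_current_def q(2)[symmetric]
  proof (rule exchange_vertex_current[where Ln = "[(1, - q), (1, - 1 / t), (1, - t / q)]"])
    show "forms_at_1 (map prod.swap [(q, - 1), (- 1 / t, 1), (- t / q, 1)]) * exp_sum (\<lambda>k. \<beta> k * shift_coeff h (int k)) =
      forms_at_1 (map prod.swap [(1, - q), (1, - 1 / t), (1, - t / q)])"
      unfolding s(1) by (rule forms_at_1_mult_exp_sum) (use n in \<open>simp_all add: simps\<close>)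
  qed simp_all
  show "exchange (- gpoly cst q t wvar zvar) (gpoly cst q t zvar wvar)
      (vertex_current 1 (\<lambda>k. 0) d) (e_current h u)"
    unfolding gpoly_linear_forms(1)[OF n] gpoly_linear_forms(3)[OF n] e_current_def q(2)[symmetric]
  proof (rule exchange_vertex_current[where Ln = "[(q, - 1), (- 1 / t, 1), (- t / q, 1)]"])
    show "forms_at_1 [(1, - q), (1, - 1 / t), (1, - t / q)] * exp_sum (\<lambda>k. (h ^ k - (h / t) ^ k) * d (int k)) =
      forms_at_1 [(q, - 1), (- 1 / t, 1), (- t / q, 1)]"
      unfolding s(2) by (rule forms_at_1_mult_exp_sum) (use n in \<open>simp_all add: simps\<close>)
  qed simp_all
  show "exchange (- gpoly cst q t zvar wvar) (gpoly cst q t wvar zvar)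
      (vertex_current 1 \<beta> (\<lambda>k. 0)) (e_current (1 / h) (1 / u))"
    unfolding gpoly_linear_forms(2)[OF n] gpoly_linear_forms(4)[OF n] e_current_def t
  proof (rule exchange_vertex_current[where Ln = "[(- q, 1), (- 1 / t, 1), (- t / q, 1)]"])
    show "forms_at_1 (map prod.swap [(- 1, q), (1, - 1 / t), (1, - t / q)]) * exp_sum (\<lambda>k. \<beta> k * shift_coeff (1 / h) (int k)) =
      forms_at_1 (map prod.swap [(- q, 1), (- 1 / t, 1), (- t / q, 1)])"
      unfolding s(5) by (rule forms_at_1_mult_exp_sum) (use n in \<open>simp_all add: simps\<close>)
  qed simp_all
  show "exchange (- gpoly cst q t (cst (q / t) * zvar) wvar) (gpoly cst q t wvar (cst (q / t) * zvar))
      (vertex_current 1 (\<lambda>k. 0) d) (e_current (1 / h) (1 / u))"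
    unfolding gpoly_linear_forms(5)[OF n] gpoly_linear_forms(6)[OF n] e_current_def t
  proof (rule exchange_vertex_current[where Ln = "[(- (q / t), q), (q / t, - 1 / t), (q / t, - t / q)]"])
    show "forms_at_1 [(- (q\<^sup>2 / t), 1), (- (q / t\<^sup>2), 1), (- 1, 1)] *
        exp_sum (\<lambda>k. ((1 / h) ^ k - (t / h) ^ k) * d (int k)) =
      forms_at_1 [(- (q / t), q), (q / t, - 1 / t), (q / t, - t / q)]"
      unfolding s(3)
    proof (rule forms_at_1_mult_exp_sum)
      show "E2 (h ^ k) (t ^ k) = (\<Sum>(a, b)\<leftarrow>[(- (q\<^sup>2 / t), 1), (- (q / t\<^sup>2), 1), (- 1, 1)]. (- b / a) ^ k) -
          (\<Sum>(a, b)\<leftarrow>[(- (q / t), q), (q / t, - 1 / t), (q / t, - t / q)]. (- b / a) ^ k)" for k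
        by (simp only: list.map case_prod_conv roots sum_list.Cons sum_list.Nil) (simp add: simps)
    qed (use n L6 in simp_all)
  qed simp_all
  have e: "gpoly cst q t wvar zvar * gpoly cst q t (cst (q / t) * zvar) wvar =
      - gpoly cst q t wvar zvar * (- gpoly cst q t (cst (q / t) * zvar) wvar)"
    by simp
  show "exchange (gpoly cst q t wvar zvar * gpoly cst q t (cst (q / t) * zvar) wvar)
      (gpoly cst q t zvar wvar * gpoly cst q t wvar (cst (q / t) * zvar))
      (vertex_current 1 (\<lambda>k. 0) d) (vertex_current 1 \<beta> (\<lambda>k. 0))"
    unfolding e gpoly_linear_forms(1)[OF n] gpoly_linear_forms(3)[OF n] gpoly_linear_forms(5)[OF n]
      gpoly_linear_forms(6)[OF n] linear_forms_append[symmetric]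
  proof (rule exchange_vertex_current[where Ln = "[(q, - 1), (- 1 / t, 1), (- t / q, 1)] @
        [(- (q / t), q), (q / t, - 1 / t), (q / t, - t / q)]"])
    show "forms_at_1 ([(1, - q), (1, - 1 / t), (1, - t / q)] @ [(- (q\<^sup>2 / t), 1), (- (q / t\<^sup>2), 1), (- 1, 1)]) *
        exp_sum (\<lambda>k. \<beta> k * d (int k)) =
      forms_at_1 ([(q, - 1), (- 1 / t, 1), (- t / q, 1)] @ [(- (q / t), q), (q / t, - 1 / t), (q / t, - t / q)])"
      unfolding s(4)
    proof (rule forms_at_1_mult_exp_sum)
      show "E1 (h ^ k) (t ^ k) + E2 (h ^ k) (t ^ k) =
          (\<Sum>(a, b)\<leftarrow>[(1, - q), (1, - 1 / t), (1, - t / q)] @ [(- (q\<^sup>2 / t), 1), (- (q / t\<^sup>2), 1), (- 1, 1)]. (- b / a) ^ k) -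
          (\<Sum>(a, b)\<leftarrow>[(q, - 1), (- 1 / t, 1), (- t / q, 1)] @ [(- (q / t), q), (q / t, - 1 / t), (q / t, - t / q)]. (- b / a) ^ k)" for k
        by (simp only: append.simps list.map case_prod_conv roots sum_list.Cons sum_list.Nil) (simp add: simps)
    qed (use n L6 in simp_all)
  qed simp_all
qed

text \<open>Here \<phi>(x) = (1 - t x)(1 - x/q) / ((1 - x)(1 - t x/q)), so r = t/q. At w = z the
  translations cancel and the multiplications combine to \<psi>+; at w = z/r = (q/t) z the
  multiplications cancel and the translations combine to \<psi>-.\<close>

lemma commutator_e_f_current:
  assumes g: "generic h u" and q: "q = h\<^sup>2" "t = u\<^sup>2" and F: "F \<in> functions_X"
  shows "commutator (e_current h u m) (e_current (1 / h) (1 / u) n) F \<nu> =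
    1 / gpoly id q t 1 1 *
      (delta_times 1 (psi_plus h u) m n F \<nu> - delta_times (q / t) (psi_minus h u) m n F \<nu>)"
proof -
  have h: "h \<noteq> 0" "q \<noteq> 0" "t \<noteq> 0" "q \<noteq> 1" "t \<noteq> 1" "q \<noteq> t" using g q by (auto simp: generic_def)
  have pw: "q ^ k = (h ^ k)\<^sup>2" for k by (simp add: q power_mult[symmetric] mult.commute)
  have t: "1 / h / (1 / u)\<^sup>2 = t / h" by (simp add: q power_one_over)
  define r where "r = t / q"
  define A where "A = (1 - t) * (1 - 1 / q) / (1 - r)"
  define \<kappa> \<kappa>' where "\<kappa> = h / ((1 - h\<^sup>2) * (1 - 1 / u\<^sup>2))" and
    "\<kappa>' = 1 / h / ((1 - (1 / h)\<^sup>2) * (1 - 1 / (1 / u)\<^sup>2))"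
  define \<alpha> \<alpha>' where "\<alpha> = (\<lambda>k. h ^ k - (h / t) ^ k)" and "\<alpha>' = (\<lambda>k. (1 / h) ^ k - (t / h) ^ k)"
  have r: "r \<noteq> 0" "r \<noteq> 1" "1 / r \<noteq> 1" "1 / r = q / t" using h by (auto simp: r_def)
  have 1: "fps_nth (exp_sum (\<lambda>k. \<alpha>' k * shift_coeff h (int k))) i = (if i = 0 then 1 else 0) + A * (1 - r ^ i)" for i
    unfolding A_def
    by (rule exp_sum_two_poles)
       (use h r in \<open>simp_all add: r_def \<alpha>'_def shift_coeff_of_nat power_divide pw power2_eq_square field_simps\<close>)
  \<comment> \<open>The opposite order expands the same function in 1/x: the three constants are
    inverted, which reverses the sign of \<open>A\<close>.\<close>
  have "(1 - 1 / t) * (1 - q) / (1 - 1 / r) = - A"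
    using h r by (simp add: A_def r_def divide_simps) (simp add: algebra_simps)
  moreover have "\<alpha> k * shift_coeff (1 / h) (int k) = 1 + (1 / r) ^ k - (1 / t) ^ k - q ^ k" for k
    using h by (simp add: \<alpha>_def r(4) shift_coeff_inverse shift_coeff_of_nat power_divide pw
        power2_eq_square field_simps)
  ultimately have 2: "fps_nth (exp_sum (\<lambda>k. \<alpha> k * shift_coeff (1 / h) (int k))) i =
      (if i = 0 then 1 else 0) + - A * (1 - (1 / r) ^ i)" for i
    using exp_sum_two_poles[of "1 / r" "1 / t" q "\<lambda>k. \<alpha> k * shift_coeff (1 / h) (int k)" i] r(3,4)
    by simp
  have \<phi>: "zero_ext (exp_sum (\<lambda>k. \<alpha>' k * shift_coeff h (int k))) i -
      zero_ext (exp_sum (\<lambda>k. \<alpha> k * shift_coeff (1 / h) (int k))) (- i) = A * (1 - r powi i)" for i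
  proof -
    consider "i = 0" | "i > 0" | "i < 0" by linarith
    then show ?thesis
      by cases (simp_all add: zero_ext_def 1 2 power_int_def power_one_over inverse_eq_divide)
  qed
  have c: "(\<lambda>k. \<alpha> k + (1 / r) ^ k * \<alpha>' k) = (\<lambda>k. 0)" "(\<lambda>k. shift_coeff h k + shift_coeff (1 / h) k) = (\<lambda>k. 0)"
    "(\<lambda>k. shift_coeff h k + r powi k * shift_coeff (1 / h) k) = (\<lambda>k. shift_coeff h k * (1 - (u\<^sup>2 / h\<^sup>2) powi k))"
  proof -
    show "(\<lambda>k. \<alpha> k + (1 / r) ^ k * \<alpha>' k) = (\<lambda>k. 0)"
      using h by (intro ext) (simp add: \<alpha>_def \<alpha>'_def r(4) power_divide pw power2_eq_square field_simps)
  qed (auto simp: shift_coeff_inverse r_def q algebra_simps)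
  have "commutator (e_current h u m) (e_current (1 / h) (1 / u) n) F \<nu> =
      commutator (vertex_current \<kappa> \<alpha> (shift_coeff h) m) (vertex_current \<kappa>' \<alpha>' (shift_coeff (1 / h)) n) F \<nu>"
    by (simp only: e_current_def t \<kappa>_def \<kappa>'_def \<alpha>_def \<alpha>'_def q(2))
  also have "\<dots> = \<kappa> * \<kappa>' * A * (psi_plus h u (m + n) F \<nu> - r powi n * psi_minus h u (m + n) F \<nu>)"
    unfolding commutator_vertex_current[OF F r(1) \<phi>] psi_plus_eq[OF F] psi_minus_eq[OF F] c
    by (simp only: \<alpha>_def \<alpha>'_def q(2))
  \<comment> \<open>The numerator (1 - t)(1 - 1/q) of \<open>A\<close> cancels against the prefactor
    of \<ff>; what is left are the three factors of g(1, 1).\<close>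
  also have "\<kappa> * \<kappa>' * A = 1 / gpoly id q t 1 1"
  proof -
    have k: "\<kappa> = h / ((1 - q) * (1 - 1 / t))" "\<kappa>' = 1 / h / ((1 - 1 / q) * (1 - t))"
      by (simp_all add: \<kappa>_def \<kappa>'_def q power_one_over)
    have nz: "1 - q \<noteq> 0" "1 - t \<noteq> 0" "1 - 1 / q \<noteq> 0" "1 - 1 / t \<noteq> 0" "1 - r \<noteq> 0"
      using h r by auto
    have "\<kappa> * \<kappa>' * A = 1 / ((1 - q) * (1 - 1 / t) * (1 - r))"
      unfolding k A_def using nz h(1) by simp
    then show ?thesis by (simp add: gpoly_def r_def)
  qed
  also have "psi_plus h u (m + n) F \<nu> - r powi n * psi_minus h u (m + n) F \<nu> =
      delta_times 1 (psi_plus h u) m n F \<nu> - delta_times (q / t) (psi_minus h u) m n F \<nu>"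
    by (simp add: delta_times_def r_def power_int_minus power_int_divide_distrib)
  finally show ?thesis .
qed

text \<open>For k > 0 the factor p_k + c_k z^-k has no positive power of z, and products preserve
  this.\<close>

lemma plethysm_positive_power_sums:
  assumes "\<forall>\<mu>. F \<mu> \<noteq> 0 \<longrightarrow> (\<forall>k\<in>Poly_Mapping.keys \<mu>. k > 0)" and "n > 0"
  shows "plethysm c F n \<nu> = 0"
proof -
  have neg: "lk X i = 0" if "X \<in> {X. \<forall>i>0. lk X i = 0}" "i > 0" for X :: "int \<Rightarrow>\<^sub>0 ps_poly" and i
    using that by simp
  have mult: "X * Y \<in> {X. \<forall>i>0. lk X i = 0}"
    if "X \<in> {X. \<forall>i>0. lk X i = 0}" "Y \<in> {X. \<forall>i>0. lk X i = 0}" for X Y :: "int \<Rightarrow>\<^sub>0 ps_poly"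
  proof -
    have "lk X a * lk Y (i - a) = 0" if "i > 0" for i a
      using neg[OF \<open>X \<in> _\<close>, of a] neg[OF \<open>Y \<in> _\<close>, of "i - a"] that by (cases "a > 0") auto
    then have "lk (X * Y) i = 0" if "i > 0" for i
      unfolding lookup_mult_group using that by (intro sum.neutral) blast
    then show ?thesis by simp
  qed
  have one: "1 \<in> {X :: int \<Rightarrow>\<^sub>0 ps_poly. \<forall>i>0. lk X i = 0}" by (simp add: lookup_one)
  have pow: "X ^ m \<in> {X. \<forall>i>0. lk X i = 0}" if "X \<in> {X. \<forall>i>0. lk X i = 0}"
    for X :: "int \<Rightarrow>\<^sub>0 ps_poly" and m
    using that one mult by (induction m) (simp_all only: power_0 power_Suc)
  have prod: "prod f S \<in> {X :: int \<Rightarrow>\<^sub>0 ps_poly. \<forall>i>0. lk X i = 0}"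
    if "\<And>s. s \<in> S \<Longrightarrow> f s \<in> {X. \<forall>i>0. lk X i = 0}" for f and S :: "int set"
    using that
  proof (induction S rule: infinite_finite_induct)
    case (infinite A)
    show ?case unfolding prod.infinite[OF infinite(1)] by (rule one)
  next
    case (insert x A)
    show ?case unfolding prod.insert[OF insert.hyps]
      by (rule mult[OF insert.prems insert.IH[OF insert.prems]]) simp_all
  qed (simp only: prod.empty one)
  have "F \<mu> * lk (lk (subst_monomial c \<mu>) n) \<nu> = 0" for \<mu>
  proof (cases "F \<mu> = 0")
    case False
    have "subst_monomial c \<mu> \<in> {X. \<forall>i>0. lk X i = 0}"
      unfolding subst_monomial_def
    proof (intro prod pow)
      fix k assume "k \<in> Poly_Mapping.keys \<mu>"
      then have "k > 0" using assms(1) False by blast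
      then show "cst (pvar k) + Poly_Mapping.single (- k) (cst (c k)) \<in> {X. \<forall>i>0. lk X i = 0}"
        by (auto simp: lookup_add cst_def[of "pvar k"] lookup_single)
    qed
    then show ?thesis using assms(2) by simp
  qed simp
  then have "(\<lambda>\<mu>. F \<mu> * lk (lk (subst_monomial c \<mu>) n) \<nu>) = (\<lambda>\<mu>. 0)" by (rule ext)
  then have "plethysm c F n \<nu> = Sum_any (\<lambda>\<mu> :: monomial. 0)" by (simp only: plethysm_def)
  then show ?thesis by simp
qed

theorem theorem4p5:
  fixes h u q t :: complex
  assumes "generic h u" and "q = h\<^sup>2" and "t = u\<^sup>2"
  shows
    \<comment> \<open>the currents act on functions, and \<open>\<ee>\<^sub>\<infinity>\<close> is the limit of the finite currents\<close>
    "(\<forall>F\<in>functions_X. \<forall>n. e_inf h u n F \<in> functions_X \<and> f_inf h u n F \<in> functions_X \<and>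
        psi_plus h u n F \<in> functions_X \<and> psi_minus h u n F \<in> functions_X) \<and>
     (cmod t > 1 \<longrightarrow> (\<forall>F\<in>functions_X. \<forall>n \<nu>.
        (\<lambda>N. u powi (1 - int N) * e_finite h u N n F \<nu>) \<longlonglongrightarrow> e_inf h u n F \<nu>)) \<and>
     \<comment> \<open>explicit formulas\<close>
     (\<forall>F\<in>functions_X. \<forall>n \<nu>. e_inf h u n F \<nu> =
        h / ((1 - q) * (1 - 1 / t)) *
          mult_z (in_z (ratio (scale_arg (h / t) C_inf) (scale_arg h C_inf)))
                 (plethysm (shift_coeff h) F) n \<nu>) \<and>
     (\<forall>F\<in>functions_X. \<forall>n \<nu>. f_inf h u n F \<nu> =
        1 / h / ((1 - 1 / q) * (1 - t)) *
          mult_z (in_z (ratio (scale_arg (t / h) C_inf) (scale_arg (1 / h) C_inf)))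
                 (plethysm (\<lambda>k. - shift_coeff h k) F) n \<nu>) \<and>
     \<comment> \<open>commutation relations\<close>
     (\<forall>F\<in>functions_X. \<forall>m n \<nu>. commutator (e_inf h u m) (f_inf h u n) F \<nu> =
        1 / gpoly id q t 1 1 *
          (delta_times 1 (psi_plus h u) m n F \<nu> - delta_times (q / t) (psi_minus h u) m n F \<nu>)) \<and>
     (let g = gpoly cst q t; z = zvar; w = wvar; z' = cst (q / t) * zvar in
        exchange (- g w z) (g z w) (e_inf h u) (e_inf h u) \<and>
        exchange (- g z w) (g w z) (f_inf h u) (f_inf h u) \<and>
        exchange (- g w z) (g z w) (psi_plus h u) (e_inf h u) \<and>
        exchange (- g w z) (g z w) (psi_minus h u) (e_inf h u) \<and>
        exchange (- g z w) (g w z) (psi_plus h u) (f_inf h u) \<and>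
        exchange (- g z' w) (g w z') (psi_minus h u) (f_inf h u) \<and>
        exchange (g w z * g z' w) (g z w * g w z') (psi_minus h u) (psi_plus h u)) \<and>
     \<comment> \<open>on symmetric functions, i.e. series in the \<open>p\<^sub>k\<close> with \<open>k > 0\<close>, \<open>\<psi>\<^sup>-\<^sub>\<infinity>\<close> is a power series in \<open>1/z\<close>\<close>
     (\<forall>F\<in>functions_X. (\<forall>\<mu>. F \<mu> \<noteq> 0 \<longrightarrow> (\<forall>k\<in>Poly_Mapping.keys \<mu>. k > 0)) \<longrightarrow>
        (\<forall>n>0. \<forall>\<nu>. psi_minus h u n F \<nu> = 0)) \<and>
     \<comment> \<open>Serre relations\<close>
     serre_relation (e_inf h u) \<and> serre_relation (f_inf h u)"
proof -
  have h: "h \<noteq> 0" "u \<noteq> 0" using assms(1) by (auto simp: generic_def)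
  have e: "e_inf h u n F = e_current h u n F" and f: "f_inf h u n F = e_current (1 / h) (1 / u) n F"
    if "F \<in> functions_X" for n F
    using e_inf_eq[OF that assms(1)] f_inf_eq[OF that assms(1)] by (simp_all add: fun_eq_iff)
  have FX: "e_current h' u' n F \<in> functions_X" if "F \<in> functions_X" for h' u' n F
    unfolding e_current_def using that by (rule vertex_current_functions_X)
  note pp = psi_plus_eq[of _ h u, folded assms(3)]
  note pm = psi_minus_eq[of _ h u, folded assms(2,3)]
  have c1: "e_inf h u n F \<in> functions_X" "f_inf h u n F \<in> functions_X"
    "psi_plus h u n F \<in> functions_X" "psi_minus h u n F \<in> functions_X" if "F \<in> functions_X" for F n
    using that by (simp_all add: e f FX pp pm vertex_current_functions_X)
  have c2: "(\<lambda>N. u powi (1 - int N) * e_finite h u N n F \<nu>) \<longlonglongrightarrow> e_inf h u n F \<nu>"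
    if "cmod t > 1" "F \<in> functions_X" for F n \<nu>
    using e_finite_tendsto[OF that(2) assms(1)] that(1) by (simp add: e[OF that(2)] assms(3))
  have c3: "e_inf h u n F \<nu> = h / ((1 - q) * (1 - 1 / t)) *
          mult_z (in_z (ratio (scale_arg (h / t) C_inf) (scale_arg h C_inf)))
                 (plethysm (shift_coeff h) F) n \<nu>" if "F \<in> functions_X" for F n \<nu>
    by (simp only: e[OF that] e_current_eq[OF that] assms(2,3))
  have c4: "f_inf h u n F \<nu> = 1 / h / ((1 - 1 / q) * (1 - t)) *
          mult_z (in_z (ratio (scale_arg (t / h) C_inf) (scale_arg (1 / h) C_inf)))
                 (plethysm (\<lambda>k. - shift_coeff h k) F) n \<nu>" if "F \<in> functions_X" for F n \<nu>
  proof -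
    have "shift_coeff (1 / h) = (\<lambda>k. - shift_coeff h k)" by (rule ext) (rule shift_coeff_inverse)
    moreover have "(1 / h)\<^sup>2 = 1 / q" "1 / (1 / u)\<^sup>2 = t" "1 / h / (1 / u)\<^sup>2 = t / h"
      by (simp_all add: assms(2,3) power_one_over)
    ultimately show ?thesis by (simp only: f[OF that] e_current_eq[OF that])
  qed
  have c5: "commutator (e_inf h u m) (f_inf h u n) F \<nu> = 1 / gpoly id q t 1 1 *
          (delta_times 1 (psi_plus h u) m n F \<nu> - delta_times (q / t) (psi_minus h u) m n F \<nu>)"
    if "F \<in> functions_X" for F m n \<nu>
    using commutator_e_f_current[OF assms that, of m n \<nu>] that by (simp add: commutator_def e f FX)
  note VF = vertex_current_functions_X
  have c6: "let g = gpoly cst q t; z = zvar; w = wvar; z' = cst (q / t) * zvar in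
        exchange (- g w z) (g z w) (e_inf h u) (e_inf h u) \<and>
        exchange (- g z w) (g w z) (f_inf h u) (f_inf h u) \<and>
        exchange (- g w z) (g z w) (psi_plus h u) (e_inf h u) \<and>
        exchange (- g w z) (g z w) (psi_minus h u) (e_inf h u) \<and>
        exchange (- g z w) (g w z) (psi_plus h u) (f_inf h u) \<and>
        exchange (- g z' w) (g w z') (psi_minus h u) (f_inf h u) \<and>
        exchange (g w z * g z' w) (g z w * g w z') (psi_minus h u) (psi_plus h u)"
    unfolding Let_def
  proof (intro conjI)
    show "exchange (- gpoly cst q t wvar zvar) (gpoly cst q t zvar wvar) (e_inf h u) (e_inf h u)"
      by (rule exchange_cong[OF exchange_e_current[OF h assms(2,3)]]; (rule e FX)?; assumption)
    show "exchange (- gpoly cst q t zvar wvar) (gpoly cst q t wvar zvar) (f_inf h u) (f_inf h u)"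
      by (rule exchange_cong[OF exchange_f_current[OF h assms(2,3)]]; (rule f FX)?; assumption)
    show "exchange (- gpoly cst q t wvar zvar) (gpoly cst q t zvar wvar) (psi_plus h u) (e_inf h u)"
      by (rule exchange_cong[OF exchange_psi(1)[OF h assms(2,3)]]; (rule pp e FX VF)?; assumption)
    show "exchange (- gpoly cst q t wvar zvar) (gpoly cst q t zvar wvar) (psi_minus h u) (e_inf h u)"
      by (rule exchange_cong[OF exchange_psi(2)[OF h assms(2,3)]]; (rule pm e FX VF)?; assumption)
    show "exchange (- gpoly cst q t zvar wvar) (gpoly cst q t wvar zvar) (psi_plus h u) (f_inf h u)"
      by (rule exchange_cong[OF exchange_psi(3)[OF h assms(2,3)]]; (rule pp f FX VF)?; assumption)
    show "exchange (- gpoly cst q t (cst (q / t) * zvar) wvar) (gpoly cst q t wvar (cst (q / t) * zvar))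
        (psi_minus h u) (f_inf h u)"
      by (rule exchange_cong[OF exchange_psi(4)[OF h assms(2,3)]]; (rule pm f FX VF)?; assumption)
    show "exchange (gpoly cst q t wvar zvar * gpoly cst q t (cst (q / t) * zvar) wvar)
        (gpoly cst q t zvar wvar * gpoly cst q t wvar (cst (q / t) * zvar)) (psi_minus h u) (psi_plus h u)"
      by (rule exchange_cong[OF exchange_psi(5)[OF h assms(2,3)]]; (rule pp pm VF)?; assumption)
  qed
  have c7: "\<forall>F\<in>functions_X. (\<forall>\<mu>. F \<mu> \<noteq> 0 \<longrightarrow> (\<forall>k\<in>Poly_Mapping.keys \<mu>. k > 0)) \<longrightarrow>
        (\<forall>n>0. \<forall>\<nu>. psi_minus h u n F \<nu> = 0)"
    by (simp add: psi_minus_def plethysm_positive_power_sums)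
  have h': "1 / h \<noteq> 0" "1 / u \<noteq> 0" using h by simp_all
  have c8: "serre_relation (e_inf h u)"
    by (rule serre_relation_cong[OF serre_relation_e_current[OF h]]; (rule e FX)?; assumption)
  have c9: "serre_relation (f_inf h u)"
    by (rule serre_relation_cong[OF serre_relation_e_current[OF h']]; (rule f FX)?; assumption)
  show ?thesis
    by (intro conjI c6 c7 c8 c9; intro ballI allI impI conjI c1 c2 c3 c4 c5; assumption)
qed

end
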